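(* Let $v_\epsilon\in L^2((0,T),L^2(\Omega_{*,\epsilon}^M))\cap H^1((0,T),(\mathcal H_{\epsilon,0}^M)')$. Then $\mathcal T_\epsilon v_\epsilon\in H^1((0,T),L^2(\Sigma,\mathcal H_0)')$ with $$\langle\partial_t\mathcal T_\epsilon v_\epsilon(t),\phi\rangle_{L^2(\Sigma,\mathcal H_0)',L^2(\Sigma,\mathcal H_0)}=\frac1\epsilon\langle\partial_tv_\epsilon(t),\mathcal U_\epsilon\phi\rangle_{(\mathcal H_{\epsilon,0}^M)',\mathcal H_{\epsilon,0}^M}$$ for all $\phi\in L^2(\Sigma,\mathcal H_0)$ and almost every $t\in(0,T)$. Additionally, $$\|\partial_t\mathcal T_\epsilon v_\epsilon\|_{L^2((0,T),L^2(\Sigma,\mathcal H_0)')}\le\frac1\epsilon\|\partial_tv_\epsilon\|_{L^2((0,T),(\mathcal H_{\epsilon,0}^M)')}.$$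
   Context: Geometry. Let $n\ge 2$, $H,T>0$, and let $\epsilon>0$ with $\epsilon^{-1}\in\mathbb N$. Write $x=(\bar x,x_n)\in\mathbb R^{n-1}\times\mathbb R$. $\Sigma\subset\mathbb R^{n-1}$ is a bounded, connected, open set with Lipschitz boundary; $\Omega_\epsilon^M=\Sigma\times(-\epsilon,\epsilon)$. $Y=(0,1)^{n-1}$, $Z=Y\times(-1,1)$, $S^\pm=Y\times\{\pm1\}$. $Z^*\subset Z$ is a connected open Lipschitz domain such that $S_*^\pm=\{y\in\partial Z^*:y_n=\pm1\}$ is a Lipschitz domain in $\mathbb R^{n-1}$ with positive measure; $N=\partial Z^*\setminus(S_*^+\cup S_*^-)$ has positive distance to $\partial Z\setminus(S^+\cup S^-)$. $I_\epsilon=\{\bar k\in\mathbb Z^{n-1}:\epsilon(Z+(\bar k,0))\subset\Omega_\epsilon^M\}$, $\Omega_{*,\epsilon}^M=\bigcup_{\bar k\in I_\epsilon}\epsilon(Z^*+(\bar k,0))$, $S_{*,\epsilon}^\pm=\bigcup_{\bar k\in I_\epsilon}\epsilon(S_*^\pm+(\bar k,0))$. The domain $\Omega_\epsilon=(\Sigma\times(\epsilon,H))\cup(\Sigma\times(-H,-\epsilon))\cup\Omega_{*,\epsilon}^M\cup S_{*,\epsilon}^+\cup S_{*,\epsilon}^-$ is assumed Lipschitz. Spaces. $\mathcal H_{\epsilon,0}^M=\{v\in H^1(\Omega_{*,\epsilon}^M):v|_{S_{*,\epsilon}^\pm}=0\}$ with inner product $\frac1\epsilon(w,v)_{L^2(\Omega_{*,\epsilon}^M)}+\epsilon(\nabla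 w,\nabla v)_{L^2(\Omega_{*,\epsilon}^M)}$; $\mathcal H_0=\{v\in H^1(Z^* ):v|_{S_*^\pm}=0\}$ with the $H^1(Z^* )$-norm. Time derivatives are generalized derivatives in the Gelfand triples $\mathcal H_{\epsilon,0}^M\hookrightarrow L^2(\Omega_{*,\epsilon}^M)\hookrightarrow(\mathcal H_{\epsilon,0}^M)'$ and $L^2(\Sigma,\mathcal H_0)\hookrightarrow L^2(\Sigma\times Z^* )\hookrightarrow L^2(\Sigma,\mathcal H_0)'$, with the usual (unweighted) $L^2$ inner products on the pivot spaces. Operators. The unfolding operator is $\mathcal T_\epsilon:L^2(\Omega_{*,\epsilon}^M)\to L^2(\Sigma\times Z^* )$, $\mathcal T_\epsilon v(\bar x,y)=v(\epsilon([\bar x/\epsilon],0)+\epsilon y)$, where $[\cdot]$ is the componentwise integer part and $v$ is extended by zero outside $\Omega_{*,\epsilon}^M$; on time-dependent functions it acts pointwise in $t$. The averaging operator $\mathcal U_\epsilon:L^2(\Sigma\times Z^* )\to L^2(\Omega_{*,\epsilon}^M)$ is defined by $(\mathcal T_\epsilon v,\phi)_{L^2(\Sigma\times Z^* )}=\frac1\epsilon(v,\mathcal U_\epsilon\phi)_{L^2(\Omega_{*,\epsilon}^M)}$ for all $v,\phi$ (i.e. $\epsilon^{-1}\mathcal U_\epsilon$ is the $L^2$-adjoint of $\mathcal T_\epsilon$); explicitly, $\mathcal U_\epsilon\phi(x)=\int_Y\phi\big(\epsilon(\bar z+[\bar x/\epsilon]),(\{\bar x/\epsilon\},x_n/\epsilon)\big)d\bar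 z$ with $\{a\}=a-[a]$. It maps $L^2(\Sigma,\mathcal H_0)$ into $\mathcal H_{\epsilon,0}^M$. *)

theory Defs
  imports "HOL-Analysis.Analysis"
begin

text \<open>
  Elements of function spaces are represented by functions; two representatives stand for the same
  element when the (semi)norm of their difference vanishes.  Since the underlying domains are term
  parameters, normed spaces are given by a carrier together with its norm.
\<close>

datatype 'x fspace = FSpace (elts: "('x \<Rightarrow> real) set") (nrm: "('x \<Rightarrow> real) \<Rightarrow> real")


subsection \<open>Square integrable functions, test functions, Sobolev spaces\<close>

definition l2_on :: "'a::euclidean_space set \<Rightarrow> ('a \<Rightarrow> real) set" where
  "l2_on S = {f \<in> borel_measurable (lebesgue_on S). integrable (lebesgue_on S) (\<lambda>x. (f x)\<^sup>2)}"

definition l2_inner :: "'a::euclidean_space set \<Rightarrow> ('a \<Rightarrow> real) \<Rightarrow> ('a \<Rightarrow> real) \<Rightarrow> real" where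
  "l2_inner S f g = (LINT x|lebesgue_on S. f x * g x)"

definition l2_norm :: "'a::euclidean_space set \<Rightarrow> ('a \<Rightarrow> real) \<Rightarrow> real" where
  "l2_norm S f = sqrt (l2_inner S f f)"

definition L2 :: "'a::euclidean_space set \<Rightarrow> 'a fspace" where
  "L2 S = FSpace (l2_on S) (l2_norm S)"

primrec Ck :: "nat \<Rightarrow> ('a::euclidean_space \<Rightarrow> real) \<Rightarrow> bool" where
  "Ck 0 f \<longleftrightarrow> continuous_on UNIV f"
| "Ck (Suc k) f \<longleftrightarrow> f differentiable_on UNIV \<and>
     (\<forall>b\<in>Basis. Ck k (\<lambda>x. frechet_derivative f (at x) b))"

definition test_functions :: "'a::euclidean_space set \<Rightarrow> ('a \<Rightarrow> real) set" where
  "test_functions S = {\<psi>. (\<forall>k. Ck k \<psi>) \<and> compact (closure {x. \<psi> x \<noteq> 0}) \<and> closure {x. \<psi> x \<noteq> 0} \<subseteq> S}"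

definition weak_gradient ::
    "'a::euclidean_space set \<Rightarrow> ('a \<Rightarrow> real) \<Rightarrow> ('a \<Rightarrow> 'a) \<Rightarrow> bool" where
  "weak_gradient S u g \<longleftrightarrow>
     (\<forall>b\<in>Basis. (\<lambda>x. g x \<bullet> b) \<in> l2_on S \<and>
       (\<forall>\<psi>\<in>test_functions S.
          (LINT x|lebesgue_on S. u x * frechet_derivative \<psi> (at x) b) =
          - (LINT x|lebesgue_on S. (g x \<bullet> b) * \<psi> x)))"

definition h1_on :: "'a::euclidean_space set \<Rightarrow> ('a \<Rightarrow> real) set" where
  "h1_on S = {u \<in> l2_on S. \<exists>g. weak_gradient S u g}"

definition grad :: "'a::euclidean_space set \<Rightarrow> ('a \<Rightarrow> real) \<Rightarrow> 'a \<Rightarrow> 'a" where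
  "grad S u = (SOME g. weak_gradient S u g)"

definition h1_inner ::
    "real \<Rightarrow> real \<Rightarrow> 'a::euclidean_space set \<Rightarrow> ('a \<Rightarrow> real) \<Rightarrow> ('a \<Rightarrow> real) \<Rightarrow> real" where
  "h1_inner a b S u v =
     a * l2_inner S u v + b * (LINT x|lebesgue_on S. grad S u x \<bullet> grad S v x)"

definition h1_norm :: "real \<Rightarrow> real \<Rightarrow> 'a::euclidean_space set \<Rightarrow> ('a \<Rightarrow> real) \<Rightarrow> real" where
  "h1_norm a b S u = sqrt (h1_inner a b S u u)"

text \<open>
  The trace on a flat boundary piece \<open>G\<close> contained in \<open>{x. x\<^sub>n = c}\<close>, as the continuous extension of
  the restriction map from \<open>H\<^sup>1(S) \<inter> C(closure S)\<close>.  The surface measure on \<open>G\<close> is the Lebesgue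
  measure of the hyperplane.
\<close>

definition has_flat_trace ::
    "('a::euclidean_space \<times> real) set \<Rightarrow> ('a \<times> real) set \<Rightarrow> real \<Rightarrow> ('a \<times> real \<Rightarrow> real) \<Rightarrow> ('a \<Rightarrow> real)
      \<Rightarrow> bool" where
  "has_flat_trace S G c v h \<longleftrightarrow>
     h \<in> l2_on {x. (x, c) \<in> G} \<and>
     (\<exists>u :: nat \<Rightarrow> 'a \<times> real \<Rightarrow> real.
        (\<forall>k. u k \<in> h1_on S \<and> continuous_on (closure S) (u k)) \<and>
        (\<lambda>k. h1_norm 1 1 S (\<lambda>x. u k x - v x)) \<longlonglongrightarrow> 0 \<and>
        (\<lambda>k. l2_norm {x. (x, c) \<in> G} (\<lambda>x. u k (x, c) - h x)) \<longlonglongrightarrow> 0)"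


subsection \<open>Duals and Bochner spaces\<close>

text \<open>A functional is only relevant through its values on the carrier.\<close>

definition dual :: "'x fspace \<Rightarrow> ('x \<Rightarrow> real) fspace" where
  "dual X = FSpace
     {F. (\<forall>u\<in>elts X. \<forall>v\<in>elts X. \<forall>a b. F (\<lambda>x. a * u x + b * v x) = a * F u + b * F v) \<and>
         (\<exists>C. \<forall>v\<in>elts X. \<bar>F v\<bar> \<le> C * nrm X v)}
     (\<lambda>F. SUP v\<in>{v \<in> elts X. nrm X v \<le> 1}. \<bar>F v\<bar>)"

definition strongly_measurable :: "'s measure \<Rightarrow> 'x fspace \<Rightarrow> ('s \<Rightarrow> 'x \<Rightarrow> real) \<Rightarrow> bool" where
  "strongly_measurable M X f \<longleftrightarrow>
     (\<exists>s :: nat \<Rightarrow> 's \<Rightarrow> 'x \<Rightarrow> real.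
        (\<forall>k. simple_function M (s k) \<and> s k ` space M \<subseteq> elts X) \<and>
        (AE t in M. (\<lambda>k. nrm X (\<lambda>x. s k t x - f t x)) \<longlonglongrightarrow> 0))"

definition bochner_l2 :: "'s measure \<Rightarrow> 'x fspace \<Rightarrow> ('s \<Rightarrow> 'x \<Rightarrow> real) set" where
  "bochner_l2 M X =
     {f. (AE t in M. f t \<in> elts X) \<and> strongly_measurable M X f \<and>
         integrable M (\<lambda>t. (nrm X (f t))\<^sup>2)}"

definition bochner_l2_norm :: "'s measure \<Rightarrow> 'x fspace \<Rightarrow> ('s \<Rightarrow> 'x \<Rightarrow> real) \<Rightarrow> real" where
  "bochner_l2_norm M X f = sqrt (LINT t|M. (nrm X (f t))\<^sup>2)"

text \<open>
  The Bochner integral, following \<^const>\<open>has_bochner_integral\<close> (which needs a normed vector space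
  type).
\<close>

definition simple_integral_in :: "'s measure \<Rightarrow> ('s \<Rightarrow> 'x \<Rightarrow> real) \<Rightarrow> 'x \<Rightarrow> real" where
  "simple_integral_in M s = (\<lambda>x. \<Sum>c\<in>s ` space M. measure M {t \<in> space M. s t = c} * c x)"

definition has_integral_in ::
    "'s measure \<Rightarrow> 'x fspace \<Rightarrow> ('s \<Rightarrow> 'x \<Rightarrow> real) \<Rightarrow> ('x \<Rightarrow> real) \<Rightarrow> bool" where
  "has_integral_in M X f J \<longleftrightarrow>
     (AE t in M. f t \<in> elts X) \<and> strongly_measurable M X f \<and> J \<in> elts X \<and>
     (\<exists>s :: nat \<Rightarrow> 's \<Rightarrow> 'x \<Rightarrow> real.
        (\<forall>k. simple_function M (s k) \<and> s k ` space M \<subseteq> elts X \<and>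
             emeasure M {t \<in> space M. s k t \<noteq> (\<lambda>x. 0)} < \<infinity>) \<and>
        (\<lambda>k. \<integral>\<^sup>+ t. ennreal (nrm X (\<lambda>x. f t x - s k t x)) \<partial>M) \<longlonglongrightarrow> 0 \<and>
        (\<lambda>k. nrm X (\<lambda>x. simple_integral_in M (s k) x - J x)) \<longlonglongrightarrow> 0)"

text \<open>\<open>w\<close> is the generalized derivative of \<open>u\<close>, both in \<open>L\<^sup>2((0,T), X)\<close>.\<close>

definition has_time_deriv ::
    "real \<Rightarrow> 'x fspace \<Rightarrow> (real \<Rightarrow> 'x \<Rightarrow> real) \<Rightarrow> (real \<Rightarrow> 'x \<Rightarrow> real) \<Rightarrow> bool" where
  "has_time_deriv T X u w \<longleftrightarrow>
     u \<in> bochner_l2 (lebesgue_on {0<..<T}) X \<and> w \<in> bochner_l2 (lebesgue_on {0<..<T}) X \<and>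
     (\<forall>\<psi>\<in>test_functions {0<..<T}. \<exists>J.
        has_integral_in (lebesgue_on {0<..<T}) X (\<lambda>t x. deriv \<psi> t * u t x) J \<and>
        has_integral_in (lebesgue_on {0<..<T}) X (\<lambda>t x. \<psi> t * w t x) (\<lambda>x. - J x))"

definition bochner_h1 :: "real \<Rightarrow> 'x fspace \<Rightarrow> (real \<Rightarrow> 'x \<Rightarrow> real) set" where
  "bochner_h1 T X = {u. \<exists>w. has_time_deriv T X u w}"

text \<open>
  The embedding of the pivot space of a Gelfand triple \<open>V \<hookrightarrow> L\<^sup>2(S) \<hookrightarrow> V'\<close> into \<open>V'\<close>.
\<close>

definition pivot :: "'a::euclidean_space set \<Rightarrow> ('a \<Rightarrow> real) \<Rightarrow> ('a \<Rightarrow> real) \<Rightarrow> real" where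
  "pivot S u = (\<lambda>w. l2_inner S u w)"


subsection \<open>Geometry\<close>

definition lipschitz_domain :: "'a::euclidean_space set \<Rightarrow> bool" where
  "lipschitz_domain S \<longleftrightarrow> open S \<and> bounded S \<and>
     (\<forall>p\<in>frontier S. \<exists>e \<gamma> C r. norm e = 1 \<and> r > 0 \<and> C-lipschitz_on {x. x \<bullet> e = 0} \<gamma> \<and>
        S \<inter> ball p r = {x \<in> ball p r. x \<bullet> e < \<gamma> (x - (x \<bullet> e) *\<^sub>R e)})"

text \<open>
  Points of \<open>\<real>\<^sup>n\<close>, \<open>n \<ge> 2\<close>, are pairs, the type \<open>'d\<close> indexing the first \<open>n - 1\<close> coordinates.
  \<open>Zs\<close> stands for \<open>Z\<^sup>*\<close>, and \<open>full_cell\<close> for \<open>Z\<close>.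
\<close>

type_synonym 'd pt = "(real ^ 'd) \<times> real"

definition unit_cube :: "(real ^ 'd) set" where
  "unit_cube = {y. \<forall>i. 0 < y $ i \<and> y $ i < 1}"

definition full_cell :: "'d::finite pt set" where
  "full_cell = unit_cube \<times> {-1<..<1}"

definition cell_face :: "'d::finite pt set \<Rightarrow> real \<Rightarrow> (real ^ 'd) set" where
  "cell_face Zs c = {y. (y, c) \<in> frontier Zs}"

text \<open>
  The set \<open>{y \<in> frontier Zs. y\<^sub>n = c}\<close> is closed.  As a Lipschitz (hence open) domain of the hyperplane
  it is taken without its relative boundary.
\<close>

definition interface :: "'d::finite pt set \<Rightarrow> real \<Rightarrow> 'd pt set" where
  "interface Zs c = interior (cell_face Zs c) \<times> {c}"

definition reference_cell :: "'d::finite pt set \<Rightarrow> bool" where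
  "reference_cell Zs \<longleftrightarrow>
     Zs \<subseteq> full_cell \<and> connected Zs \<and> lipschitz_domain Zs \<and>
     (\<forall>c\<in>{1, -1}. lipschitz_domain (interior (cell_face Zs c)) \<and>
        cell_face Zs c = closure (interior (cell_face Zs c)) \<and>
        measure lebesgue (interior (cell_face Zs c)) > 0) \<and>
     setdist (frontier Zs - (interface Zs 1 \<union> interface Zs (-1)))
       (frontier full_cell - (unit_cube \<times> {1} \<union> unit_cube \<times> {-1})) > 0"

definition of_ints :: "int ^ 'd \<Rightarrow> real ^ 'd" where
  "of_ints k = (\<chi> i. of_int (k $ i))"

definition scaled_shift :: "real \<Rightarrow> int ^ 'd \<Rightarrow> 'd::finite pt \<Rightarrow> 'd pt" where
  "scaled_shift \<epsilon> k y = \<epsilon> *\<^sub>R (y + (of_ints k, 0))"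

definition cell_indices :: "(real ^ 'd) set \<Rightarrow> real \<Rightarrow> (int ^ 'd::finite) set" where
  "cell_indices \<Sigma> \<epsilon> = {k. scaled_shift \<epsilon> k ` full_cell \<subseteq> \<Sigma> \<times> {-\<epsilon><..<\<epsilon>}}"

definition layer :: "(real ^ 'd) set \<Rightarrow> 'd::finite pt set \<Rightarrow> real \<Rightarrow> 'd pt set" where
  "layer \<Sigma> Zs \<epsilon> = (\<Union>k\<in>cell_indices \<Sigma> \<epsilon>. scaled_shift \<epsilon> k ` Zs)"

definition layer_interface ::
    "(real ^ 'd) set \<Rightarrow> 'd::finite pt set \<Rightarrow> real \<Rightarrow> real \<Rightarrow> 'd pt set" where
  "layer_interface \<Sigma> Zs \<epsilon> c = (\<Union>k\<in>cell_indices \<Sigma> \<epsilon>. scaled_shift \<epsilon> k ` interface Zs c)"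

definition whole_domain ::
    "(real ^ 'd) set \<Rightarrow> real \<Rightarrow> 'd::finite pt set \<Rightarrow> real \<Rightarrow> 'd pt set" where
  "whole_domain \<Sigma> H Zs \<epsilon> =
     \<Sigma> \<times> {\<epsilon><..<H} \<union> \<Sigma> \<times> {-H<..<-\<epsilon>} \<union> layer \<Sigma> Zs \<epsilon>
     \<union> layer_interface \<Sigma> Zs \<epsilon> 1 \<union> layer_interface \<Sigma> Zs \<epsilon> (-1)"


subsection \<open>Function spaces on the layer and on the cell\<close>

definition H_layer :: "(real ^ 'd) set \<Rightarrow> 'd::finite pt set \<Rightarrow> real \<Rightarrow> 'd pt fspace" where
  "H_layer \<Sigma> Zs \<epsilon> = FSpace
     {v \<in> h1_on (layer \<Sigma> Zs \<epsilon>).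
        has_flat_trace (layer \<Sigma> Zs \<epsilon>) (layer_interface \<Sigma> Zs \<epsilon> 1) \<epsilon> v (\<lambda>_. 0) \<and>
        has_flat_trace (layer \<Sigma> Zs \<epsilon>) (layer_interface \<Sigma> Zs \<epsilon> (-1)) (-\<epsilon>) v (\<lambda>_. 0)}
     (h1_norm (1 / \<epsilon>) \<epsilon> (layer \<Sigma> Zs \<epsilon>))"

definition H_cell :: "'d::finite pt set \<Rightarrow> 'd pt fspace" where
  "H_cell Zs = FSpace
     {v \<in> h1_on Zs. has_flat_trace Zs (interface Zs 1) 1 v (\<lambda>_. 0) \<and>
                   has_flat_trace Zs (interface Zs (-1)) (-1) v (\<lambda>_. 0)}
     (h1_norm 1 1 Zs)"

text \<open>
  \<open>L\<^sup>2(\<Sigma>, H)\<close>, with \<open>H\<close> the space \<^const>\<open>H_cell\<close>, as a subspace of \<open>L\<^sup>2(\<Sigma> \<times> Zs)\<close>: its elements are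
  represented by jointly measurable functions, so that the embedding is the identity.
\<close>

definition L2_H_cell :: "(real ^ 'd) set \<Rightarrow> 'd::finite pt set \<Rightarrow> ((real ^ 'd) \<times> 'd pt) fspace" where
  "L2_H_cell \<Sigma> Zs = FSpace
     {\<phi> \<in> l2_on (\<Sigma> \<times> Zs). (\<lambda>x y. \<phi> (x, y)) \<in> bochner_l2 (lebesgue_on \<Sigma>) (H_cell Zs)}
     (\<lambda>\<phi>. bochner_l2_norm (lebesgue_on \<Sigma>) (H_cell Zs) (\<lambda>x y. \<phi> (x, y)))"


subsection \<open>Unfolding and averaging\<close>

definition int_part :: "real ^ 'd \<Rightarrow> real ^ 'd" where
  "int_part a = (\<chi> i. of_int \<lfloor>a $ i\<rfloor>)"

definition frac_part :: "real ^ 'd \<Rightarrow> real ^ 'd" where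
  "frac_part a = a - int_part a"

definition unfolding_op ::
    "(real ^ 'd) set \<Rightarrow> 'd::finite pt set \<Rightarrow> real \<Rightarrow> ('d pt \<Rightarrow> real) \<Rightarrow> (real ^ 'd) \<times> 'd pt \<Rightarrow> real" where
  "unfolding_op \<Sigma> Zs \<epsilon> v = (\<lambda>(x, y).
     let z = \<epsilon> *\<^sub>R (int_part (x /\<^sub>R \<epsilon>), 0) + \<epsilon> *\<^sub>R y
     in if z \<in> layer \<Sigma> Zs \<epsilon> then v z else 0)"

text \<open>\<open>\<epsilon>\<close> times the \<open>L\<^sup>2\<close>-adjoint of \<^const>\<open>unfolding_op\<close>.\<close>

definition averaging_op :: "real \<Rightarrow> ((real ^ 'd) \<times> 'd::finite pt \<Rightarrow> real) \<Rightarrow> 'd pt \<Rightarrow> real" where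
  "averaging_op \<epsilon> \<phi> = (\<lambda>(x, xn).
     LINT z|lebesgue_on unit_cube.
       \<phi> (\<epsilon> *\<^sub>R (z + int_part (x /\<^sub>R \<epsilon>)), (frac_part (x /\<^sub>R \<epsilon>), xn / \<epsilon>)))"

end

theory Submission
  imports Defs
begin

text \<open>
  By Fubini and a change of variables on each cell, the unfolding operator and the averaging operator
  \<open>U\<close> are adjoint up to the factor \<open>\<epsilon>\<close>.  Moreover \<open>U\<close> maps \<open>L\<^sup>2(\<Sigma>, H)\<close> into the Sobolev space of the
  layer without increasing the norm: on a cell, \<open>U \<phi>\<close> is the rescaled mean of the \<open>H\<close>-valued function
  \<open>\<phi>\<close> over the base of the cell, which lies in \<open>H\<close> because \<open>H\<close> is complete, and the cells can be glued
  since their closures are disjoint.  Hence \<open>F \<mapsto> (\<lambda>\<phi>. F (U \<phi>) / \<epsilon>)\<close> is a bounded linear map between the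
  duals; such a map commutes with Bochner integrals, so it carries the derivative of \<open>v\<close> to a
  derivative of the unfolded function with the norm bound.  Derivatives are unique: by the fundamental
  lemma of the calculus of variations the difference of two of them vanishes, for almost all times, on
  a countable set of functions that norms its (essentially separable) range.
\<close>

subsection \<open>Seminormed spaces and duals\<close>

text \<open>The norm bound has constant 1 because of the weights in the layer norm: under x =
  \<epsilon>(y + k), both \<open>1 / \<epsilon>\<close> times the squared L2 norm and \<epsilon>
  times the squared gradient norm scale like the volume \<open>\<epsilon> ^ CARD('d)\<close> of a
  base cell, and this volume is what the Cauchy-Schwarz estimate of a cell mean absorbs. The closed
  cells are disjoint because the boundary of \<open>Zs\<close> off the two faces keeps a positive
  distance from the lateral boundary of \<open>full_cell\<close>. This matters for the traces: they
  are defined by approximants continuous up to the boundary, and gluing those must not create jumps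
  on a shared wall. Three identifications shape the statements. Elements are functions with a
  seminorm, so U is linear only up to differences of norm zero. Functionals count only through their
  values on the carrier, so two of them are compared only there. The exceptional null set of the
  fundamental lemma depends on the test element, so uniqueness for all elements at once has to be
  reached through countably many of them.\<close>

lemma dualI: assumes "\<And>u v a b. u \<in> elts X \<Longrightarrow> v \<in> elts X \<Longrightarrow> F (\<lambda>x. a * u x + b * v x) = a * F u + b * F v"
  "\<And>v. v \<in> elts X \<Longrightarrow> \<bar>F v\<bar> \<le> C * nrm X v"
  shows "F \<in> elts (dual X)"
  using assms unfolding dual_def fspace.sel by blast

lemma dual_linear: assumes "F \<in> elts (dual X)" "u \<in> elts X" "v \<in> elts X"
  shows "F (\<lambda>x. a * u x + b * v x) = a * F u + b * F v"
  using assms unfolding dual_def by auto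

lemma dual_diff: assumes "F \<in> elts (dual X)" "u \<in> elts X" "v \<in> elts X"
  shows "F (\<lambda>x. u x - v x) = F u - F v"
  using dual_linear[OF assms, of 1 "-1"] by simp

lemma dual_boundE: assumes "F \<in> elts (dual X)"
  obtains C where "\<And>v. v \<in> elts X \<Longrightarrow> \<bar>F v\<bar> \<le> C * nrm X v"
  using assms unfolding dual_def fspace.sel by blast

text \<open>One inequality bundles the triangle inequality with homogeneity. Nonnegativity and
  equality in the scaling law follow from it; definiteness is not assumed, because representatives
  may differ on null sets.\<close>

locale seminormed =
  fixes X :: "'x fspace"
  assumes zero_elts: "(\<lambda>x. 0) \<in> elts X"
    and comb_elts: "\<And>u v a b. u \<in> elts X \<Longrightarrow> v \<in> elts X \<Longrightarrow> (\<lambda>x. a * u x + b * v x) \<in> elts X"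
    and nrm_comb: "\<And>u v a b. u \<in> elts X \<Longrightarrow> v \<in> elts X \<Longrightarrow>
      nrm X (\<lambda>x. a * u x + b * v x) \<le> \<bar>a\<bar> * nrm X u + \<bar>b\<bar> * nrm X v"
begin

lemma scale_elts: "u \<in> elts X \<Longrightarrow> (\<lambda>x. a * u x) \<in> elts X"
  using comb_elts[of u u a 0] by simp

lemma diff_elts: "u \<in> elts X \<Longrightarrow> v \<in> elts X \<Longrightarrow> (\<lambda>x. u x - v x) \<in> elts X"
  using comb_elts[of u v 1 "-1"] by simp

text \<open>The instance a = b = 0 bounds the value above by 0; the instance a = b = 1 bounds it by
  twice itself, hence below by 0.\<close>

lemma nrm_zero: "nrm X (\<lambda>x. 0) = 0"
  using nrm_comb[OF zero_elts zero_elts, of 0 0] nrm_comb[OF zero_elts zero_elts, of 1 1] by simp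

lemma nrm_add: "u \<in> elts X \<Longrightarrow> v \<in> elts X \<Longrightarrow> nrm X (\<lambda>x. u x + v x) \<le> nrm X u + nrm X v"
  using nrm_comb[of u v 1 1] by simp

lemma nrm_diff: "u \<in> elts X \<Longrightarrow> v \<in> elts X \<Longrightarrow> nrm X (\<lambda>x. u x - v x) \<le> nrm X u + nrm X v"
  using nrm_comb[of u v 1 "-1"] by simp

lemma nrm_nonneg: "u \<in> elts X \<Longrightarrow> 0 \<le> nrm X u"
  using nrm_diff[of u u] nrm_zero by simp

lemma nrm_scale_le: "u \<in> elts X \<Longrightarrow> nrm X (\<lambda>x. a * u x) \<le> \<bar>a\<bar> * nrm X u"
  using nrm_comb[of u u a 0] by simp

lemma nrm_scale: assumes "u \<in> elts X" shows "nrm X (\<lambda>x. a * u x) = \<bar>a\<bar> * nrm X u"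
proof (cases "a = 0")
  case False
  have "nrm X (\<lambda>x. inverse a * (a * u x)) \<le> \<bar>inverse a\<bar> * nrm X (\<lambda>x. a * u x)"
    by (rule nrm_scale_le) (rule scale_elts[OF assms])
  then have "\<bar>a\<bar> * nrm X u \<le> nrm X (\<lambda>x. a * u x)"
    using False by (simp add: field_simps)
  then show ?thesis using nrm_scale_le[OF assms] by (intro antisym)
qed (simp add: nrm_zero)

lemma nrm_minus_commute: assumes "u \<in> elts X" "v \<in> elts X"
  shows "nrm X (\<lambda>x. u x - v x) = nrm X (\<lambda>x. v x - u x)"
  using nrm_scale[OF diff_elts[OF assms], of "-1"] by simp

lemma nrm_triangle: assumes "u \<in> elts X" "v \<in> elts X" "w \<in> elts X"
  shows "nrm X (\<lambda>x. u x - w x) \<le> nrm X (\<lambda>x. u x - v x) + nrm X (\<lambda>x. v x - w x)"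
  using nrm_add[OF diff_elts[OF assms(1,2)] diff_elts[OF assms(2,3)]] by simp

lemma nrm_diff_abs: assumes "u \<in> elts X" "v \<in> elts X"
  shows "\<bar>nrm X u - nrm X v\<bar> \<le> nrm X (\<lambda>x. u x - v x)"
  using nrm_add[OF diff_elts[OF assms] assms(2)] nrm_add[OF diff_elts[OF assms(2,1)] assms(1)]
    nrm_minus_commute[OF assms] by auto

lemma nrm_cong_zero: assumes "u \<in> elts X" "v \<in> elts X" "nrm X (\<lambda>x. u x - v x) = 0"
  shows "nrm X u = nrm X v"
  using nrm_diff_abs[OF assms(1,2)] assms(3) by simp

lemma sum_elts: "finite I \<Longrightarrow> (\<And>i. i \<in> I \<Longrightarrow> u i \<in> elts X) \<Longrightarrow>
    (\<lambda>x. \<Sum>i\<in>I. a i * u i x) \<in> elts X \<and> nrm X (\<lambda>x. \<Sum>i\<in>I. a i * u i x) \<le> (\<Sum>i\<in>I. \<bar>a i\<bar> * nrm X (u i))"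
proof (induction I rule: finite_induct)
  case empty then show ?case using zero_elts nrm_zero by simp
next
  case (insert i I)
  then have *: "(\<lambda>x. \<Sum>i\<in>I. a i * u i x) \<in> elts X" "u i \<in> elts X" by auto
  show ?case using insert comb_elts[OF *(2,1), of "a i" 1] nrm_comb[OF *(2,1), of "a i" 1] by simp
qed

lemma dual_bdd: assumes F: "F \<in> elts (dual X)"
  shows "bdd_above ((\<lambda>v. \<bar>F v\<bar>) ` {v \<in> elts X. nrm X v \<le> 1})"
proof -
  obtain C where C: "\<And>v. v \<in> elts X \<Longrightarrow> \<bar>F v\<bar> \<le> C * nrm X v" using dual_boundE[OF F] by blast
  show ?thesis
  proof (rule bdd_aboveI2)
    fix v assume v: "v \<in> {v \<in> elts X. nrm X v \<le> 1}"
    then have "\<bar>F v\<bar> \<le> C * nrm X v" using C by auto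
    \<comment> \<open>\<open>C\<close> may be negative when every element has norm zero.\<close>
    also have "\<dots> \<le> \<bar>C\<bar> * nrm X v" using v nrm_nonneg by (intro mult_right_mono) auto
    also have "\<dots> \<le> \<bar>C\<bar> * 1" using v by (intro mult_left_mono) auto
    finally show "\<bar>F v\<bar> \<le> \<bar>C\<bar> * 1" .
  qed
qed

text \<open>Scaling to the unit ball fails for elements of seminorm zero. There the bound with some
  constant \<open>C\<close> already forces the functional to vanish.\<close>

lemma dual_bound: assumes F: "F \<in> elts (dual X)" and v: "v \<in> elts X"
  shows "\<bar>F v\<bar> \<le> nrm (dual X) F * nrm X v"
proof -
  obtain C where C: "\<And>v. v \<in> elts X \<Longrightarrow> \<bar>F v\<bar> \<le> C * nrm X v" using dual_boundE[OF F] by blast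
  have scale: "F (\<lambda>x. a * u x) = a * F u" if "u \<in> elts X" for a u
  proof -
    have "F (\<lambda>x. a * u x + 0 * u x) = a * F u + 0 * F u" using F that by (intro dual_linear)
    then show ?thesis by simp
  qed
  have bdd: "bdd_above ((\<lambda>v. \<bar>F v\<bar>) ` {v \<in> elts X. nrm X v \<le> 1})" by (rule dual_bdd[OF F])
  show ?thesis
  proof (cases "nrm X v = 0")
    case True then show ?thesis using C[OF v] by simp
  next
    case False
    then have pos: "nrm X v > 0" using nrm_nonneg[OF v] by simp
    have "(\<lambda>x. inverse (nrm X v) * v x) \<in> {v \<in> elts X. nrm X v \<le> 1}"
      using scale_elts[OF v] nrm_scale[OF v] pos by simp
    then have "\<bar>F (\<lambda>x. inverse (nrm X v) * v x)\<bar> \<le> nrm (dual X) F"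
      unfolding dual_def fspace.sel by (rule cSUP_upper[OF _ bdd])
    then have "inverse (nrm X v) * \<bar>F v\<bar> \<le> nrm (dual X) F"
      unfolding scale[OF v] using pos by (simp add: abs_mult)
    then show ?thesis using pos by (simp add: field_simps)
  qed
qed

lemma nrm_dual_le: assumes "\<And>v. v \<in> elts X \<Longrightarrow> \<bar>F v\<bar> \<le> C * nrm X v" "0 \<le> C"
  shows "nrm (dual X) F \<le> C"
  unfolding dual_def fspace.sel
proof (rule cSUP_least)
  show "{v \<in> elts X. nrm X v \<le> 1} \<noteq> {}" using zero_elts nrm_zero by auto
  fix v assume "v \<in> {v \<in> elts X. nrm X v \<le> 1}"
  then show "\<bar>F v\<bar> \<le> C" using assms(1)[of v] assms(2) mult_left_mono[of "nrm X v" 1 C] by simp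
qed

lemma dual_nonneg: assumes F: "F \<in> elts (dual X)" shows "0 \<le> nrm (dual X) F"
proof -
  have bdd: "bdd_above ((\<lambda>v. \<bar>F v\<bar>) ` {v \<in> elts X. nrm X v \<le> 1})" by (rule dual_bdd[OF F])
  have "\<bar>F (\<lambda>x. 0)\<bar> \<le> nrm (dual X) F"
    unfolding dual_def fspace.sel by (rule cSUP_upper[OF _ bdd]) (simp add: zero_elts nrm_zero)
  then show ?thesis by linarith
qed

text \<open>Elements of the dual are functions on all of \<open>'x \<Rightarrow> real\<close> whose
  values off the carrier are arbitrary. This lemma replaces extensionality wherever two functionals
  describe the same element.\<close>

lemma dual_cong: assumes "F \<in> elts (dual X)" "\<And>v. v \<in> elts X \<Longrightarrow> G v = F v"
  shows "G \<in> elts (dual X)" "nrm (dual X) G = nrm (dual X) F"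
proof -
  obtain C where C: "\<And>v. v \<in> elts X \<Longrightarrow> \<bar>F v\<bar> \<le> C * nrm X v" using dual_boundE[OF assms(1)] by blast
  show "G \<in> elts (dual X)"
  proof (rule dualI)
    show "\<bar>G v\<bar> \<le> C * nrm X v" if "v \<in> elts X" for v using C[OF that] assms(2)[OF that] by simp
  qed (simp add: assms(2) comb_elts dual_linear[OF assms(1)])
  show "nrm (dual X) G = nrm (dual X) F"
    using assms(2) unfolding dual_def fspace.sel by (intro SUP_cong) auto
qed

lemma dual_near: assumes F: "F \<in> elts (dual X)" and e: "e > 0"
  obtains v where "v \<in> elts X" "nrm X v \<le> 1" "nrm (dual X) F - e < \<bar>F v\<bar>"
proof -
  have ne: "{v \<in> elts X. nrm X v \<le> 1} \<noteq> {}" using zero_elts nrm_zero by auto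
  have "nrm (dual X) F - e < (SUP v\<in>{v \<in> elts X. nrm X v \<le> 1}. \<bar>F v\<bar>)"
    using e by (simp add: dual_def)
  then have "\<exists>v\<in>{v \<in> elts X. nrm X v \<le> 1}. nrm (dual X) F - e < \<bar>F v\<bar>"
    unfolding less_cSUP_iff[OF ne dual_bdd[OF F]] .
  then show ?thesis using that by auto
qed

text \<open>With the dual again an instance of the locale, the theory of Bochner spaces below serves
  for the Sobolev spaces and for their duals alike.\<close>

lemma seminormed_dual: "seminormed (dual X)"
proof
  show "(\<lambda>x. 0) \<in> elts (dual X)" by (auto simp: dual_def intro!: exI[of _ 0])
next
  fix F G a b assume F: "F \<in> elts (dual X)" and G: "G \<in> elts (dual X)"
  have bd: "\<bar>a * F v + b * G v\<bar> \<le> (\<bar>a\<bar> * nrm (dual X) F + \<bar>b\<bar> * nrm (dual X) G) * nrm X v" if "v \<in> elts X" for v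
  proof -
    have "\<bar>a * F v + b * G v\<bar> \<le> \<bar>a\<bar> * \<bar>F v\<bar> + \<bar>b\<bar> * \<bar>G v\<bar>" by (metis abs_mult abs_triangle_ineq)
    also have "\<dots> \<le> \<bar>a\<bar> * (nrm (dual X) F * nrm X v) + \<bar>b\<bar> * (nrm (dual X) G * nrm X v)"
      by (intro add_mono mult_left_mono dual_bound F G that) auto
    finally show ?thesis by (simp add: algebra_simps)
  qed
  show "(\<lambda>x. a * F x + b * G x) \<in> elts (dual X)"
    by (rule dualI[OF _ bd]) (simp_all add: dual_linear[OF F] dual_linear[OF G] algebra_simps)
  show "nrm (dual X) (\<lambda>x. a * F x + b * G x) \<le> \<bar>a\<bar> * nrm (dual X) F + \<bar>b\<bar> * nrm (dual X) G"
    by (rule nrm_dual_le[OF bd]) (auto intro!: add_nonneg_nonneg mult_nonneg_nonneg dual_nonneg F G)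
qed

end

section \<open>Measurability on complete measure spaces and integrals of simple functions\<close>

lemma (in complete_measure) borel_measurable_AE_cong:
  assumes f: "f \<in> borel_measurable M" and ae: "AE x in M. f x = g x"
  shows "g \<in> borel_measurable M"
proof (rule measurableI)
  fix A :: "'b set" assume "A \<in> sets borel"
  then have "f -` A \<inter> space M \<in> sets M" using f by (auto intro: measurable_sets)
  moreover have "AE x in M. x \<in> f -` A \<inter> space M \<longleftrightarrow> x \<in> g -` A \<inter> space M"
    using ae by eventually_elim simp
  ultimately show "g -` A \<inter> space M \<in> sets M" using in_sets_AE[of "f -` A \<inter> space M"] by blast
qed auto

lemma complete_measure_lebesgue_on:
  assumes "S \<in> sets lebesgue" shows "complete_measure (lebesgue_on S)"
proof
  fix A B assume "B \<subseteq> A" "A \<in> null_sets (lebesgue_on S)"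
  then show "B \<in> sets (lebesgue_on S)"
    using assms completion.complete2[of B A lborel]
    by (auto simp: null_sets_restrict_space sets_restrict_space_iff)
qed

text \<open>\<open>lim\<close> is measurable everywhere, whatever value it takes where the sequence
  diverges; completeness carries measurability over to the almost everywhere limit.\<close>

lemma (in complete_measure) borel_measurable_LIMSEQ_AE:
  fixes f :: "'a \<Rightarrow> real"
  assumes s: "\<And>k. s k \<in> borel_measurable M" and ae: "AE x in M. (\<lambda>k. s k x) \<longlonglongrightarrow> f x"
  shows "f \<in> borel_measurable M"
proof -
  have "(\<lambda>x. lim (\<lambda>k. s k x)) \<in> borel_measurable M" using s by measurable
  moreover have "AE x in M. lim (\<lambda>k. s k x) = f x" using ae by eventually_elim (rule limI)
  ultimately show ?thesis by (rule borel_measurable_AE_cong)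
qed

text \<open>A simple function has finitely many values, so g may be arbitrary. This allows g =
  \<open>nrm X\<close> and evaluation at an element, with no sigma-algebra on the function
  space.\<close>

lemma simple_function_borel_compose:
  assumes "simple_function M s" shows "(\<lambda>t. g (s t) :: real) \<in> borel_measurable M"
  using simple_function_compose1[OF assms] by (rule borel_measurable_simple_function)

lemma (in finite_measure) integral_simple_compose:
  assumes s: "simple_function M s"
  shows "integrable M (\<lambda>t. g (s t) :: real)"
    "(LINT t|M. g (s t)) = (\<Sum>c\<in>s ` space M. measure M {t \<in> space M. s t = c} * g c)"
proof -
  have fin: "finite (s ` space M)" using s by (rule simple_functionD(1))
  have meas: "{t \<in> space M. s t = c} \<in> sets M" for c
    using simple_functionD(2)[OF s, of "{c}"] by (simp add: vimage_def Int_def conj_commute)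
  have eq: "g (s t) = (\<Sum>c\<in>s ` space M. indicator {t \<in> space M. s t = c} t * g c)" if "t \<in> space M" for t
  proof -
    have "(\<Sum>c\<in>s ` space M. indicator {t \<in> space M. s t = c} t * g c) = (\<Sum>c\<in>s ` space M. if c = s t then g c else 0)"
      using that by (intro sum.cong) (auto simp: indicator_def)
    then show ?thesis using fin that by simp
  qed
  have int: "integrable M (\<lambda>t. indicator {t \<in> space M. s t = c} t * g c)" for c
    using meas[of c] by (intro integrable_mult_left) (auto simp: emeasure_eq_measure)
  show "integrable M (\<lambda>t. g (s t))"
    by (subst Bochner_Integration.integrable_cong[OF refl eq]) (assumption, intro Bochner_Integration.integrable_sum int)
  have "(LINT t|M. g (s t)) = (LINT t|M. (\<Sum>c\<in>s ` space M. indicator {t \<in> space M. s t = c} t * g c))"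
    by (rule Bochner_Integration.integral_cong[OF refl eq])
  also have "\<dots> = (\<Sum>c\<in>s ` space M. LINT t|M. indicator {t \<in> space M. s t = c} t * g c)"
    using int by (rule Bochner_Integration.integral_sum)
  also have "\<dots> = (\<Sum>c\<in>s ` space M. measure M {t \<in> space M. s t = c} * g c)"
    using meas by (intro sum.cong) auto
  finally show "(LINT t|M. g (s t)) = (\<Sum>c\<in>s ` space M. measure M {t \<in> space M. s t = c} * g c)" .
qed

subsection \<open>Bochner spaces\<close>

context seminormed
begin

lemma strongly_measurable_comb:
  assumes f: "strongly_measurable M X f" "AE t in M. f t \<in> elts X"
    and g: "strongly_measurable M X g" "AE t in M. g t \<in> elts X"
  shows "strongly_measurable M X (\<lambda>t x. a * f t x + b * g t x)"
proof -
  obtain s where s: "\<And>k. simple_function M (s k)" "\<And>k. s k ` space M \<subseteq> elts X"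
    "AE t in M. (\<lambda>k. nrm X (\<lambda>x. s k t x - f t x)) \<longlonglongrightarrow> 0" using f(1) unfolding strongly_measurable_def by blast
  obtain r where r: "\<And>k. simple_function M (r k)" "\<And>k. r k ` space M \<subseteq> elts X"
    "AE t in M. (\<lambda>k. nrm X (\<lambda>x. r k t x - g t x)) \<longlonglongrightarrow> 0" using g(1) unfolding strongly_measurable_def by blast
  show ?thesis unfolding strongly_measurable_def
  proof (intro exI[of _ "\<lambda>k t x. a * s k t x + b * r k t x"] conjI allI)
    show "simple_function M (\<lambda>t x. a * s k t x + b * r k t x)" for k
      using simple_function_compose2[OF s(1) r(1), of "\<lambda>u v x. a * u x + b * v x" k k] by simp
    show "(\<lambda>t x. a * s k t x + b * r k t x) ` space M \<subseteq> elts X" for k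
      using s(2)[of k] r(2)[of k] by (auto intro!: comb_elts)
    show "AE t in M. (\<lambda>k. nrm X (\<lambda>x. a * s k t x + b * r k t x - (a * f t x + b * g t x))) \<longlonglongrightarrow> 0"
      using s(3) r(3) f(2) g(2) AE_space
    proof eventually_elim
      case (elim t)
      have sk: "s k t \<in> elts X" "r k t \<in> elts X" for k using s(2)[of k] r(2)[of k] elim(5) by auto
      have eq: "(\<lambda>x. a * s k t x + b * r k t x - (a * f t x + b * g t x)) =
        (\<lambda>x. a * (s k t x - f t x) + b * (r k t x - g t x))" for k by (simp add: algebra_simps)
      have "(\<lambda>k. \<bar>a\<bar> * nrm X (\<lambda>x. s k t x - f t x) + \<bar>b\<bar> * nrm X (\<lambda>x. r k t x - g t x)) \<longlonglongrightarrow> \<bar>a\<bar> * 0 + \<bar>b\<bar> * 0"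
        by (intro tendsto_intros elim)
      then have lim: "(\<lambda>k. \<bar>a\<bar> * nrm X (\<lambda>x. s k t x - f t x) + \<bar>b\<bar> * nrm X (\<lambda>x. r k t x - g t x)) \<longlonglongrightarrow> 0" by simp
      show ?case
      proof (rule Lim_null_comparison[OF always_eventually lim])
        show "\<forall>k. norm (nrm X (\<lambda>x. a * s k t x + b * r k t x - (a * f t x + b * g t x)))
            \<le> \<bar>a\<bar> * nrm X (\<lambda>x. s k t x - f t x) + \<bar>b\<bar> * nrm X (\<lambda>x. r k t x - g t x)"
          unfolding eq using nrm_comb[OF diff_elts[OF sk(1) elim(3)] diff_elts[OF sk(2) elim(4)]]
            nrm_nonneg[OF comb_elts[OF diff_elts[OF sk(1) elim(3)] diff_elts[OF sk(2) elim(4)]]] by simp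
      qed
    qed
  qed
qed

text \<open>The reverse triangle inequality turns strong convergence of simple functions into
  convergence of their norms, which are measurable.\<close>

lemma strongly_measurable_nrm:
  assumes M: "complete_measure M" and f: "strongly_measurable M X f" "AE t in M. f t \<in> elts X"
  shows "(\<lambda>t. nrm X (f t)) \<in> borel_measurable M"
proof -
  obtain s where s: "\<And>k. simple_function M (s k)" "\<And>k. s k ` space M \<subseteq> elts X"
    "AE t in M. (\<lambda>k. nrm X (\<lambda>x. s k t x - f t x)) \<longlonglongrightarrow> 0" using f(1) unfolding strongly_measurable_def by blast
  show ?thesis
  proof (rule complete_measure.borel_measurable_LIMSEQ_AE[OF M])
    show "(\<lambda>t. nrm X (s k t)) \<in> borel_measurable M" for k by (rule simple_function_borel_compose[OF s(1)])
    show "AE t in M. (\<lambda>k. nrm X (s k t)) \<longlonglongrightarrow> nrm X (f t)"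
      using s(3) f(2) AE_space
    proof eventually_elim
      case (elim t)
      then have sk: "s k t \<in> elts X" for k using s(2)[of k] by auto
      have "(\<lambda>k. nrm X (s k t) - nrm X (f t)) \<longlonglongrightarrow> 0"
        by (rule Lim_null_comparison[OF always_eventually elim(1)])
          (auto intro: nrm_diff_abs sk elim)
      then show ?case by (simp add: LIM_zero_iff)
    qed
  qed
qed

lemma strongly_measurable_simple:
  assumes "simple_function M s" "s ` space M \<subseteq> elts X" shows "strongly_measurable M X s"
  unfolding strongly_measurable_def using assms nrm_zero by (intro exI[of _ "\<lambda>_. s"]) simp

lemma measurable_nrm_diff_simple:
  assumes M: "complete_measure M" and f: "strongly_measurable M X f" "AE t in M. f t \<in> elts X"
    and s: "simple_function M s" "s ` space M \<subseteq> elts X"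
  shows "(\<lambda>t. nrm X (\<lambda>x. f t x - s t x)) \<in> borel_measurable M"
proof (rule strongly_measurable_nrm[OF M])
  have sM: "AE t in M. s t \<in> elts X" using s(2) by (intro AE_I2) auto
  show "strongly_measurable M X (\<lambda>t x. f t x - s t x)"
    using strongly_measurable_comb[OF f strongly_measurable_simple[OF s] sM, where a=1 and b="-1"] by simp
  show "AE t in M. (\<lambda>x. f t x - s t x) \<in> elts X"
    using f(2) sM by eventually_elim (rule diff_elts)
qed

lemma bochner_l2D:
  assumes "complete_measure M" "f \<in> bochner_l2 M X"
  shows "AE t in M. f t \<in> elts X" "strongly_measurable M X f" "integrable M (\<lambda>t. (nrm X (f t))\<^sup>2)"
    "(\<lambda>t. nrm X (f t)) \<in> borel_measurable M"
  using assms strongly_measurable_nrm[of M f] by (auto simp: bochner_l2_def)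

lemma bochner_l2_comb:
  assumes M: "complete_measure M" and f: "f \<in> bochner_l2 M X" and g: "g \<in> bochner_l2 M X"
  shows "(\<lambda>t x. a * f t x + b * g t x) \<in> bochner_l2 M X"
proof -
  note F = bochner_l2D[OF M f] and G = bochner_l2D[OF M g]
  have AE: "AE t in M. (\<lambda>x. a * f t x + b * g t x) \<in> elts X"
    using F(1) G(1) by eventually_elim (rule comb_elts)
  have sm: "strongly_measurable M X (\<lambda>t x. a * f t x + b * g t x)"
    by (rule strongly_measurable_comb[OF F(2,1) G(2,1)])
  have "integrable M (\<lambda>t. (nrm X (\<lambda>x. a * f t x + b * g t x))\<^sup>2)"
  proof (rule Bochner_Integration.integrable_bound)
    \<comment> \<open>The majorant comes from bounding (p + q)^2 by 2 p^2 + 2 q^2.\<close>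
    show "integrable M (\<lambda>t. 2 * a\<^sup>2 * (nrm X (f t))\<^sup>2 + 2 * b\<^sup>2 * (nrm X (g t))\<^sup>2)"
      using F(3) G(3) by (intro Bochner_Integration.integrable_add integrable_mult_right)
    show "(\<lambda>t. (nrm X (\<lambda>x. a * f t x + b * g t x))\<^sup>2) \<in> borel_measurable M"
      using strongly_measurable_nrm[OF M sm AE] by measurable
    show "AE t in M. norm ((nrm X (\<lambda>x. a * f t x + b * g t x))\<^sup>2)
        \<le> norm (2 * a\<^sup>2 * (nrm X (f t))\<^sup>2 + 2 * b\<^sup>2 * (nrm X (g t))\<^sup>2)"
      using F(1) G(1)
    proof eventually_elim
      case (elim t)
      have "(nrm X (\<lambda>x. a * f t x + b * g t x))\<^sup>2 \<le> (\<bar>a\<bar> * nrm X (f t) + \<bar>b\<bar> * nrm X (g t))\<^sup>2"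
        by (intro power_mono nrm_comb elim nrm_nonneg comb_elts)
      also have "\<dots> \<le> 2 * (\<bar>a\<bar> * nrm X (f t))\<^sup>2 + 2 * (\<bar>b\<bar> * nrm X (g t))\<^sup>2"
        using sum_squares_bound[of "\<bar>a\<bar> * nrm X (f t)" "\<bar>b\<bar> * nrm X (g t)"] by (simp add: power2_sum)
      finally show ?case by (simp add: power_mult_distrib)
    qed
  qed
  then show ?thesis using AE sm by (simp add: bochner_l2_def)
qed

lemma bochner_l2_integrable:
  assumes M: "complete_measure M" "finite_measure M" and f: "f \<in> bochner_l2 M X"
  shows "integrable M (\<lambda>t. nrm X (f t))"
  using finite_measure.square_integrable_imp_integrable[OF M(2) bochner_l2D(4)[OF M(1) f] bochner_l2D(3)[OF M(1) f]] .

text \<open>The approximating functions are cut off where their norm exceeds twice that of \<open>f\<close>.\<close>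

lemma bochner_l2_simple_approx:
  assumes M: "complete_measure M" "finite_measure M" and f: "f \<in> bochner_l2 M X"
  obtains s where "\<And>k. simple_function M (s k)" "\<And>k. s k ` space M \<subseteq> elts X"
    "\<And>k. integrable M (\<lambda>t. nrm X (\<lambda>x. s k t x - f t x))"
    "(\<lambda>k. LINT t|M. nrm X (\<lambda>x. s k t x - f t x)) \<longlonglongrightarrow> 0"
proof -
  note F = bochner_l2D[OF M(1) f]
  note [measurable] = F(4)
  obtain s where s: "\<And>k. simple_function M (s k)" "\<And>k. s k ` space M \<subseteq> elts X"
    "AE t in M. (\<lambda>k. nrm X (\<lambda>x. s k t x - f t x)) \<longlonglongrightarrow> 0" using F(2) unfolding strongly_measurable_def by blast
  define r where "r k t = (if nrm X (s k t) \<le> 2 * nrm X (f t) then s k t else (\<lambda>x. 0))" for k t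
  have sM: "s k t \<in> elts X" if "t \<in> space M" for k t using s(2)[of k] that by auto
  have [measurable]: "(\<lambda>t. nrm X (s k t)) \<in> borel_measurable M" for k by (rule simple_function_borel_compose[OF s(1)])
  have r1: "simple_function M (r k)" for k
    unfolding r_def by (intro simple_function_If s(1)) (simp, measurable)
  have r2: "r k ` space M \<subseteq> elts X" for k using sM zero_elts by (auto simp: r_def)
  have rM: "r k t \<in> elts X" if "t \<in> space M" for k t using r2[of k] that by auto
  have nr: "nrm X (r k t) \<le> 2 * nrm X (f t)" if "f t \<in> elts X" for k t
    using nrm_nonneg[OF that] by (simp add: r_def nrm_zero)
  have lim: "AE t in M. (\<lambda>k. nrm X (\<lambda>x. r k t x - f t x)) \<longlonglongrightarrow> 0"
    using s(3) F(1) AE_space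
  proof eventually_elim
    case (elim t)
    note nn = nrm_nonneg[OF elim(2)]
    show ?case
    proof (cases "nrm X (f t) = 0")
      case True
      \<comment> \<open>If \<open>f t\<close> has norm zero, the cut-off keeps only values of norm
        zero, so the distance vanishes for every k even where \<open>r k t\<close> and
        \<open>s k t\<close> never agree.\<close>
      have "nrm X (\<lambda>x. r k t x - f t x) = 0" for k
        using nrm_diff[OF rM[OF elim(3)] elim(2), of k] nr[OF elim(2), of k] True
          nrm_nonneg[OF diff_elts[OF rM[OF elim(3)] elim(2)], of k] by simp
      then show ?thesis by simp
    next
      case False
      then have "nrm X (f t) > 0" using nn by simp
      then have "\<forall>\<^sub>F k in sequentially. nrm X (\<lambda>x. s k t x - f t x) < nrm X (f t)"
        using elim(1) by (rule order_tendstoD(2)[rotated])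
      \<comment> \<open>Once \<open>s k t\<close> is closer to \<open>f t\<close> than the norm of
        \<open>f t\<close>, its norm is at most twice that of \<open>f t\<close> and the cut-off is
        inactive.\<close>
      then have "\<forall>\<^sub>F k in sequentially. r k t = s k t"
      proof eventually_elim
        case (elim k)
        then have "nrm X (s k t) \<le> 2 * nrm X (f t)"
          using nrm_diff_abs[OF sM[OF \<open>t \<in> space M\<close>] \<open>f t \<in> elts X\<close>, of k] by linarith
        then show ?case by (simp add: r_def)
      qed
      then have "\<forall>\<^sub>F k in sequentially. nrm X (\<lambda>x. s k t x - f t x) = nrm X (\<lambda>x. r k t x - f t x)"
        by eventually_elim simp
      then show ?thesis using elim(1) by (rule Lim_transform_eventually[rotated])
    qed
  qed
  have meas: "(\<lambda>t. nrm X (\<lambda>x. r k t x - f t x)) \<in> borel_measurable M" for k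
  proof (rule complete_measure.borel_measurable_AE_cong[OF M(1) measurable_nrm_diff_simple[OF M(1) F(2,1) r1 r2]])
    show "AE t in M. nrm X (\<lambda>x. f t x - r k t x) = nrm X (\<lambda>x. r k t x - f t x)"
      using F(1) AE_space by eventually_elim (intro nrm_minus_commute rM)
  qed
  have bd: "AE t in M. norm (nrm X (\<lambda>x. r k t x - f t x)) \<le> 3 * nrm X (f t)" for k
    using F(1) AE_space
  proof eventually_elim
    case (elim t)
    show ?case using nrm_diff[OF rM[OF elim(2)] elim(1), of k] nr[OF elim(1), of k]
        nrm_nonneg[OF diff_elts[OF rM[OF elim(2)] elim(1)], of k] by simp
  qed
  note fi = bochner_l2_integrable[OF M f]
  have "(\<lambda>k. LINT t|M. nrm X (\<lambda>x. r k t x - f t x)) \<longlonglongrightarrow> (LINT t|M. 0)"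
    by (rule integral_dominated_convergence[where w="\<lambda>t. 3 * nrm X (f t)"]) (use meas fi lim bd in auto)
  moreover have "integrable M (\<lambda>t. nrm X (\<lambda>x. r k t x - f t x))" for k
    by (rule Bochner_Integration.integrable_bound[OF integrable_mult_right[of 3, OF fi] meas])
      (use bd[of k] in eventually_elim, auto)
  ultimately show ?thesis by (intro that[of r] r1 r2) simp_all
qed

text \<open>Evaluation at a fixed \<phi> is bounded on the dual with constant
  \<open>nrm X \<phi>\<close>, so it preserves measurability and square integrability.\<close>

lemma dual_bochner_l2_apply:
  assumes M: "complete_measure M" and f: "f \<in> bochner_l2 M (dual X)" and \<phi>: "\<phi> \<in> elts X"
  shows "(\<lambda>t. f t \<phi>) \<in> borel_measurable M" "integrable M (\<lambda>t. (f t \<phi>)\<^sup>2)"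
proof -
  interpret D: seminormed "dual X" by (rule seminormed_dual)
  note F = D.bochner_l2D[OF M f]
  obtain s where s: "\<And>k. simple_function M (s k)" "\<And>k. s k ` space M \<subseteq> elts (dual X)"
    "AE t in M. (\<lambda>k. nrm (dual X) (\<lambda>x. s k t x - f t x)) \<longlonglongrightarrow> 0" using F(2) unfolding strongly_measurable_def by blast
  show m: "(\<lambda>t. f t \<phi>) \<in> borel_measurable M"
  proof (rule complete_measure.borel_measurable_LIMSEQ_AE[OF M])
    show "(\<lambda>t. s k t \<phi>) \<in> borel_measurable M" for k by (rule simple_function_borel_compose[OF s(1)])
    show "AE t in M. (\<lambda>k. s k t \<phi>) \<longlonglongrightarrow> f t \<phi>"
      using s(3) F(1) AE_space
    proof eventually_elim
      case (elim t)
      then have sk: "s k t \<in> elts (dual X)" for k using s(2)[of k] by auto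
      have "(\<lambda>k. s k t \<phi> - f t \<phi>) \<longlonglongrightarrow> 0"
      proof (rule Lim_null_comparison[OF always_eventually])
        show "(\<lambda>k. nrm (dual X) (\<lambda>x. s k t x - f t x) * nrm X \<phi>) \<longlonglongrightarrow> 0"
          using tendsto_mult_right[OF elim(1), of "nrm X \<phi>"] by simp
        show "\<forall>k. norm (s k t \<phi> - f t \<phi>) \<le> nrm (dual X) (\<lambda>x. s k t x - f t x) * nrm X \<phi>"
          using dual_bound[OF D.diff_elts[OF sk elim(2)] \<phi>] by simp
      qed
      then show ?case by (simp add: LIM_zero_iff)
    qed
  qed
  show "integrable M (\<lambda>t. (f t \<phi>)\<^sup>2)"
  proof (rule Bochner_Integration.integrable_bound)
    show "integrable M (\<lambda>t. (nrm X \<phi>)\<^sup>2 * (nrm (dual X) (f t))\<^sup>2)" using F(3) by (rule integrable_mult_right)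
    show "(\<lambda>t. (f t \<phi>)\<^sup>2) \<in> borel_measurable M" using m by measurable
    show "AE t in M. norm ((f t \<phi>)\<^sup>2) \<le> norm ((nrm X \<phi>)\<^sup>2 * (nrm (dual X) (f t))\<^sup>2)"
      using F(1)
    proof eventually_elim
      case (elim t)
      have "\<bar>f t \<phi>\<bar>\<^sup>2 \<le> (nrm (dual X) (f t) * nrm X \<phi>)\<^sup>2"
        by (rule power_mono[OF dual_bound[OF elim \<phi>]]) simp
      then show ?case by (simp add: power_mult_distrib mult.commute)
    qed
  qed
qed

end

lemma simple_integral_in_eq:
  assumes "finite_measure M" "simple_function M s"
  shows "simple_integral_in M s x = (LINT t|M. s t x)"
  unfolding simple_integral_in_def
  using finite_measure.integral_simple_compose(2)[OF assms, of "\<lambda>c. c x"] by simp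

text \<open>Evaluation at \<phi> is bounded and linear, so it commutes with the integral: evaluating
  the approximating simple functions gives exactly the data required to introduce
  \<open>has_bochner_integral\<close> for the scalar function.\<close>

lemma (in seminormed) has_integral_in_dual_apply:
  assumes C: "complete_measure M" and M: "finite_measure M" and J: "has_integral_in M (dual X) f J" and \<phi>: "\<phi> \<in> elts X"
    and meas: "(\<lambda>t. f t \<phi>) \<in> borel_measurable M"
  shows "J \<phi> = (LINT t|M. f t \<phi>)"
proof -
  interpret D: seminormed "dual X" by (rule seminormed_dual)
  interpret M: finite_measure M by (rule M)
  obtain s where s: "\<And>k. simple_function M (s k)" "\<And>k. s k ` space M \<subseteq> elts (dual X)"
    "(\<lambda>k. \<integral>\<^sup>+ t. ennreal (nrm (dual X) (\<lambda>x. f t x - s k t x)) \<partial>M) \<longlonglongrightarrow> 0"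
    "(\<lambda>k. nrm (dual X) (\<lambda>x. simple_integral_in M (s k) x - J x)) \<longlonglongrightarrow> 0"
    and fm: "strongly_measurable M (dual X) f"
    and fJ: "J \<in> elts (dual X)" "AE t in M. f t \<in> elts (dual X)"
    using J unfolding has_integral_in_def by blast
  have sM: "s k t \<in> elts (dual X)" if "t \<in> space M" for k t using s(2)[of k] that by auto
  have si: "simple_integral_in M (s k) \<in> elts (dual X)" for k
    unfolding simple_integral_in_def using s(2)[of k]
    by (intro D.sum_elts[THEN conjunct1] simple_functionD(1)[OF s(1)]) auto
  have "has_bochner_integral M (\<lambda>t. f t \<phi>) (J \<phi>)"
  proof (rule has_bochner_integral.intros[where s="\<lambda>k t. s k t \<phi>"])
    show sb: "Bochner_Integration.simple_bochner_integrable M (\<lambda>t. s k t \<phi>)" for k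
    proof -
      have "simple_function M (\<lambda>t. s k t \<phi>)" using simple_function_compose1[OF s(1), of "\<lambda>c. c \<phi>"] by simp
      then show ?thesis by (simp add: simple_bochner_integrable.simps M.emeasure_eq_measure)
    qed
    show "(\<lambda>k. \<integral>\<^sup>+ t. ennreal (norm (f t \<phi> - s k t \<phi>)) \<partial>M) \<longlonglongrightarrow> 0"
    proof (rule tendsto_sandwich[OF _ _ tendsto_const])
      show "(\<lambda>k. (\<integral>\<^sup>+ t. ennreal (nrm (dual X) (\<lambda>x. f t x - s k t x)) \<partial>M) * ennreal (nrm X \<phi>)) \<longlonglongrightarrow> 0"
        using ennreal_tendsto_cmult[OF _ s(3), of "ennreal (nrm X \<phi>)"] by (simp add: mult.commute)
      show "\<forall>\<^sub>F k in sequentially. (\<integral>\<^sup>+ t. ennreal (norm (f t \<phi> - s k t \<phi>)) \<partial>M)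
          \<le> (\<integral>\<^sup>+ t. ennreal (nrm (dual X) (\<lambda>x. f t x - s k t x)) \<partial>M) * ennreal (nrm X \<phi>)"
      proof (intro always_eventually allI)
        fix k
        have "(\<integral>\<^sup>+ t. ennreal (norm (f t \<phi> - s k t \<phi>)) \<partial>M) \<le>
           (\<integral>\<^sup>+ t. ennreal (nrm X \<phi>) * ennreal (nrm (dual X) (\<lambda>x. f t x - s k t x)) \<partial>M)"
        proof (rule nn_integral_mono_AE)
          show "AE t in M. ennreal (norm (f t \<phi> - s k t \<phi>)) \<le> ennreal (nrm X \<phi>) * ennreal (nrm (dual X) (\<lambda>x. f t x - s k t x))"
            using fJ(2) AE_space
          proof eventually_elim
            case (elim t)
            show ?case using dual_bound[OF D.diff_elts[OF elim(1) sM[OF elim(2)]] \<phi>, of k]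
              by (simp add: ennreal_mult'[symmetric] nrm_nonneg[OF \<phi>] mult.commute)
          qed
        qed
        also have "\<dots> = ennreal (nrm X \<phi>) * (\<integral>\<^sup>+ t. ennreal (nrm (dual X) (\<lambda>x. f t x - s k t x)) \<partial>M)"
          by (intro nn_integral_cmult measurable_compose[OF D.measurable_nrm_diff_simple[OF C fm fJ(2) s(1,2)] measurable_ennreal])
        finally show "(\<integral>\<^sup>+ t. ennreal (norm (f t \<phi> - s k t \<phi>)) \<partial>M)
          \<le> (\<integral>\<^sup>+ t. ennreal (nrm (dual X) (\<lambda>x. f t x - s k t x)) \<partial>M) * ennreal (nrm X \<phi>)" by (simp add: mult.commute)
      qed
    qed simp
    have "(\<lambda>k. simple_integral_in M (s k) \<phi> - J \<phi>) \<longlonglongrightarrow> 0"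
    proof (rule Lim_null_comparison[OF always_eventually])
      show "(\<lambda>k. nrm (dual X) (\<lambda>x. simple_integral_in M (s k) x - J x) * nrm X \<phi>) \<longlonglongrightarrow> 0"
        using tendsto_mult_right[OF s(4), of "nrm X \<phi>"] by simp
      show "\<forall>k. norm (simple_integral_in M (s k) \<phi> - J \<phi>) \<le> nrm (dual X) (\<lambda>x. simple_integral_in M (s k) x - J x) * nrm X \<phi>"
        using dual_bound[OF D.diff_elts[OF si fJ(1)] \<phi>] by simp
    qed
    then show "(\<lambda>k. Bochner_Integration.simple_bochner_integral M (\<lambda>t. s k t \<phi>)) \<longlonglongrightarrow> J \<phi>"
      by (simp add: LIM_zero_iff simple_bochner_integrable_eq_integral[OF sb] simple_integral_in_eq[OF M s(1)])
  qed (rule meas)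
  then show ?thesis by (simp add: has_bochner_integral_integral_eq)
qed

subsection \<open>Pulling back functionals\<close>

lemma finite_measure_Ioo: "finite_measure (lebesgue_on {0<..<T::real})"
  by (rule finite_measure_lebesgue_on) (simp add: lmeasurable_interval)

text \<open>\<open>U_comb\<close> asks for linearity only up to norm zero. An average over a cell is
  a Lebesgue integral, whose default value 0 on non-integrable sections breaks pointwise linearity
  on a null set.\<close>

locale dual_pullback = X: seminormed X + Y: seminormed Y
  for X :: "'x fspace" and Y :: "'y fspace" +
  fixes c :: real and U :: "('y \<Rightarrow> real) \<Rightarrow> 'x \<Rightarrow> real"
  assumes U_elts: "\<And>\<phi>. \<phi> \<in> elts Y \<Longrightarrow> U \<phi> \<in> elts X"
    and U_nrm: "\<And>\<phi>. \<phi> \<in> elts Y \<Longrightarrow> nrm X (U \<phi>) \<le> nrm Y \<phi>"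
    and U_comb: "\<And>\<phi> \<psi> a b. \<phi> \<in> elts Y \<Longrightarrow> \<psi> \<in> elts Y \<Longrightarrow>
      nrm X (\<lambda>x. U (\<lambda>y. a * \<phi> y + b * \<psi> y) x - (a * U \<phi> x + b * U \<psi> x)) = 0"
begin

definition pb :: "(('x \<Rightarrow> real) \<Rightarrow> real) \<Rightarrow> ('y \<Rightarrow> real) \<Rightarrow> real" where
  "pb F = (\<lambda>\<phi>. c * F (U \<phi>))"

sublocale DX: seminormed "dual X" by (rule X.seminormed_dual)
sublocale DY: seminormed "dual Y" by (rule Y.seminormed_dual)

lemma pb_dual: assumes F: "F \<in> elts (dual X)"
  shows "pb F \<in> elts (dual Y)" "nrm (dual Y) (pb F) \<le> \<bar>c\<bar> * nrm (dual X) F"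
proof -
  have bd: "\<bar>pb F \<phi>\<bar> \<le> (\<bar>c\<bar> * nrm (dual X) F) * nrm Y \<phi>" if "\<phi> \<in> elts Y" for \<phi>
  proof -
    have "\<bar>F (U \<phi>)\<bar> \<le> nrm (dual X) F * nrm X (U \<phi>)" by (rule X.dual_bound[OF F U_elts[OF that]])
    also have "\<dots> \<le> nrm (dual X) F * nrm Y \<phi>" by (intro mult_left_mono U_nrm that X.dual_nonneg F)
    finally show ?thesis by (simp add: pb_def abs_mult mult.assoc mult_left_mono)
  qed
  show "pb F \<in> elts (dual Y)"
  proof (rule dualI[OF _ bd])
    fix \<phi> \<psi> a b assume \<phi>: "\<phi> \<in> elts Y" and \<psi>: "\<psi> \<in> elts Y"
    let ?u = "U (\<lambda>y. a * \<phi> y + b * \<psi> y)" and ?v = "\<lambda>x. a * U \<phi> x + b * U \<psi> x"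
    have u: "?u \<in> elts X" and v: "?v \<in> elts X"
      by (intro U_elts Y.comb_elts \<phi> \<psi>, intro X.comb_elts U_elts \<phi> \<psi>)
    \<comment> \<open>The two sides of the linearity relation may be different functions, but a
      bounded functional cannot separate elements at distance zero.\<close>
    have "\<bar>F (\<lambda>x. ?u x - ?v x)\<bar> \<le> nrm (dual X) F * 0"
      using X.dual_bound[OF F X.diff_elts[OF u v]] U_comb[OF \<phi> \<psi>, of a b] by simp
    then have "F ?u = F ?v" unfolding dual_diff[OF F u v] by simp
    then show "pb F (\<lambda>y. a * \<phi> y + b * \<psi> y) = a * pb F \<phi> + b * pb F \<psi>"
      using dual_linear[OF F U_elts[OF \<phi>] U_elts[OF \<psi>], of a b] by (simp add: pb_def algebra_simps)
  qed
  show "nrm (dual Y) (pb F) \<le> \<bar>c\<bar> * nrm (dual X) F"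
    by (rule Y.nrm_dual_le[OF bd]) (simp_all add: X.dual_nonneg F)
qed

text \<open>Agreement is asked only on the carrier of Y and for almost every t: the adjoint identity
  relates the two pivot functionals only on that carrier, and only for t at which the function in
  the layer is square integrable.\<close>

definition lifts :: "('s measure) \<Rightarrow> ('s \<Rightarrow> ('x \<Rightarrow> real) \<Rightarrow> real) \<Rightarrow> ('s \<Rightarrow> ('y \<Rightarrow> real) \<Rightarrow> real) \<Rightarrow> bool" where
  "lifts M f f' \<longleftrightarrow> (AE t in M. \<forall>\<phi>\<in>elts Y. f' t \<phi> = pb (f t) \<phi>)"

lemma lifts_elts: assumes "lifts M f f'" "AE t in M. f t \<in> elts (dual X)"
  shows "AE t in M. f' t \<in> elts (dual Y)" "AE t in M. nrm (dual Y) (f' t) \<le> \<bar>c\<bar> * nrm (dual X) (f t)"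
proof -
  have "AE t in M. f' t \<in> elts (dual Y) \<and> nrm (dual Y) (f' t) \<le> \<bar>c\<bar> * nrm (dual X) (f t)"
    using assms unfolding lifts_def
  proof eventually_elim
    case (elim t)
    then show ?case using Y.dual_cong[OF pb_dual(1)[OF elim(2)], of "f' t"] pb_dual(2)[OF elim(2)] by auto
  qed
  then show "AE t in M. f' t \<in> elts (dual Y)" "AE t in M. nrm (dual Y) (f' t) \<le> \<bar>c\<bar> * nrm (dual X) (f t)"
    by (auto elim: eventually_mono)
qed

text \<open>Both orders of subtraction occur because \<open>strongly_measurable\<close> measures
  approximant minus function, whereas \<open>has_integral_in\<close> measures function minus
  approximant.\<close>

lemma lifts_diff_bound:
  assumes "F \<in> elts (dual X)" "G \<in> elts (dual X)" "\<And>\<phi>. \<phi> \<in> elts Y \<Longrightarrow> G' \<phi> = pb G \<phi>"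
  shows "nrm (dual Y) (\<lambda>\<phi>. pb F \<phi> - G' \<phi>) \<le> \<bar>c\<bar> * nrm (dual X) (\<lambda>x. F x - G x)"
    "nrm (dual Y) (\<lambda>\<phi>. G' \<phi> - pb F \<phi>) \<le> \<bar>c\<bar> * nrm (dual X) (\<lambda>x. G x - F x)"
proof -
  note d = DX.diff_elts[OF assms(1,2)] and e = DX.diff_elts[OF assms(2,1)]
  have "nrm (dual Y) (\<lambda>\<phi>. pb F \<phi> - G' \<phi>) = nrm (dual Y) (pb (\<lambda>x. F x - G x))"
    by (rule Y.dual_cong[OF pb_dual(1)[OF d]]) (simp add: assms(3) pb_def algebra_simps)
  then show "nrm (dual Y) (\<lambda>\<phi>. pb F \<phi> - G' \<phi>) \<le> \<bar>c\<bar> * nrm (dual X) (\<lambda>x. F x - G x)"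
    using pb_dual(2)[OF d] by simp
  have "nrm (dual Y) (\<lambda>\<phi>. G' \<phi> - pb F \<phi>) = nrm (dual Y) (pb (\<lambda>x. G x - F x))"
    by (rule Y.dual_cong[OF pb_dual(1)[OF e]]) (simp add: assms(3) pb_def algebra_simps)
  then show "nrm (dual Y) (\<lambda>\<phi>. G' \<phi> - pb F \<phi>) \<le> \<bar>c\<bar> * nrm (dual X) (\<lambda>x. G x - F x)"
    using pb_dual(2)[OF e] by simp
qed

lemma simple_function_pb:
  assumes "simple_function M s" "s ` space M \<subseteq> elts (dual X)"
  shows "simple_function M (\<lambda>t. pb (s t))" "(\<lambda>t. pb (s t)) ` space M \<subseteq> elts (dual Y)"
  using simple_function_compose1[OF assms(1), of pb] assms(2) pb_dual(1) by auto

lemma strongly_measurable_lift: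
  assumes f: "strongly_measurable M (dual X) f" "AE t in M. f t \<in> elts (dual X)" and l: "lifts M f f'"
  shows "strongly_measurable M (dual Y) f'"
proof -
  obtain s where s: "\<And>k. simple_function M (s k)" "\<And>k. s k ` space M \<subseteq> elts (dual X)"
    "AE t in M. (\<lambda>k. nrm (dual X) (\<lambda>x. s k t x - f t x)) \<longlonglongrightarrow> 0" using f(1) unfolding strongly_measurable_def by blast
  show ?thesis unfolding strongly_measurable_def
  proof (intro exI[of _ "\<lambda>k t. pb (s k t)"] conjI allI simple_function_pb s)
    show "AE t in M. (\<lambda>k. nrm (dual Y) (\<lambda>x. pb (s k t) x - f' t x)) \<longlonglongrightarrow> 0"
      using s(3) f(2) l[unfolded lifts_def] lifts_elts(1)[OF l f(2)] AE_space
    proof eventually_elim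
      case (elim t)
      have sk: "s k t \<in> elts (dual X)" for k using s(2)[of k] elim(5) by auto
      show ?case
      proof (rule Lim_null_comparison[OF always_eventually])
        show "(\<lambda>k. \<bar>c\<bar> * nrm (dual X) (\<lambda>x. s k t x - f t x)) \<longlonglongrightarrow> 0"
          using tendsto_mult_left[OF elim(1), of "\<bar>c\<bar>"] by simp
        show "\<forall>k. norm (nrm (dual Y) (\<lambda>x. pb (s k t) x - f' t x)) \<le> \<bar>c\<bar> * nrm (dual X) (\<lambda>x. s k t x - f t x)"
          using lifts_diff_bound(1)[OF sk elim(2)] elim(3) Y.dual_nonneg[OF DY.diff_elts[OF pb_dual(1)[OF sk] elim(4)]]
          by simp
      qed
    qed
  qed
qed

lemma bochner_l2_lift:
  assumes M: "complete_measure M" and f: "f \<in> bochner_l2 M (dual X)" and l: "lifts M f f'"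
  shows "f' \<in> bochner_l2 M (dual Y)"
proof -
  note F = DX.bochner_l2D[OF M f]
  note sm = strongly_measurable_lift[OF F(2,1) l] and el = lifts_elts[OF l F(1)]
  have "integrable M (\<lambda>t. (nrm (dual Y) (f' t))\<^sup>2)"
  proof (rule Bochner_Integration.integrable_bound)
    show "integrable M (\<lambda>t. c\<^sup>2 * (nrm (dual X) (f t))\<^sup>2)" using F(3) by (rule integrable_mult_right)
    show "(\<lambda>t. (nrm (dual Y) (f' t))\<^sup>2) \<in> borel_measurable M"
      using DY.strongly_measurable_nrm[OF M sm el(1)] by measurable
    show "AE t in M. norm ((nrm (dual Y) (f' t))\<^sup>2) \<le> norm (c\<^sup>2 * (nrm (dual X) (f t))\<^sup>2)"
      using el
    proof eventually_elim
      case (elim t)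
      then have "(nrm (dual Y) (f' t))\<^sup>2 \<le> (\<bar>c\<bar> * nrm (dual X) (f t))\<^sup>2"
        by (intro power_mono Y.dual_nonneg)
      then show ?case by (simp add: power_mult_distrib)
    qed
  qed
  then show ?thesis using sm el(1) by (simp add: bochner_l2_def)
qed

text \<open>The pullbacks of the simple functions that approximate f serve for f', every distance
  growing by at most the factor \<open>\<bar>c\<bar>\<close>.\<close>

lemma has_integral_in_lift:
  assumes M: "complete_measure M" "finite_measure M" and f: "has_integral_in M (dual X) f J" and l: "lifts M f f'"
    and J': "\<And>\<phi>. \<phi> \<in> elts Y \<Longrightarrow> J' \<phi> = pb J \<phi>"
  shows "has_integral_in M (dual Y) f' J'"
proof -
  interpret M: finite_measure M by (rule M)
  obtain s where s: "\<And>k. simple_function M (s k)" "\<And>k. s k ` space M \<subseteq> elts (dual X)"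
    "(\<lambda>k. \<integral>\<^sup>+ t. ennreal (nrm (dual X) (\<lambda>x. f t x - s k t x)) \<partial>M) \<longlonglongrightarrow> 0"
    "(\<lambda>k. nrm (dual X) (\<lambda>x. simple_integral_in M (s k) x - J x)) \<longlonglongrightarrow> 0"
    and fm: "strongly_measurable M (dual X) f"
    and fJ: "J \<in> elts (dual X)" "AE t in M. f t \<in> elts (dual X)"
    using f unfolding has_integral_in_def by blast
  have sM: "s k t \<in> elts (dual X)" if "t \<in> space M" for k t using s(2)[of k] that by auto
  have si: "simple_integral_in M (s k) \<in> elts (dual X)" for k
    unfolding simple_integral_in_def using s(2)[of k]
    by (intro DX.sum_elts[THEN conjunct1] simple_functionD(1)[OF s(1)]) auto
  have J'e: "J' \<in> elts (dual Y)" using Y.dual_cong[OF pb_dual(1)[OF fJ(1)]] J' by auto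
  \<comment> \<open>This identity is exact and not only valid on the carrier, since a simple
    integral is evaluated pointwise and \<open>pb\<close> is evaluation at \<open>U \<phi>\<close>
    times a constant.\<close>
  have si_pb: "simple_integral_in M (\<lambda>t. pb (s k t)) = pb (simple_integral_in M (s k))" for k
    unfolding fun_eq_iff simple_integral_in_eq[OF M(2) simple_function_pb(1)[OF s(1,2)]]
    by (simp add: pb_def simple_integral_in_eq[OF M(2) s(1)])
  show ?thesis unfolding has_integral_in_def
  proof (intro conjI exI[of _ "\<lambda>k t. pb (s k t)"] allI)
    show "AE t in M. f' t \<in> elts (dual Y)" by (rule lifts_elts[OF l fJ(2)])
    show "strongly_measurable M (dual Y) f'" by (rule strongly_measurable_lift[OF fm fJ(2) l])
    show "J' \<in> elts (dual Y)" by (rule J'e)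
    show "simple_function M (\<lambda>t. pb (s k t))" "(\<lambda>t. pb (s k t)) ` space M \<subseteq> elts (dual Y)" for k
      by (intro simple_function_pb s)+
    show "emeasure M {t \<in> space M. pb (s k t) \<noteq> (\<lambda>x. 0)} < \<infinity>" for k
      by (simp add: M.emeasure_eq_measure)
    show "(\<lambda>k. nrm (dual Y) (\<lambda>x. simple_integral_in M (\<lambda>t. pb (s k t)) x - J' x)) \<longlonglongrightarrow> 0"
    proof (rule Lim_null_comparison[OF always_eventually])
      show "(\<lambda>k. \<bar>c\<bar> * nrm (dual X) (\<lambda>x. simple_integral_in M (s k) x - J x)) \<longlonglongrightarrow> 0"
        using tendsto_mult_left[OF s(4), of "\<bar>c\<bar>"] by simp
      show "\<forall>k. norm (nrm (dual Y) (\<lambda>x. simple_integral_in M (\<lambda>t. pb (s k t)) x - J' x))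
          \<le> \<bar>c\<bar> * nrm (dual X) (\<lambda>x. simple_integral_in M (s k) x - J x)"
        unfolding si_pb
        using lifts_diff_bound(1)[OF si fJ(1) J'] Y.dual_nonneg[OF DY.diff_elts[OF pb_dual(1)[OF si] J'e]] by simp
    qed
    show "(\<lambda>k. \<integral>\<^sup>+ t. ennreal (nrm (dual Y) (\<lambda>x. f' t x - pb (s k t) x)) \<partial>M) \<longlonglongrightarrow> 0"
    proof (rule tendsto_sandwich[OF _ _ tendsto_const])
      show "(\<lambda>k. ennreal \<bar>c\<bar> * (\<integral>\<^sup>+ t. ennreal (nrm (dual X) (\<lambda>x. f t x - s k t x)) \<partial>M)) \<longlonglongrightarrow> 0"
        using ennreal_tendsto_cmult[OF _ s(3), of "ennreal \<bar>c\<bar>"] by simp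
      show "\<forall>\<^sub>F k in sequentially. (\<integral>\<^sup>+ t. ennreal (nrm (dual Y) (\<lambda>x. f' t x - pb (s k t) x)) \<partial>M)
          \<le> ennreal \<bar>c\<bar> * (\<integral>\<^sup>+ t. ennreal (nrm (dual X) (\<lambda>x. f t x - s k t x)) \<partial>M)"
      proof (intro always_eventually allI)
        fix k
        have "(\<integral>\<^sup>+ t. ennreal (nrm (dual Y) (\<lambda>x. f' t x - pb (s k t) x)) \<partial>M) \<le>
           (\<integral>\<^sup>+ t. ennreal \<bar>c\<bar> * ennreal (nrm (dual X) (\<lambda>x. f t x - s k t x)) \<partial>M)"
        proof (rule nn_integral_mono_AE)
          show "AE t in M. ennreal (nrm (dual Y) (\<lambda>x. f' t x - pb (s k t) x)) \<le> ennreal \<bar>c\<bar> * ennreal (nrm (dual X) (\<lambda>x. f t x - s k t x))"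
            using fJ(2) l[unfolded lifts_def] AE_space
          proof eventually_elim
            case (elim t)
            show ?case using lifts_diff_bound(2)[OF sM[OF elim(3)] elim(1), of "f' t" k] elim(2)
              by (simp add: ennreal_mult'[symmetric] ennreal_leI)
          qed
        qed
        also have "\<dots> = ennreal \<bar>c\<bar> * (\<integral>\<^sup>+ t. ennreal (nrm (dual X) (\<lambda>x. f t x - s k t x)) \<partial>M)"
          by (intro nn_integral_cmult measurable_compose[OF DX.measurable_nrm_diff_simple[OF M(1) fm fJ(2) s(1,2)] measurable_ennreal])
        finally show "(\<integral>\<^sup>+ t. ennreal (nrm (dual Y) (\<lambda>x. f' t x - pb (s k t) x)) \<partial>M)
          \<le> ennreal \<bar>c\<bar> * (\<integral>\<^sup>+ t. ennreal (nrm (dual X) (\<lambda>x. f t x - s k t x)) \<partial>M)" .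
      qed
    qed simp
  qed
qed

lemma has_time_deriv_lift:
  assumes d: "has_time_deriv T (dual X) u w"
    and u: "lifts (lebesgue_on {0<..<T}) u u'" and w: "lifts (lebesgue_on {0<..<T}) w w'"
  shows "has_time_deriv T (dual Y) u' w'"
proof -
  let ?M = "lebesgue_on {0<..<T}"
  have C: "complete_measure ?M" and F: "finite_measure ?M"
    by (simp_all add: complete_measure_lebesgue_on finite_measure_Ioo)
  note D = d[unfolded has_time_deriv_def]
  show ?thesis unfolding has_time_deriv_def
  proof (intro conjI ballI)
    show "u' \<in> bochner_l2 ?M (dual Y)" "w' \<in> bochner_l2 ?M (dual Y)"
      using bochner_l2_lift[OF C _ u] bochner_l2_lift[OF C _ w] D by auto
    fix \<psi> assume "\<psi> \<in> test_functions {0<..<T}"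
    then obtain J where J: "has_integral_in ?M (dual X) (\<lambda>t x. deriv \<psi> t * u t x) J"
        "has_integral_in ?M (dual X) (\<lambda>t x. \<psi> t * w t x) (\<lambda>x. - J x)" using D by blast
    have "lifts ?M (\<lambda>t x. deriv \<psi> t * u t x) (\<lambda>t x. deriv \<psi> t * u' t x)"
      using u unfolding lifts_def by eventually_elim (simp add: pb_def)
    then have 1: "has_integral_in ?M (dual Y) (\<lambda>t x. deriv \<psi> t * u' t x) (pb J)"
      by (rule has_integral_in_lift[OF C F J(1)]) simp
    have "lifts ?M (\<lambda>t x. \<psi> t * w t x) (\<lambda>t x. \<psi> t * w' t x)"
      using w unfolding lifts_def by eventually_elim (simp add: pb_def)
    then have 2: "has_integral_in ?M (dual Y) (\<lambda>t x. \<psi> t * w' t x) (\<lambda>x. - pb J x)"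
      by (rule has_integral_in_lift[OF C F J(2)]) (simp add: pb_def)
    show "\<exists>J. has_integral_in ?M (dual Y) (\<lambda>t x. deriv \<psi> t * u' t x) J \<and>
        has_integral_in ?M (dual Y) (\<lambda>t x. \<psi> t * w' t x) (\<lambda>x. - J x)" using 1 2 by blast
  qed
qed

end

subsection \<open>Smooth bump functions\<close>

lemma Ck_Suc_imp: "Ck (Suc k) f \<Longrightarrow> Ck k f"
proof (induction k arbitrary: f)
  case 0 then show ?case by (simp add: differentiable_imp_continuous_on)
next
  case (Suc k)
  from Suc.prems have "f differentiable_on UNIV" "\<forall>b\<in>Basis. Ck (Suc k) (\<lambda>x. frechet_derivative f (at x) b)"
    unfolding Ck.simps(2)[of "Suc k"] by blast+
  then show ?case using Suc.IH by (simp only: Ck.simps(2)) blast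
qed

lemma differentiable_on_UNIV_D: "f differentiable_on UNIV \<Longrightarrow> f differentiable at x"
  by (simp add: differentiable_on_eq_differentiable_at)

lemma differentiable_has_derivative:
  "f differentiable at x \<Longrightarrow> (f has_derivative frechet_derivative f (at x)) (at x)"
  by (simp add: frechet_derivative_works)

lemma Ck_SucI:
  assumes "\<And>x. (f has_derivative f' x) (at x)" "\<And>b. b \<in> Basis \<Longrightarrow> Ck k (\<lambda>x. f' x b)"
  shows "Ck (Suc k) f"
proof -
  have "frechet_derivative f (at x) = f' x" for x using frechet_derivative_at[OF assms(1)] by simp
  then show ?thesis using assms by (auto simp: differentiable_on_def differentiable_def)
qed

lemma Ck_SucD:
  assumes "Ck (Suc k) f"
  shows "(f has_derivative frechet_derivative f (at x)) (at x)" "b \<in> Basis \<Longrightarrow> Ck k (\<lambda>x. frechet_derivative f (at x) b)"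
  using assms by (auto intro: differentiable_has_derivative differentiable_on_UNIV_D)

lemma Ck_const: "Ck k (\<lambda>x. c)"
proof (induction k arbitrary: c)
  case (Suc k) show ?case by (rule Ck_SucI[where f'="\<lambda>_ _. 0"]) (auto intro: Suc)
qed auto

lemma Ck_add: "Ck k f \<Longrightarrow> Ck k g \<Longrightarrow> Ck k (\<lambda>x. f x + g x)"
proof (induction k arbitrary: f g)
  case 0 then show ?case by (auto intro: continuous_intros)
next
  case (Suc k)
  show ?case
    by (rule Ck_SucI[OF has_derivative_add[OF Ck_SucD(1)[OF Suc.prems(1)] Ck_SucD(1)[OF Suc.prems(2)]]])
      (intro Suc.IH Ck_SucD(2)[OF Suc.prems(1)] Ck_SucD(2)[OF Suc.prems(2)])
qed

lemma Ck_mult: "Ck k f \<Longrightarrow> Ck k g \<Longrightarrow> Ck k (\<lambda>x. f x * g x)"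
proof (induction k arbitrary: f g)
  case 0 then show ?case by (auto intro: continuous_intros)
next
  case (Suc k)
  show ?case
    by (rule Ck_SucI[OF has_derivative_mult[OF Ck_SucD(1)[OF Suc.prems(1)] Ck_SucD(1)[OF Suc.prems(2)]]])
      (intro Ck_add Suc.IH Ck_SucD(2)[OF Suc.prems(1)] Ck_SucD(2)[OF Suc.prems(2)] Ck_Suc_imp[OF Suc.prems(1)] Ck_Suc_imp[OF Suc.prems(2)])
qed

lemma Ck_prod: "(\<And>i. i \<in> I \<Longrightarrow> Ck k (f i)) \<Longrightarrow> Ck k (\<lambda>x. \<Prod>i\<in>I. f i x)"
  by (induction I rule: infinite_finite_induct) (auto intro: Ck_const Ck_mult)

lemma Ck_affine:
  fixes f :: "'a::euclidean_space \<Rightarrow> real"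
  shows "Ck k f \<Longrightarrow> Ck k (\<lambda>x. f (r *\<^sub>R x + c))"
proof (induction k arbitrary: f)
  case 0 then show ?case by (auto intro!: continuous_intros continuous_on_compose2[where s=UNIV and t=UNIV and g=f])
next
  case (Suc k)
  have d: "((\<lambda>x. f (r *\<^sub>R x + c)) has_derivative (\<lambda>h. frechet_derivative f (at (r *\<^sub>R x + c)) (r *\<^sub>R h))) (at x)" for x
    by (rule has_derivative_compose[OF _ Ck_SucD(1)[OF Suc.prems]]) (auto intro!: derivative_eq_intros)
  have lin: "frechet_derivative f (at y) (r *\<^sub>R h) = r * frechet_derivative f (at y) h" for y h
    using linear_scale[OF has_derivative_linear[OF Ck_SucD(1)[OF Suc.prems]]] by simp
  show ?case
    by (rule Ck_SucI[OF d[unfolded lin]]) (intro Ck_mult Ck_const Suc.IH Ck_SucD(2)[OF Suc.prems])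
qed

text \<open>The powers in the denominator make the family closed under differentiation: the
  derivative of member m combines the members m + 1 and m + 2. Smoothness of all members then
  follows by one induction on the order.\<close>

definition flat_exp :: "nat \<Rightarrow> real \<Rightarrow> real" where
  "flat_exp m s = (if s \<le> 0 then 0 else exp (- 1 / s) / s ^ m)"

lemma flat_exp_nonpos: "s \<le> 0 \<Longrightarrow> flat_exp m s = 0"
  by (simp add: flat_exp_def)

text \<open>With y = 1/s, the single term of order m + 1 in the exponential series gives that
  y^(m+1) is at most (m+1)! exp y. Vanishing of first order at 0 is what the derivative at 0
  requires.\<close>

lemma flat_exp_bound: "\<bar>flat_exp m s\<bar> \<le> fact (Suc m) * \<bar>s\<bar>"
proof (cases "s \<le> 0")
  case True
  then show ?thesis by (simp add: flat_exp_nonpos mult_nonneg_nonpos del: fact_Suc)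
next
  case False
  then have s: "s > 0" by simp
  define y where "y = 1 / s"
  have y: "y > 0" using s by (simp add: y_def)
  have "(\<Sum>n\<in>{Suc m}. inverse (fact n) *\<^sub>R y ^ n) \<le> (\<Sum>n. inverse (fact n) *\<^sub>R y ^ n)"
    using y by (intro sum_le_suminf summable_exp_generic) auto
  then have "y ^ Suc m / fact (Suc m) \<le> exp y" by (simp add: exp_def field_simps)
  then have "y ^ Suc m \<le> fact (Suc m) * exp y" by (simp add: field_simps del: fact_Suc power_Suc)
  then have "exp (- y) * y ^ Suc m \<le> fact (Suc m)" by (simp add: exp_minus field_simps del: fact_Suc power_Suc)
  then have "exp (- y) * y ^ m * y \<le> fact (Suc m)" by (simp add: mult_ac del: fact_Suc)
  then have "exp (- y) * y ^ m \<le> fact (Suc m) * s" using s by (simp add: y_def field_simps del: fact_Suc)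
  then show ?thesis using s by (simp add: flat_exp_def y_def power_divide field_simps del: fact_Suc)
qed

lemma flat_exp_deriv: "(flat_exp m has_real_derivative (- real m * flat_exp (Suc m) s + flat_exp (m + 2) s)) (at s)"
proof -
  consider "s < 0" | "s > 0" | "s = 0" by linarith
  then show ?thesis
  proof cases
    case 1
    have "((\<lambda>s. 0) has_real_derivative 0) (at s)" by simp
    then have "(flat_exp m has_real_derivative 0) (at s)"
      by (rule has_field_derivative_transform_within_open[of _ _ _ "{..<0}"]) (use 1 in \<open>auto simp: flat_exp_def\<close>)
    then show ?thesis using 1 by (simp add: flat_exp_def)
  next
    case 2
    have "((\<lambda>s. exp (- 1 / s) / s ^ m) has_real_derivative
        ((exp (- 1 / s) * (1 / s\<^sup>2)) * s ^ m - exp (- 1 / s) * (real m * s ^ (m - 1))) / (s ^ m * s ^ m)) (at s)"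
      using 2 by (auto intro!: derivative_eq_intros simp: power2_eq_square)
    moreover have "((exp (- 1 / s) * (1 / s\<^sup>2)) * s ^ m - exp (- 1 / s) * (real m * s ^ (m - 1))) / (s ^ m * s ^ m) =
      - real m * flat_exp (Suc m) s + flat_exp (m + 2) s"
      using 2 by (cases m) (simp_all add: flat_exp_def field_simps power2_eq_square)
    ultimately have "((\<lambda>s. exp (- 1 / s) / s ^ m) has_real_derivative - real m * flat_exp (Suc m) s + flat_exp (m + 2) s) (at s)" by simp
    then show ?thesis
      by (rule has_field_derivative_transform_within_open[of _ _ _ "{0<..}"]) (use 2 in \<open>auto simp: flat_exp_def\<close>)
  next
    case 3
    have "((\<lambda>h. flat_exp m h / h) \<longlongrightarrow> 0) (at 0)"
    proof (rule Lim_null_comparison)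
      show "\<forall>\<^sub>F h in at 0. norm (flat_exp m h / h) \<le> fact (Suc (Suc m)) * \<bar>h\<bar>"
      proof (rule always_eventually, rule allI)
        fix h :: real
        \<comment> \<open>The difference quotient at 0 is the next member of the family, which tends
          to 0 by the bound.\<close>
        have "norm (flat_exp m h / h) = \<bar>flat_exp (Suc m) h\<bar>" by (simp add: flat_exp_def)
        then show "norm (flat_exp m h / h) \<le> fact (Suc (Suc m)) * \<bar>h\<bar>" using flat_exp_bound[of "Suc m" h] by simp
      qed
      show "((\<lambda>h. fact (Suc (Suc m)) * \<bar>h\<bar>) \<longlongrightarrow> (0::real)) (at 0)"
        by (auto intro!: tendsto_eq_intros)
    qed
    then show ?thesis unfolding 3 DERIV_def by (simp add: flat_exp_nonpos)
  qed
qed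

lemma Ck_flat_exp: "Ck k (\<lambda>x. flat_exp m (r * (x \<bullet> v) + d))"
proof (induction k arbitrary: m)
  case 0
  have "continuous_on UNIV (flat_exp m)"
    using flat_exp_deriv by (intro DERIV_continuous_on[of UNIV "flat_exp m"]) (auto intro: has_field_derivative_at_within)
  then show ?case by (auto intro!: continuous_intros continuous_on_compose2[where s=UNIV and t=UNIV and g="flat_exp m"])
next
  case (Suc k)
  have d: "((\<lambda>x. flat_exp m (r * (x \<bullet> v) + d)) has_derivative
     (\<lambda>h. (r * (h \<bullet> v)) * (- real m * flat_exp (Suc m) (r * (x \<bullet> v) + d) + flat_exp (m + 2) (r * (x \<bullet> v) + d)))) (at x)" for x
    by (rule DERIV_compose_FDERIV[OF flat_exp_deriv]) (auto intro!: derivative_eq_intros)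
  show ?case by (rule Ck_SucI[OF d]) (intro Ck_mult Ck_add Ck_const Suc.IH)
qed

text \<open>A product over the coordinates of two one-sided cut-offs, written as affine arguments to
  suit \<open>Ck_flat_exp\<close>. The factor j + 1 makes exp(-1/((j+1)s)) tend to 1 for s > 0, so
  the bumps converge to the indicator of the open box.\<close>

definition box_bump :: "'a::euclidean_space \<Rightarrow> 'a \<Rightarrow> nat \<Rightarrow> 'a \<Rightarrow> real" where
  "box_bump a c j x = (\<Prod>b\<in>Basis. flat_exp 0 (real (Suc j) * (x \<bullet> b) + - real (Suc j) * (a \<bullet> b)) *
      flat_exp 0 (- real (Suc j) * (x \<bullet> b) + real (Suc j) * (c \<bullet> b)))"

lemma flat_exp_0: "0 \<le> flat_exp 0 s" "flat_exp 0 s \<le> 1" "flat_exp 0 s = 0 \<longleftrightarrow> s \<le> 0"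
  by (auto simp: flat_exp_def)

lemma box_bump_range: "0 \<le> box_bump a c j x" "box_bump a c j x \<le> 1"
  unfolding box_bump_def by (auto intro!: prod_nonneg prod_le_1 mult_nonneg_nonneg mult_le_one simp: flat_exp_0)

lemma box_bump_outside: "x \<notin> box a c \<Longrightarrow> box_bump a c j x = 0"
proof -
  assume "x \<notin> box a c"
  then obtain b where b: "b \<in> Basis" "x \<bullet> b \<le> a \<bullet> b \<or> c \<bullet> b \<le> x \<bullet> b" by (auto simp: mem_box not_less)
  have "real (Suc j) * (x \<bullet> b) \<le> real (Suc j) * (a \<bullet> b) \<or> real (Suc j) * (c \<bullet> b) \<le> real (Suc j) * (x \<bullet> b)"
    using b(2) by (auto intro: mult_left_mono)
  then have "flat_exp 0 (real (Suc j) * (x \<bullet> b) + - real (Suc j) * (a \<bullet> b)) = 0 \<or>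
      flat_exp 0 (- real (Suc j) * (x \<bullet> b) + real (Suc j) * (c \<bullet> b)) = 0"
    by (simp add: flat_exp_0 del: of_nat_Suc)
  then show "box_bump a c j x = 0" unfolding box_bump_def using b(1) by (intro prod_zero) auto
qed

lemma box_bump_test: assumes "cbox a c \<subseteq> S" shows "box_bump a c j \<in> test_functions S"
proof -
  have "Ck k (box_bump a c j)" for k
    unfolding box_bump_def[abs_def] by (intro Ck_prod Ck_mult Ck_flat_exp)
  moreover have "{x. box_bump a c j x \<noteq> 0} \<subseteq> cbox a c" using box_bump_outside[of _ a c j] box_subset_cbox by blast
  then have "closure {x. box_bump a c j x \<noteq> 0} \<subseteq> cbox a c" by (rule closure_minimal[OF _ closed_cbox])
  moreover from this have "compact (closure {x. box_bump a c j x \<noteq> 0})"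
    using bounded_subset[OF bounded_cbox] closed_closure compact_eq_bounded_closed by blast
  ultimately show ?thesis using assms by (auto simp: test_functions_def)
qed

lemma box_bump_lim: "(\<lambda>j. box_bump a c j x) \<longlonglongrightarrow> indicator (box a c) x"
proof (cases "x \<in> box a c")
  case True
  have lim: "(\<lambda>j. flat_exp 0 (real (Suc j) * s)) \<longlonglongrightarrow> 1" if "s > 0" for s
  proof -
    have "(\<lambda>j. exp (- (1 / s) * inverse (real (Suc j)))) \<longlonglongrightarrow> exp (- (1 / s) * 0)"
      by (intro tendsto_intros LIMSEQ_inverse_real_of_nat)
    moreover have "flat_exp 0 (real (Suc j) * s) = exp (- (1 / s) * inverse (real (Suc j)))" for j
    proof -
      have "\<not> real (Suc j) * s \<le> 0" using that by (simp add: mult_le_0_iff)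
      then show ?thesis using that by (simp add: flat_exp_def field_simps)
    qed
    ultimately show ?thesis by simp
  qed
  have "(\<lambda>j. \<Prod>b\<in>Basis. flat_exp 0 (real (Suc j) * (x \<bullet> b - a \<bullet> b)) * flat_exp 0 (real (Suc j) * (c \<bullet> b - x \<bullet> b)))
     \<longlonglongrightarrow> (\<Prod>b\<in>(Basis::'a set). 1 * 1)"
    using True by (intro tendsto_prod tendsto_mult lim) (auto simp: mem_box)
  then show ?thesis using True by (simp add: box_bump_def algebra_simps)
qed (simp add: box_bump_outside)

subsection \<open>The fundamental lemma and uniqueness of the time derivative\<close>

lemma LINT_lebesgue_on:
  fixes f :: "'a::euclidean_space \<Rightarrow> real"
  assumes "S \<in> sets lebesgue"
  shows "(LINT x|lebesgue_on S. f x) = (LINT x|lebesgue. indicator S x * f x)"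
  using integral_restrict_space[of S lebesgue f] assms by simp

lemma integrable_lebesgue_on:
  fixes f :: "'a::euclidean_space \<Rightarrow> real"
  assumes "S \<in> sets lebesgue"
  shows "integrable (lebesgue_on S) f \<longleftrightarrow> integrable lebesgue (\<lambda>x. indicator S x * f x)"
  using integrable_restrict_space[of S lebesgue f] assms by simp

lemma measurable_lebesgue_on:
  fixes f :: "'a::euclidean_space \<Rightarrow> real"
  assumes "S \<in> sets lebesgue"
  shows "f \<in> borel_measurable (lebesgue_on S) \<longleftrightarrow> (\<lambda>x. indicator S x * f x) \<in> borel_measurable lebesgue"
  using borel_measurable_restrict_space_iff[of S lebesgue f] assms by simp

lemma AE_lebesgue_on:
  assumes "S \<in> sets lebesgue"
  shows "(AE x in lebesgue_on S. P x) \<longleftrightarrow> (AE x in lebesgue. x \<in> S \<longrightarrow> P x)"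
  using AE_restrict_space_iff[of S lebesgue P] assms by simp

lemma l2_on_zero_extension:
  fixes f :: "'a::euclidean_space \<Rightarrow> real"
  assumes "S \<in> sets lebesgue"
  shows "f \<in> l2_on S \<longleftrightarrow> (\<lambda>x. indicator S x * f x) \<in> borel_measurable lebesgue \<and>
    integrable lebesgue (\<lambda>x. indicator S x * (f x)\<^sup>2)"
  by (simp add: l2_on_def measurable_lebesgue_on[OF assms] integrable_lebesgue_on[OF assms])

lemma borel_measurable_indicator_times:
  fixes f :: "'a \<Rightarrow> real"
  shows "A \<in> sets M \<Longrightarrow> f \<in> borel_measurable M \<Longrightarrow> (\<lambda>x. indicator A x * f x) \<in> borel_measurable M"
  by (intro borel_measurable_times borel_measurable_indicator)

lemma l2_on_subset:
  fixes f :: "'a::euclidean_space \<Rightarrow> real"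
  assumes f: "f \<in> l2_on S" and S: "S \<in> sets lebesgue" and A: "A \<in> sets lebesgue" "A \<subseteq> S"
  shows "f \<in> l2_on A"
proof -
  note F = f[unfolded l2_on_zero_extension[OF S]]
  have i: "indicator A x * (indicator S x * g) = indicator A x * g" for x and g :: real
    using A(2) by (auto simp: indicator_def)
  have "(\<lambda>x. indicator A x * (indicator S x * f x)) \<in> borel_measurable lebesgue"
    by (rule borel_measurable_indicator_times[OF A(1)]) (use F in simp)
  moreover have "integrable lebesgue (\<lambda>x. indicator A x * (indicator S x * (f x)\<^sup>2))"
    using F A(1) integrable_mult_indicator[of A lebesgue "\<lambda>x. indicator S x * (f x)\<^sup>2"] by simp
  ultimately show ?thesis unfolding l2_on_zero_extension[OF A(1)] i by simp
qed

lemma l2_on_integrable: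
  fixes f :: "'a::euclidean_space \<Rightarrow> real"
  assumes f: "f \<in> l2_on S" and S: "S \<in> lmeasurable"
  shows "integrable (lebesgue_on S) f"
  using finite_measure.square_integrable_imp_integrable[OF finite_measure_lebesgue_on[OF S], of f] f
  unfolding l2_on_def by blast

text \<open>A Dynkin argument: boxes are stable under intersection and generate the Borel sets, and
  \<open>tot\<close> handles complements, so the integral over every Borel set vanishes. Testing the
  sets where h is positive and where it is negative finishes.\<close>

lemma AE_zero_if_box_integrals_zero:
  fixes h :: "'a::euclidean_space \<Rightarrow> real"
  assumes h: "integrable lborel h" and tot: "(LINT x|lborel. h x) = 0"
    and box: "\<And>a b. (LINT x|lborel. indicator (box a b) x * h x) = 0"
  shows "AE x in lborel. h x = 0"
proof -
  have int: "integrable lborel (\<lambda>x. indicator A x * h x)" if "A \<in> sets borel" for A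
    using integrable_mult_indicator[of A lborel h] h that by simp
  have zero: "(LINT x|lborel. indicator A x * h x) = 0" if "A \<in> sets borel" for A
  proof -
    have A: "A \<in> sigma_sets UNIV (range (\<lambda>(a, b). box a b :: 'a set))"
      using that by (simp add: borel_eq_box)
    have stable: "Int_stable (range (\<lambda>(a, b). box a b :: 'a set))"
    proof (rule Int_stableI)
      fix X Y assume "X \<in> range (\<lambda>(a, b). box a b :: 'a set)" "Y \<in> range (\<lambda>(a, b). box a b :: 'a set)"
      then obtain a b c d where "X = box a b" "Y = box c d" by auto
      then have "X \<inter> Y = (\<lambda>(a, b). box a b) ((\<Sum>i\<in>Basis. max (a\<bullet>i) (c\<bullet>i) *\<^sub>R i), (\<Sum>i\<in>Basis. min (b\<bullet>i) (d\<bullet>i) *\<^sub>R i))"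
        by (simp add: box_Int_box)
      then show "X \<inter> Y \<in> range (\<lambda>(a, b). box a b :: 'a set)" by blast
    qed
    have "range (\<lambda>(a, b). box a b :: 'a set) \<subseteq> Pow UNIV" by simp
    with stable show ?thesis using A
    proof (induction A rule: sigma_sets_induct_disjoint)
      case (basic A) then show ?case using box by auto
    next
      case (compl A)
      then have A: "A \<in> sets borel" by (simp add: borel_eq_box)
      have "(LINT x|lborel. indicator (UNIV - A) x * h x) = (LINT x|lborel. h x - indicator A x * h x)"
        by (intro Bochner_Integration.integral_cong) (auto simp: indicator_def)
      also have "\<dots> = 0" using compl tot by (simp add: h int[OF A])
      finally show ?case .
    next
      case (union A)
      then have A: "A i \<in> sets borel" for i by (simp add: borel_eq_box subset_eq)
      have "(LINT x:(\<Union>i. A i)|lborel. h x) = (\<Sum>i. (LINT x:(A i)|lborel. h x))"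
        using union(1) by (intro lebesgue_integral_countable_add)
          (auto simp: disjoint_family_on_def A set_integrable_def intro!: int sets.countable_UN)
      then show ?case using union by (simp add: set_lebesgue_integral_def)
    qed simp
  qed
  have [measurable]: "h \<in> borel_measurable borel" using h by auto
  have pos: "integrable lborel (\<lambda>x. indicator {x. h x > 0} x * h x)"
    and neg: "integrable lborel (\<lambda>x. - (indicator {x. h x < 0} x * h x))"
    by (intro integrable_minus int; measurable)+
  have "(LINT x|lborel. indicator {x. h x > 0} x * h x) = 0" by (rule zero) measurable
  then have p: "AE x in lborel. indicator {x. h x > 0} x * h x = 0"
    by (subst (asm) integral_nonneg_eq_0_iff_AE[OF pos]) (auto simp: indicator_def)
  have "(LINT x|lborel. indicator {x. h x < 0} x * h x) = 0" by (rule zero) measurable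
  then have "(LINT x|lborel. - (indicator {x. h x < 0} x * h x)) = 0" by simp
  then have n: "AE x in lborel. - (indicator {x. h x < 0} x * h x) = 0"
    by (subst (asm) integral_nonneg_eq_0_iff_AE[OF neg]) (auto simp: indicator_def)
  show ?thesis using p n by eventually_elim (auto simp: indicator_def split: if_splits)
qed

text \<open>S may have infinite measure and f need not be integrable on it, so the argument is
  local. Inside a closed box contained in S, bumps converge dominatedly to indicators of open boxes;
  countably many such closed boxes cover S.\<close>

theorem fundamental_lemma_variations:
  fixes f :: "'a::euclidean_space \<Rightarrow> real"
  assumes S: "open S" and f: "f \<in> l2_on S"
    and zero: "\<And>\<psi>. \<psi> \<in> test_functions S \<Longrightarrow> (LINT x|lebesgue_on S. f x * \<psi> x) = 0"
  shows "AE x in lebesgue_on S. f x = 0"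
proof -
  have SM: "S \<in> sets lebesgue" using S by simp
  have int_on: "integrable lebesgue (\<lambda>x. indicator (cbox a c) x * f x)" if "cbox a c \<subseteq> S" for a c
  proof -
    have "integrable (lebesgue_on (cbox a c)) f"
      using l2_on_integrable[OF l2_on_subset[OF f SM _ that]] by simp
    then show ?thesis by (simp add: integrable_lebesgue_on)
  qed
  have box0: "(LINT x|lebesgue. indicator (box a c) x * f x) = 0" if ac: "cbox a c \<subseteq> S" for a c
  proof -
    have "(\<lambda>j. LINT x|lebesgue. indicator S x * (f x * box_bump a c j x)) \<longlonglongrightarrow> (LINT x|lebesgue. indicator (box a c) x * f x)"
    proof (rule integral_dominated_convergence[where w="\<lambda>x. \<bar>indicator (cbox a c) x * f x\<bar>"])
      show "integrable lebesgue (\<lambda>x. \<bar>indicator (cbox a c) x * f x\<bar>)" using int_on[OF ac] by (rule integrable_abs)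
      have m: "(\<lambda>x. indicator (cbox a c) x * f x) \<in> borel_measurable lebesgue" using int_on[OF ac] by auto
      have eqb: "indicator (box a c) x * (indicator (cbox a c) x * f x) = indicator (box a c) x * f x" for x
        using box_subset_cbox[of a c] by (auto simp: indicator_def)
      have "(\<lambda>x. indicator (box a c) x * (indicator (cbox a c) x * f x)) \<in> borel_measurable lebesgue"
        by (rule borel_measurable_indicator_times[OF _ m]) simp
      then show "(\<lambda>x. indicator (box a c) x * f x) \<in> borel_measurable lebesgue" unfolding eqb .
      show "(\<lambda>x. indicator S x * (f x * box_bump a c j x)) \<in> borel_measurable lebesgue" for j
      proof -
        have "continuous_on UNIV (box_bump a c j)" using box_bump_test[OF ac, of j]
          by (auto simp: test_functions_def dest: spec[where x=0])
        then have "box_bump a c j \<in> borel_measurable lebesgue"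
          by (intro measurable_completion) (simp add: borel_measurable_continuous_onI)
        then have "(\<lambda>x. (indicator S x * f x) * box_bump a c j x) \<in> borel_measurable lebesgue"
          using f unfolding l2_on_zero_extension[OF SM] by (elim conjE) (rule borel_measurable_times)
        then show ?thesis by (simp add: mult.assoc)
      qed
      show "AE x in lebesgue. norm (indicator S x * (f x * box_bump a c j x)) \<le> \<bar>indicator (cbox a c) x * f x\<bar>" for j
      proof (rule AE_I2)
        fix x
        show "norm (indicator S x * (f x * box_bump a c j x)) \<le> \<bar>indicator (cbox a c) x * f x\<bar>"
        proof (cases "x \<in> box a c")
          case True
          then have x: "x \<in> S" "x \<in> cbox a c" using ac box_subset_cbox by blast+
          have "\<bar>f x\<bar> * box_bump a c j x \<le> \<bar>f x\<bar> * 1" by (intro mult_left_mono box_bump_range) simp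
          then show ?thesis using x by (simp add: abs_mult box_bump_range)
        qed (simp add: box_bump_outside)
      qed
      show "AE x in lebesgue. (\<lambda>j. indicator S x * (f x * box_bump a c j x)) \<longlonglongrightarrow> indicator (box a c) x * f x"
      proof (rule AE_I2)
        fix x
        have "(\<lambda>j. indicator S x * (f x * box_bump a c j x)) \<longlonglongrightarrow> indicator S x * (f x * indicator (box a c) x)"
          by (intro tendsto_intros box_bump_lim)
        moreover have "indicator S x * (f x * indicator (box a c) x) = indicator (box a c) x * f x"
          using ac box_subset_cbox[of a c] by (auto simp: indicator_def)
        ultimately show "(\<lambda>j. indicator S x * (f x * box_bump a c j x)) \<longlonglongrightarrow> indicator (box a c) x * f x" by simp
      qed
    qed
    moreover have "(LINT x|lebesgue. indicator S x * (f x * box_bump a c j x)) = 0" for j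
      using zero[OF box_bump_test[OF ac, of j]] by (simp add: LINT_lebesgue_on[OF SM])
    ultimately show ?thesis by (simp add: LIMSEQ_const_iff)
  qed
  have local: "AE x in lebesgue. x \<in> cbox a c \<longrightarrow> f x = 0" if ac: "cbox a c \<subseteq> S" for a c
  proof -
    let ?h = "\<lambda>x. indicator (box a c) x * f x"
    have "integrable lebesgue (\<lambda>x. indicator (box a c) x * (indicator (cbox a c) x * f x))"
      using integrable_mult_indicator[OF _ int_on[OF ac], of "box a c"] by simp
    moreover have eqb: "indicator (box a c) x * (indicator (cbox a c) x * f x) = ?h x" for x
      using box_subset_cbox[of a c] by (auto simp: indicator_def)
    ultimately have hi: "integrable lebesgue ?h" by simp
    \<comment> \<open>The Dynkin argument works on \<open>lborel\<close>, so \<open>?h\<close> is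
      replaced by a Borel function equal to it almost everywhere.\<close>
    then obtain h' where h': "h' \<in> borel_measurable lborel" "AE x in lborel. ?h x = h' x"
      using completion_ex_borel_measurable_real[of ?h lborel] by auto
    then have ae: "AE x in lebesgue. ?h x = h' x" by (intro AE_completion)
    have h'm: "h' \<in> borel_measurable lebesgue" using h'(1) by (rule measurable_completion)
    have h'i: "integrable lborel h'"
      using integrable_cong_AE_imp[OF hi h'm] ae integrable_completion[OF h'(1)] by (simp add: eq_commute)
    have eq: "(LINT x|lborel. indicator A x * h' x) = (LINT x|lebesgue. indicator A x * ?h x)" if "A \<in> sets borel" for A
    proof -
      have "(LINT x|lborel. indicator A x * h' x) = (LINT x|lebesgue. indicator A x * h' x)"
        using h'(1) that by (intro integral_completion[symmetric] borel_measurable_indicator_times) auto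
      also have "\<dots> = (LINT x|lebesgue. indicator A x * ?h x)"
      proof (rule integral_cong_AE)
        show "AE x in lebesgue. indicator A x * h' x = indicator A x * ?h x" using ae by eventually_elim simp
        have A: "A \<in> sets lebesgue" using that by auto
        show "(\<lambda>x. indicator A x * h' x) \<in> borel_measurable lebesgue" "(\<lambda>x. indicator A x * ?h x) \<in> borel_measurable lebesgue"
          by (rule borel_measurable_indicator_times[OF A h'm],
              rule borel_measurable_indicator_times[OF A borel_measurable_integrable[OF hi]])
      qed
      finally show ?thesis .
    qed
    have "AE x in lborel. h' x = 0"
    proof (rule AE_zero_if_box_integrals_zero[OF h'i])
      show "(LINT x|lborel. h' x) = 0" using eq[of UNIV] box0[OF ac] by simp
      fix p q
      obtain r s where rs: "box p q \<inter> box a c = box r s" using box_Int_box by blast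
      have "(LINT x|lebesgue. indicator (box p q) x * ?h x) = (LINT x|lebesgue. indicator (box r s) x * f x)"
        unfolding rs[symmetric] by (intro Bochner_Integration.integral_cong) (auto simp: indicator_def)
      also have "\<dots> = 0"
      proof (cases "box r s = {}")
        \<comment> \<open>A nonempty open box has the closed box as its closure, which keeps
          \<open>cbox r s\<close> inside \<open>cbox a c\<close> and hence inside S. For an empty
          box this inclusion could fail.\<close>
        case False
        then have "cbox r s = closure (box r s)" by (simp add: closure_box)
        also have "\<dots> \<subseteq> closure (box a c)" using rs by (intro closure_mono) auto
        also have "\<dots> \<subseteq> cbox a c" using box_subset_cbox by (rule closure_minimal) (rule closed_cbox)
        finally show ?thesis using ac by (intro box0) auto
      qed simp
      finally show "(LINT x|lborel. indicator (box p q) x * h' x) = 0" using eq[of "box p q"] by simp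
    qed
    then have "AE x in lebesgue. h' x = 0" by (rule AE_completion)
    \<comment> \<open>The integrals only see the open box, the covering consists of closed ones; the
      difference is a null set.\<close>
    moreover have "AE x in lebesgue. x \<notin> cbox a c - box a c"
      using negligible_frontier_interval[of a c] by (intro AE_not_in) (simp add: negligible_iff_null_sets)
    ultimately show ?thesis using ae by eventually_elim (auto simp: indicator_def split: if_splits)
  qed
  obtain D where D: "countable D" "D \<subseteq> Pow S" "\<And>X. X \<in> D \<Longrightarrow> \<exists>a b. X = cbox a b" "\<Union>D = S"
    using open_countable_Union_open_cbox[OF S] by metis
  have "AE x in lebesgue. \<forall>X\<in>D. x \<in> X \<longrightarrow> f x = 0"
  proof (subst AE_ball_countable[OF D(1)], intro ballI)
    fix X assume X: "X \<in> D"
    obtain a b where "X = cbox a b" using D(3)[OF X] by blast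
    then show "AE x in lebesgue. x \<in> X \<longrightarrow> f x = 0" using local[of a b] X D(2) by blast
  qed
  then have "AE x in lebesgue. x \<in> S \<longrightarrow> f x = 0" using D(4) by (auto elim!: eventually_mono)
  then show ?thesis by (simp add: AE_lebesgue_on SM)
qed

text \<open>The countable set tests the values of simple approximants of the difference d, not d
  itself. If d vanishes on these tests, the norm of an approximant is at most its distance to d, so
  the norm of d is at most twice that distance and tends to 0.\<close>

theorem (in seminormed) time_deriv_unique:
  assumes w1: "has_time_deriv T (dual X) u w1" and w2: "has_time_deriv T (dual X) u w2"
  shows "AE t in lebesgue_on {0<..<T}. w1 t \<in> elts (dual X) \<and> w2 t \<in> elts (dual X) \<and> (\<forall>\<phi>\<in>elts X. w1 t \<phi> = w2 t \<phi>)"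
proof -
  let ?M = "lebesgue_on {0<..<T}"
  interpret D: seminormed "dual X" by (rule seminormed_dual)
  have C: "complete_measure ?M" by (simp add: complete_measure_lebesgue_on)
  have F: "finite_measure ?M" by (rule finite_measure_Ioo)
  have mem: "u \<in> bochner_l2 ?M (dual X)" "w1 \<in> bochner_l2 ?M (dual X)" "w2 \<in> bochner_l2 ?M (dual X)"
    using w1 w2 by (auto simp: has_time_deriv_def)
  define d where "d = (\<lambda>t x. 1 * w1 t x + (-1) * w2 t x)"
  have d: "d \<in> bochner_l2 ?M (dual X)" unfolding d_def by (rule D.bochner_l2_comb[OF C mem(2,3)])
  note dD = D.bochner_l2D[OF C d]
  have test_meas: "\<psi> \<in> borel_measurable ?M" "deriv \<psi> \<in> borel_measurable ?M" "bounded (range \<psi>)"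
    if "\<psi> \<in> test_functions {0<..<T}" for \<psi> :: "real \<Rightarrow> real"
  proof -
    have ck: "Ck k \<psi>" for k using that by (auto simp: test_functions_def)
    have "continuous_on UNIV \<psi>" using ck[of 0] by simp
    then show "\<psi> \<in> borel_measurable ?M"
      by (intro measurable_restrict_space1 measurable_completion) (simp add: borel_measurable_continuous_onI)
    \<comment> \<open>Smoothness of test functions is phrased by Frechet derivatives, the time
      derivative by \<open>deriv\<close>. Identifying them on the line gives continuity of
      \<open>deriv \<psi>\<close>.\<close>
    have "deriv \<psi> t = frechet_derivative \<psi> (at t) 1" for t
    proof (rule DERIV_imp_deriv)
      have "(\<psi> has_derivative frechet_derivative \<psi> (at t)) (at t)" by (rule Ck_SucD(1)[OF ck])
      moreover have "frechet_derivative \<psi> (at t) = (*) (frechet_derivative \<psi> (at t) 1)"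
      proof
        fix h show "frechet_derivative \<psi> (at t) h = frechet_derivative \<psi> (at t) 1 * h"
          using linear_scale[OF has_derivative_linear[OF calculation], of h 1] by simp
      qed
      ultimately show "(\<psi> has_real_derivative frechet_derivative \<psi> (at t) 1) (at t)"
        by (simp add: has_field_derivative_def)
    qed
    moreover have "continuous_on UNIV (\<lambda>t. frechet_derivative \<psi> (at t) 1)"
      using Ck_SucD(2)[OF ck[of "Suc 0"], of 1] by simp
    ultimately have "continuous_on UNIV (deriv \<psi>)" by presburger
    then show "deriv \<psi> \<in> borel_measurable ?M"
      by (intro measurable_restrict_space1 measurable_completion) (simp add: borel_measurable_continuous_onI)
    let ?K = "closure {x. \<psi> x \<noteq> 0}"
    have "bounded (\<psi> ` ?K)"
      using that \<open>continuous_on UNIV \<psi>\<close>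
      by (intro compact_imp_bounded compact_continuous_image) (auto simp: test_functions_def intro: continuous_on_subset)
    then have "bounded (insert 0 (\<psi> ` ?K))" by simp
    then show "bounded (range \<psi>)"
      by (rule bounded_subset) (use closure_subset[of "{x. \<psi> x \<noteq> 0}"] in blast)
  qed
  have scalar: "AE t in ?M. d t \<phi> = 0" if \<phi>: "\<phi> \<in> elts X" for \<phi>
  proof (rule fundamental_lemma_variations)
    note m = dual_bochner_l2_apply[OF C _ \<phi>]
    show "(\<lambda>t. d t \<phi>) \<in> l2_on {0<..<T}" using m[OF d] by (simp add: l2_on_def)
    fix \<psi> :: "real \<Rightarrow> real" assume \<psi>: "\<psi> \<in> test_functions {0<..<T}"
    note tm = test_meas[OF \<psi>]
    have J: "\<exists>J. has_integral_in ?M (dual X) (\<lambda>t x. deriv \<psi> t * u t x) J \<and>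
        has_integral_in ?M (dual X) (\<lambda>t x. \<psi> t * w t x) (\<lambda>x. - J x)" if "has_time_deriv T (dual X) u w" for w
      using that \<psi> by (auto simp: has_time_deriv_def)
    \<comment> \<open>The vector integrals J obtained for \<open>w1\<close> and \<open>w2\<close>
      are a priori unrelated. Evaluated at \<phi>, both become the same scalar integral of
      u.\<close>
    have val: "(LINT t|?M. \<psi> t * w t \<phi>) = - (LINT t|?M. deriv \<psi> t * u t \<phi>)" if w: "has_time_deriv T (dual X) u w" for w
    proof -
      have wm: "w \<in> bochner_l2 ?M (dual X)" using w by (simp add: has_time_deriv_def)
      obtain J where J1: "has_integral_in ?M (dual X) (\<lambda>t x. deriv \<psi> t * u t x) J"
        and J2: "has_integral_in ?M (dual X) (\<lambda>t x. \<psi> t * w t x) (\<lambda>x. - J x)" using J[OF w] by blast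
      show ?thesis
        using has_integral_in_dual_apply[OF C F J1 \<phi>] has_integral_in_dual_apply[OF C F J2 \<phi>]
          m(1)[OF mem(1)] m(1)[OF wm] tm(1,2) by (simp add: borel_measurable_times)
    qed
    have int: "integrable ?M (\<lambda>t. \<psi> t * w t \<phi>)" if "w \<in> bochner_l2 ?M (dual X)" for w
    proof -
      have wi: "integrable ?M (\<lambda>t. w t \<phi>)"
        using finite_measure.square_integrable_imp_integrable[OF F m[OF that]] .
      obtain B where B: "\<And>t. norm (\<psi> t) \<le> B" using tm(3) unfolding bounded_iff by auto
      show ?thesis
      proof (rule Bochner_Integration.integrable_bound[OF integrable_mult_right[OF wi, of B]])
        show "(\<lambda>t. \<psi> t * w t \<phi>) \<in> borel_measurable ?M" using tm(1) m(1)[OF that] by (rule borel_measurable_times)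
        have "\<bar>\<psi> t\<bar> \<le> \<bar>B\<bar>" for t using B[of t] by simp
        then show "AE t in ?M. norm (\<psi> t * w t \<phi>) \<le> norm (B * w t \<phi>)"
          by (intro AE_I2) (auto simp: abs_mult intro!: mult_right_mono)
      qed
    qed
    have "(LINT t|?M. d t \<phi> * \<psi> t) = (LINT t|?M. \<psi> t * w1 t \<phi> - \<psi> t * w2 t \<phi>)"
      by (simp add: d_def algebra_simps)
    also have "\<dots> = 0" by (simp add: int mem val[OF w1] val[OF w2])
    finally show "(LINT t|?M. d t \<phi> * \<psi> t) = 0" .
  qed simp
  obtain s where s: "\<And>k. simple_function ?M (s k)" "\<And>k. s k ` space ?M \<subseteq> elts (dual X)"
    "AE t in ?M. (\<lambda>k. nrm (dual X) (\<lambda>x. s k t x - d t x)) \<longlonglongrightarrow> 0" using dD(2) unfolding strongly_measurable_def by blast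
  \<comment> \<open>A countable set near almost all values of d, in place of a dense subset of its
    essentially separable range.\<close>
  define V where "V = (\<Union>k. s k ` space ?M)"
  have V: "countable V"
    unfolding V_def by (intro countable_UN countable_finite simple_functionD(1)[OF s(1)] countableI_type)
  have Vd: "V \<subseteq> elts (dual X)" unfolding V_def by (rule UN_least) (rule s(2))
  have "\<exists>\<phi>. \<phi> \<in> elts X \<and> nrm X \<phi> \<le> 1 \<and> nrm (dual X) c - 1 / real (Suc n) < \<bar>c \<phi>\<bar>" if "c \<in> V" for c n
    using dual_near[of c "1 / real (Suc n)"] that Vd by (metis of_nat_0_less_iff subsetD zero_less_Suc zero_less_divide_1_iff)
  then obtain p where p: "\<And>c n. c \<in> V \<Longrightarrow> p c n \<in> elts X \<and> nrm X (p c n) \<le> 1 \<and> nrm (dual X) c - 1 / real (Suc n) < \<bar>c (p c n)\<bar>"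
    by metis
  have "AE t in ?M. \<forall>c\<in>V. \<forall>n. d t (p c n) = 0"
    by (subst AE_ball_countable[OF V], intro ballI, subst AE_all_countable) (use p scalar in blast)
  then have "AE t in ?M. nrm (dual X) (d t) = 0"
    using s(3) dD(1) AE_space
  proof eventually_elim
    case (elim t)
    have sk: "s k t \<in> V" for k using elim(4) unfolding V_def by blast
    then have skd: "s k t \<in> elts (dual X)" for k using Vd by blast
    \<comment> \<open>A test element that nearly attains the norm of \<open>s k t\<close>
      annihilates \<open>d t\<close>, so it sees only their difference.\<close>
    have le: "nrm (dual X) (s k t) \<le> nrm (dual X) (\<lambda>x. s k t x - d t x)" for k
    proof (rule field_le_epsilon)
      fix e :: real assume "e > 0"
      then obtain n where n: "1 / real (Suc n) < e" using nat_approx_posE by blast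
      let ?\<phi> = "p (s k t) n"
      note pp = p[OF sk, of k n]
      have "\<bar>s k t ?\<phi>\<bar> = \<bar>s k t ?\<phi> - d t ?\<phi>\<bar>" using elim(1) sk by simp
      also have "\<dots> \<le> nrm (dual X) (\<lambda>x. s k t x - d t x) * nrm X ?\<phi>"
        using dual_bound[OF D.diff_elts[OF skd elim(3)], of ?\<phi> k] pp by simp
      also have "\<dots> \<le> nrm (dual X) (\<lambda>x. s k t x - d t x) * 1"
        using pp by (intro mult_left_mono dual_nonneg D.diff_elts skd elim) auto
      finally show "nrm (dual X) (s k t) \<le> nrm (dual X) (\<lambda>x. s k t x - d t x) + e" using pp n by simp
    qed
    have "nrm (dual X) (d t) \<le> 2 * nrm (dual X) (\<lambda>x. s k t x - d t x)" for k
      using le[of k] D.nrm_diff_abs[OF skd elim(3), of k] by linarith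
    moreover have "(\<lambda>k. 2 * nrm (dual X) (\<lambda>x. s k t x - d t x)) \<longlonglongrightarrow> 0"
      using tendsto_mult_left[OF elim(2), of 2] by simp
    ultimately have "nrm (dual X) (d t) \<le> 0" by (meson LIMSEQ_le_const)
    then show ?case using dual_nonneg[OF elim(3)] by simp
  qed
  then show ?thesis using dD(1) D.bochner_l2D(1)[OF C mem(2)] D.bochner_l2D(1)[OF C mem(3)]
  proof eventually_elim
    case (elim t)
    have "d t \<phi> = 0" if "\<phi> \<in> elts X" for \<phi> using dual_bound[OF elim(2) that] elim(1) by simp
    then show ?case using elim(3,4) by (simp add: d_def)
  qed
qed

subsection \<open>Square integrable functions\<close>

locale semi_inner =
  fixes V :: "('x \<Rightarrow> real) set" and B :: "('x \<Rightarrow> real) \<Rightarrow> ('x \<Rightarrow> real) \<Rightarrow> real"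
  assumes V_zero: "(\<lambda>x. 0) \<in> V"
    and V_comb: "\<And>u v a b. u \<in> V \<Longrightarrow> v \<in> V \<Longrightarrow> (\<lambda>x. a * u x + b * v x) \<in> V"
    and B_sym: "\<And>u v. u \<in> V \<Longrightarrow> v \<in> V \<Longrightarrow> B u v = B v u"
    and B_lin: "\<And>u v w a b. u \<in> V \<Longrightarrow> v \<in> V \<Longrightarrow> w \<in> V \<Longrightarrow> B (\<lambda>x. a * u x + b * v x) w = a * B u w + b * B v w"
    and B_pos: "\<And>u. u \<in> V \<Longrightarrow> 0 \<le> B u u"
begin

lemma B_comb_comb:
  assumes "u \<in> V" "v \<in> V"
  shows "B (\<lambda>x. a * u x + b * v x) (\<lambda>x. a * u x + b * v x) = a\<^sup>2 * B u u + 2 * (a * b * B u v) + b\<^sup>2 * B v v"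
proof -
  let ?w = "\<lambda>x. a * u x + b * v x"
  have w: "?w \<in> V" by (rule V_comb[OF assms])
  have "B ?w ?w = a * B ?w u + b * B ?w v"
    unfolding B_lin[OF assms w] B_sym[OF assms(1) w] B_sym[OF assms(2) w] ..
  also have "\<dots> = a * (a * B u u + b * B v u) + b * (a * B u v + b * B v v)"
    unfolding B_lin[OF assms assms(1)] B_lin[OF assms assms(2)] ..
  finally show ?thesis using B_sym[OF assms] by (simp add: power2_eq_square algebra_simps)
qed

text \<open>The form is only positive semidefinite, so the case in which v has length zero cannot be
  settled by v = 0; the nonnegative quadratic form then degenerates to a linear function of b, which
  forces its slope to vanish.\<close>

lemma cauchy_schwarz: assumes "u \<in> V" "v \<in> V" shows "\<bar>B u v\<bar> \<le> sqrt (B u u) * sqrt (B v v)"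
proof -
  have q: "0 \<le> a\<^sup>2 * B u u + 2 * (a * b * B u v) + b\<^sup>2 * B v v" for a b
    using B_pos[OF V_comb[OF assms, of a b]] B_comb_comb[OF assms, of a b] by simp
  have "(B u v)\<^sup>2 \<le> B u u * B v v"
  proof (cases "B v v = 0")
    case True
    have "B u v = 0"
    proof (rule ccontr)
      assume ne: "B u v \<noteq> 0"
      \<comment> \<open>With this b the form equals B u u - (B u u + 1) = -1.\<close>
      show False using q[of 1 "- (B u u + 1) / (2 * B u v)"] True ne by (simp add: field_simps)
    qed
    then show ?thesis using True by simp
  next
    case False
    then have pos: "B v v > 0" using B_pos[OF assms(2)] by simp
    \<comment> \<open>Up to scaling, these coefficients minimise the form; its value there is
      \<open>B v v\<close> times the gap in the inequality.\<close>
    have "0 \<le> (B v v)\<^sup>2 * B u u + 2 * (B v v * (- B u v) * B u v) + (- B u v)\<^sup>2 * B v v" by (rule q)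
    then have "0 \<le> B v v * (B u u * B v v - (B u v)\<^sup>2)" by (simp add: power2_eq_square algebra_simps)
    then show ?thesis using pos by (simp add: zero_le_mult_iff)
  qed
  then have "sqrt ((B u v)\<^sup>2) \<le> sqrt (B u u * B v v)" by (rule real_sqrt_le_mono)
  then show ?thesis by (simp add: real_sqrt_mult)
qed

lemma seminormed_sqrt: "seminormed (FSpace V (\<lambda>u. sqrt (B u u)))"
proof
  fix u v a b assume "u \<in> elts (FSpace V (\<lambda>u. sqrt (B u u)))" "v \<in> elts (FSpace V (\<lambda>u. sqrt (B u u)))"
  then have uv: "u \<in> V" "v \<in> V" by auto
  have "a * b * B u v \<le> \<bar>a * b\<bar> * (sqrt (B u u) * sqrt (B v v))"
  proof -
    have "a * b * B u v \<le> \<bar>a * b\<bar> * \<bar>B u v\<bar>" by (metis abs_ge_self abs_mult)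
    also have "\<dots> \<le> \<bar>a * b\<bar> * (sqrt (B u u) * sqrt (B v v))" by (intro mult_left_mono cauchy_schwarz uv) simp
    finally show ?thesis .
  qed
  then have "B (\<lambda>x. a * u x + b * v x) (\<lambda>x. a * u x + b * v x) \<le> (\<bar>a\<bar> * sqrt (B u u) + \<bar>b\<bar> * sqrt (B v v))\<^sup>2"
    unfolding B_comb_comb[OF uv] using B_pos[OF uv(1)] B_pos[OF uv(2)]
    by (simp add: power2_sum power_mult_distrib abs_mult mult_ac)
  then show "nrm (FSpace V (\<lambda>u. sqrt (B u u))) (\<lambda>x. a * u x + b * v x)
      \<le> \<bar>a\<bar> * nrm (FSpace V (\<lambda>u. sqrt (B u u))) u + \<bar>b\<bar> * nrm (FSpace V (\<lambda>u. sqrt (B u u))) v"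
    unfolding fspace.sel using B_pos[OF uv(1)] B_pos[OF uv(2)] by (intro real_le_lsqrt) simp_all
qed (use V_zero V_comb in auto)

end

lemma l2_on_mult_integrable:
  assumes "f \<in> l2_on S" "g \<in> l2_on S" shows "integrable (lebesgue_on S) (\<lambda>x. f x * g x)"
proof (rule Bochner_Integration.integrable_bound)
  show "integrable (lebesgue_on S) (\<lambda>x. (f x)\<^sup>2 + (g x)\<^sup>2)" using assms by (auto simp: l2_on_def)
  show "(\<lambda>x. f x * g x) \<in> borel_measurable (lebesgue_on S)"
    by (rule borel_measurable_times) (use assms in \<open>simp_all add: l2_on_def\<close>)
  have "\<bar>f x * g x\<bar> \<le> (f x)\<^sup>2 + (g x)\<^sup>2" for x
  proof -
    have "0 \<le> \<bar>f x\<bar> * \<bar>g x\<bar>" by simp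
    moreover have "2 * \<bar>f x\<bar> * \<bar>g x\<bar> \<le> (f x)\<^sup>2 + (g x)\<^sup>2" using sum_squares_bound[of "\<bar>f x\<bar>" "\<bar>g x\<bar>"] by simp
    ultimately show ?thesis unfolding abs_mult by linarith
  qed
  then show "AE x in lebesgue_on S. norm (f x * g x) \<le> norm ((f x)\<^sup>2 + (g x)\<^sup>2)" by simp
qed

lemma l2_on_comb: assumes "f \<in> l2_on S" "g \<in> l2_on S" shows "(\<lambda>x. a * f x + b * g x) \<in> l2_on S"
proof -
  have "(\<lambda>x. (a * f x + b * g x)\<^sup>2) = (\<lambda>x. a\<^sup>2 * (f x)\<^sup>2 + 2 * a * b * (f x * g x) + b\<^sup>2 * (g x)\<^sup>2)"
    by (simp add: power2_eq_square algebra_simps)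
  moreover have "integrable (lebesgue_on S) (\<lambda>x. a\<^sup>2 * (f x)\<^sup>2 + 2 * a * b * (f x * g x) + b\<^sup>2 * (g x)\<^sup>2)"
    using assms l2_on_mult_integrable[OF assms] by (auto simp: l2_on_def simp del: integrable_mult_right_iff intro!: Bochner_Integration.integrable_add integrable_mult_right)
  moreover have "(\<lambda>x. a * f x + b * g x) \<in> borel_measurable (lebesgue_on S)"
    by (intro borel_measurable_add borel_measurable_times borel_measurable_const) (use assms in \<open>simp_all add: l2_on_def\<close>)
  ultimately show ?thesis by (simp add: l2_on_def)
qed

interpretation l2: semi_inner "l2_on S" "l2_inner S" for S :: "'a::euclidean_space set"
proof
  show "(\<lambda>x. 0) \<in> l2_on S" by (simp add: l2_on_def)
  show "u \<in> l2_on S \<Longrightarrow> v \<in> l2_on S \<Longrightarrow> w \<in> l2_on S \<Longrightarrow>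
      l2_inner S (\<lambda>x. a * u x + b * v x) w = a * l2_inner S u w + b * l2_inner S v w" for u v w a b
    unfolding l2_inner_def
    by (simp add: distrib_right mult.assoc l2_on_mult_integrable)
qed (auto simp: l2_inner_def mult.commute intro: l2_on_comb)

interpretation L2: seminormed "L2 S" for S :: "'a::euclidean_space set"
  using l2.seminormed_sqrt[of S] by (simp add: L2_def l2_norm_def[abs_def])

lemma L2_sel [simp]: "elts (L2 S) = l2_on S" "nrm (L2 S) = l2_norm S"
  by (simp_all add: L2_def)

lemma l2_norm_power2: "f \<in> l2_on S \<Longrightarrow> (l2_norm S f)\<^sup>2 = (LINT x|lebesgue_on S. (f x)\<^sup>2)"
  using l2.B_pos[of f S] by (simp add: l2_norm_def l2_inner_def power2_eq_square)

lemma l2_norm_eq_0: assumes "f \<in> l2_on S"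
  shows "l2_norm S f = 0 \<longleftrightarrow> (AE x in lebesgue_on S. f x = 0)"
proof -
  have "l2_norm S f = 0 \<longleftrightarrow> (LINT x|lebesgue_on S. (f x)\<^sup>2) = 0"
    using l2_norm_power2[OF assms] by (metis zero_eq_power2)
  also have "\<dots> \<longleftrightarrow> (AE x in lebesgue_on S. (f x)\<^sup>2 = 0)"
    using assms by (intro integral_nonneg_eq_0_iff_AE) (auto simp: l2_on_def)
  finally show ?thesis by simp
qed

lemma l2_on_AE_cong:
  assumes S: "S \<in> sets lebesgue" and f: "f \<in> l2_on S" and ae: "AE x in lebesgue_on S. f x = g x"
  shows "g \<in> l2_on S"
proof -
  have m: "g \<in> borel_measurable (lebesgue_on S)"
    using complete_measure.borel_measurable_AE_cong[OF complete_measure_lebesgue_on[OF S] _ ae] f by (simp add: l2_on_def)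
  have "integrable (lebesgue_on S) (\<lambda>x. (g x)\<^sup>2)"
  proof (rule integrable_cong_AE_imp)
    show "integrable (lebesgue_on S) (\<lambda>x. (f x)\<^sup>2)" using f by (simp add: l2_on_def)
    show "AE x in lebesgue_on S. (f x)\<^sup>2 = (g x)\<^sup>2" using ae by eventually_elim simp
  qed (use m in measurable)
  then show ?thesis using m by (simp add: l2_on_def)
qed

lemma l2_on_cong: assumes "\<And>x. x \<in> S \<Longrightarrow> f x = g x" shows "f \<in> l2_on S \<longleftrightarrow> g \<in> l2_on S"
proof -
  have "f \<in> borel_measurable (lebesgue_on S) \<longleftrightarrow> g \<in> borel_measurable (lebesgue_on S)"
    by (rule measurable_cong) (simp add: assms)
  moreover have "integrable (lebesgue_on S) (\<lambda>x. (f x)\<^sup>2) \<longleftrightarrow> integrable (lebesgue_on S) (\<lambda>x. (g x)\<^sup>2)"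
    by (rule Bochner_Integration.integrable_cong[OF refl]) (simp add: assms)
  ultimately show ?thesis by (simp add: l2_on_def)
qed

lemma l2_inner_cong: assumes "\<And>x. x \<in> S \<Longrightarrow> f x * g x = f' x * g' x" shows "l2_inner S f g = l2_inner S f' g'"
  unfolding l2_inner_def by (rule Bochner_Integration.integral_cong) (simp_all add: assms)

lemma l2_norm_cong: assumes "\<And>x. x \<in> S \<Longrightarrow> f x = g x" shows "l2_norm S f = l2_norm S g"
  unfolding l2_norm_def by (simp add: l2_inner_cong[of S f f g g] assms)

text \<open>Riesz-Fischer. A rapidly Cauchy subsequence converges almost everywhere, and Fatou along
  it bounds the distance of every member of the full sequence to the limit.\<close>

lemma l2_complete:
  fixes f :: "nat \<Rightarrow> 'a::euclidean_space \<Rightarrow> real"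
  assumes S: "S \<in> sets lebesgue" and f: "\<And>k. f k \<in> l2_on S"
    and cauchy: "\<And>e. e > 0 \<Longrightarrow> \<exists>N. \<forall>m\<ge>N. \<forall>n\<ge>N. l2_norm S (\<lambda>x. f m x - f n x) < e"
  obtains g where "g \<in> l2_on S" "(\<lambda>k. l2_norm S (\<lambda>x. f k x - g x)) \<longlonglongrightarrow> 0"
proof -
  let ?M = "lebesgue_on S"
  note d = L2.diff_elts[of _ S, unfolded L2_sel]
  note [measurable] = f[unfolded l2_on_def, simplified, THEN conjunct1]
  have "\<exists>N. \<forall>m\<ge>N. \<forall>n\<ge>N. l2_norm S (\<lambda>x. f m x - f n x) < (1/2)^k" for k by (rule cauchy) simp
  then obtain N where N: "\<And>k m n. m \<ge> N k \<Longrightarrow> n \<ge> N k \<Longrightarrow> l2_norm S (\<lambda>x. f m x - f n x) < (1/2)^k" by metis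
  \<comment> \<open>The maximum makes the subsequence strictly increasing and keeps
    \<open>r k\<close> beyond the threshold \<open>N k\<close>.\<close>
  define r where "r = rec_nat (N 0) (\<lambda>k p. max (Suc p) (N (Suc k)))"
  have r_Suc: "r (Suc k) = max (Suc (r k)) (N (Suc k))" for k by (simp add: r_def)
  have rN: "r k \<ge> N k" for k by (cases k) (simp_all add: r_def)
  have "r k < r (Suc k)" for k by (simp add: r_Suc)
  then have smono: "strict_mono r" by (rule strict_monoI_Suc)
  then have r_mono: "r k \<le> r (Suc k)" for k by (simp add: strict_mono_less_eq)
  define g where "g k x = f (r (Suc k)) x - f (r k) x" for k x
  \<comment> \<open>The weights \<open>2^k\<close> force \<open>g k x\<close> to decay geometrically wherever the weighted sum of squares is finite.\<close>
  have g2: "(\<integral>\<^sup>+x. ennreal (2^k * (g k x)\<^sup>2) \<partial>?M) \<le> ennreal ((1/2)^k)" for k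
  proof -
    have gl: "g k \<in> l2_on S" unfolding g_def[abs_def] by (intro d f)
    have "l2_norm S (g k) \<le> (1/2)^k" unfolding g_def[abs_def] using N[of k "r (Suc k)" "r k"] rN[of k] r_mono[of k] by simp
    then have "(l2_norm S (g k))\<^sup>2 \<le> ((1/2)^k)\<^sup>2"
      using L2.nrm_nonneg[of "g k" S] gl by (intro power_mono) auto
    then have le: "2^k * (LINT x|?M. (g k x)\<^sup>2) \<le> 2^k * ((1/2)^k)\<^sup>2"
      unfolding l2_norm_power2[OF gl] by (intro mult_left_mono) auto
    have i: "integrable ?M (\<lambda>x. 2^k * (g k x)\<^sup>2)" using gl by (auto simp: l2_on_def)
    have "(\<integral>\<^sup>+x. ennreal (2^k * (g k x)\<^sup>2) \<partial>?M) = ennreal (LINT x|?M. 2^k * (g k x)\<^sup>2)"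
      by (rule nn_integral_eq_integral[OF i]) simp
    also have "\<dots> \<le> ennreal (2^k * ((1/2)^k)\<^sup>2)" using le by (intro ennreal_leI) simp
    also have "(2::real)^k * ((1/2)^k)\<^sup>2 = (1/2)^k" by (simp add: power2_eq_square power_divide)
    finally show ?thesis .
  qed
  have gm [measurable]: "g k \<in> borel_measurable ?M" for k unfolding g_def[abs_def] by measurable
  have "(\<integral>\<^sup>+x. (\<Sum>k. ennreal (2^k * (g k x)\<^sup>2)) \<partial>?M) = (\<Sum>k. \<integral>\<^sup>+x. ennreal (2^k * (g k x)\<^sup>2) \<partial>?M)"
    by (rule nn_integral_suminf) measurable
  also have "\<dots> \<le> (\<Sum>k. ennreal ((1/2)^k))" by (intro suminf_le g2) auto
  also have "\<dots> = ennreal (\<Sum>k. (1/2)^k)" by (intro suminf_ennreal2) (auto simp: summable_geometric)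
  also have "\<dots> < \<infinity>" by simp
  finally have "(\<integral>\<^sup>+x. (\<Sum>k. ennreal (2^k * (g k x)\<^sup>2)) \<partial>?M) \<noteq> \<infinity>" by simp
  then have "AE x in ?M. (\<Sum>k. ennreal (2^k * (g k x)\<^sup>2)) \<noteq> \<infinity>" by (intro nn_integral_noteq_infinite) measurable
  then have conv: "AE x in ?M. convergent (\<lambda>k. f (r k) x)"
  proof eventually_elim
    case (elim x)
    have "summable (\<lambda>k. 2^k * (g k x)\<^sup>2)" using elim by (intro summable_suminf_not_top) auto
    then have "(\<lambda>k. 2^k * (g k x)\<^sup>2) \<longlonglongrightarrow> 0" by (rule summable_LIMSEQ_zero)
    then have "Bseq (\<lambda>k. 2^k * (g k x)\<^sup>2)" by (intro convergent_imp_Bseq convergentI)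
    then obtain C where C: "\<And>k. norm (2^k * (g k x)\<^sup>2) \<le> C" unfolding Bseq_def by blast
    \<comment> \<open>From 2^k g_k^2 at most C, the increments are dominated by a geometric series
      of ratio 1/sqrt 2.\<close>
    have "summable (\<lambda>k. sqrt C * (sqrt (1/2))^k)"
      by (intro summable_mult summable_geometric) (simp add: real_sqrt_less_iff[of "1/2" 1, simplified])
    then have "summable (\<lambda>k. g k x)"
    proof (rule summable_comparison_test'[where N=0])
      fix k
      have "(g k x)\<^sup>2 \<le> C * (1/2)^k" using C[of k] by (simp add: power_divide field_simps)
      then have "sqrt ((g k x)\<^sup>2) \<le> sqrt (C * (1/2)^k)" by (rule real_sqrt_le_mono)
      moreover have "sqrt (C * (1/2)^k) = sqrt C * (sqrt (1/2))^k" by (simp only: real_sqrt_mult real_sqrt_power)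
      ultimately show "norm (g k x) \<le> sqrt C * (sqrt (1/2))^k" by (simp only: real_sqrt_abs real_norm_def)
    qed
    then have "convergent (\<lambda>n. \<Sum>k<n. g k x)" by (simp add: summable_iff_convergent)
    moreover have "(\<Sum>k<n. g k x) = f (r n) x - f (r 0) x" for n
      unfolding g_def by (rule sum_lessThan_telescope)
    ultimately have "convergent (\<lambda>n. (f (r n) x - f (r 0) x) + f (r 0) x)"
      by (intro convergent_add convergent_const) simp
    then show ?case by simp
  qed
  define h where "h x = lim (\<lambda>k. f (r k) x)" for x
  have hm [measurable]: "h \<in> borel_measurable ?M" unfolding h_def[abs_def] by measurable
  have hlim: "AE x in ?M. (\<lambda>k. f (r k) x) \<longlonglongrightarrow> h x"
    using conv by eventually_elim (simp add: h_def convergent_LIMSEQ_iff)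
  \<comment> \<open>The index n is arbitrary; only the second index runs through the
    subsequence.\<close>
  have fatou: "(\<integral>\<^sup>+x. ennreal ((f n x - h x)\<^sup>2) \<partial>?M) \<le> ennreal (e\<^sup>2)"
    if e: "e > 0" and n: "\<And>m. m \<ge> K \<Longrightarrow> l2_norm S (\<lambda>x. f n x - f m x) \<le> e" for n e K
  proof -
    have "(\<integral>\<^sup>+x. ennreal ((f n x - h x)\<^sup>2) \<partial>?M) = (\<integral>\<^sup>+x. liminf (\<lambda>k. ennreal ((f n x - f (r k) x)\<^sup>2)) \<partial>?M)"
    proof (rule nn_integral_cong_AE)
      show "AE x in ?M. ennreal ((f n x - h x)\<^sup>2) = liminf (\<lambda>k. ennreal ((f n x - f (r k) x)\<^sup>2))"
        using hlim
      proof eventually_elim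
        case (elim x)
        then have "(\<lambda>k. ennreal ((f n x - f (r k) x)\<^sup>2)) \<longlonglongrightarrow> ennreal ((f n x - h x)\<^sup>2)"
          by (intro tendsto_intros)
        then show ?case by (intro lim_imp_Liminf[symmetric]) simp_all
      qed
    qed
    also have "\<dots> \<le> liminf (\<lambda>k. \<integral>\<^sup>+x. ennreal ((f n x - f (r k) x)\<^sup>2) \<partial>?M)"
      by (rule nn_integral_liminf) measurable
    also have "\<dots> \<le> liminf (\<lambda>k. ennreal (e\<^sup>2))"
    proof (rule Liminf_mono)
      have "\<forall>\<^sub>F k in sequentially. r k \<ge> K"
        using smono by (meson eventually_sequentiallyI order_trans seq_suble)
      then show "\<forall>\<^sub>F k in sequentially. (\<integral>\<^sup>+x. ennreal ((f n x - f (r k) x)\<^sup>2) \<partial>?M) \<le> ennreal (e\<^sup>2)"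
      proof eventually_elim
        case (elim k)
        let ?d = "\<lambda>x. f n x - f (r k) x"
        have dl: "?d \<in> l2_on S" by (intro d f)
        have "(\<integral>\<^sup>+x. ennreal ((?d x)\<^sup>2) \<partial>?M) = ennreal ((l2_norm S ?d)\<^sup>2)"
          unfolding l2_norm_power2[OF dl] by (rule nn_integral_eq_integral) (use dl in \<open>auto simp: l2_on_def\<close>)
        also have "\<dots> \<le> ennreal (e\<^sup>2)"
          using n[OF elim] L2.nrm_nonneg[of ?d S] dl by (intro ennreal_leI power_mono) auto
        finally show ?case .
      qed
    qed
    finally show ?thesis by (simp add: Liminf_const)
  qed
  have diff_l2: "(\<lambda>x. f n x - h x) \<in> l2_on S \<and> l2_norm S (\<lambda>x. f n x - h x) \<le> e"
    if e: "e > 0" and n: "\<And>m. m \<ge> K \<Longrightarrow> l2_norm S (\<lambda>x. f n x - f m x) \<le> e" for n e K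
  proof -
    note ft = fatou[of e K n, OF that]
    have "integrable ?M (\<lambda>x. (f n x - h x)\<^sup>2)"
      using ft by (intro integrableI_bounded) (auto simp: le_less_trans)
    then have l: "(\<lambda>x. f n x - h x) \<in> l2_on S" by (simp add: l2_on_def)
    have "ennreal ((l2_norm S (\<lambda>x. f n x - h x))\<^sup>2) \<le> ennreal (e\<^sup>2)"
      using ft l unfolding l2_norm_power2[OF l] by (subst nn_integral_eq_integral[symmetric]) (auto simp: l2_on_def)
    then have "(l2_norm S (\<lambda>x. f n x - h x))\<^sup>2 \<le> e\<^sup>2" by simp
    then show ?thesis using l e by (auto intro: power2_le_imp_le)
  qed
  obtain K where K: "\<And>m n. m \<ge> K \<Longrightarrow> n \<ge> K \<Longrightarrow> l2_norm S (\<lambda>x. f m x - f n x) < 1" using cauchy[of 1] by auto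
  have "(\<lambda>x. f K x - h x) \<in> l2_on S" using diff_l2[of 1 K K] K[of K] by (simp add: less_imp_le)
  \<comment> \<open>Square integrability of the limit is recovered from that of one member and of
    its difference to the limit.\<close>
  then have "(\<lambda>x. f K x - (f K x - h x)) \<in> l2_on S" by (rule d[OF f])
  moreover have "(\<lambda>x. f K x - (f K x - h x)) = h" by (simp add: fun_eq_iff)
  ultimately have hl: "h \<in> l2_on S" by metis
  show ?thesis
  proof (rule that[OF hl], rule LIMSEQ_I)
    fix e :: real assume e: "e > 0"
    obtain L where L: "\<And>m n. m \<ge> L \<Longrightarrow> n \<ge> L \<Longrightarrow> l2_norm S (\<lambda>x. f m x - f n x) < e / 2" using cauchy[of "e/2"] e by auto
    show "\<exists>no. \<forall>n\<ge>no. norm (l2_norm S (\<lambda>x. f n x - h x) - 0) < e"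
    proof (intro exI[of _ L] allI impI)
      fix n assume n: "n \<ge> L"
      have "l2_norm S (\<lambda>x. f n x - h x) \<le> e / 2" using diff_l2[of "e/2" L n] L[OF n] e by (simp add: less_imp_le)
      then show "norm (l2_norm S (\<lambda>x. f n x - h x) - 0) < e"
        using e L2.nrm_nonneg[of "\<lambda>x. f n x - h x" S] d[OF f hl] by simp
    qed
  qed
qed

subsection \<open>Weak gradients\<close>

lemma test_functions_l2:
  assumes S: "S \<in> sets lebesgue" and \<psi>: "\<psi> \<in> test_functions U"
  shows "\<psi> \<in> l2_on S"
proof -
  let ?K = "closure {x. \<psi> x \<noteq> 0}"
  have "Ck 0 \<psi>" using \<psi> by (simp only: test_functions_def mem_Collect_eq)
  then have cont: "continuous_on UNIV \<psi>" by simp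
  have K: "compact ?K" using \<psi> by (simp add: test_functions_def)
  have \<psi>K: "indicator ?K x *\<^sub>R (\<psi> x)\<^sup>2 = (\<psi> x)\<^sup>2" for x
    using closure_subset[of "{x. \<psi> x \<noteq> 0}"] by (auto simp: indicator_def)
  have "continuous_on ?K (\<lambda>x. (\<psi> x)\<^sup>2)" using cont by (intro continuous_intros) (rule continuous_on_subset, auto)
  from borel_integrable_compact[OF K this] have "integrable lborel (\<lambda>x. (\<psi> x)\<^sup>2)" unfolding \<psi>K .
  then have i: "integrable lebesgue (\<lambda>x. (\<psi> x)\<^sup>2)" by (subst integrable_completion) auto
  have m: "\<psi> \<in> borel_measurable lebesgue"
    using cont by (intro measurable_completion) (simp add: borel_measurable_continuous_onI)
  show ?thesis unfolding l2_on_zero_extension[OF S]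
    using borel_measurable_indicator_times[OF S m] integrable_mult_indicator[OF S i] by simp
qed

lemma test_functions_deriv:
  assumes \<psi>: "\<psi> \<in> test_functions S" and b: "b \<in> Basis"
  shows "(\<lambda>x. frechet_derivative \<psi> (at x) b) \<in> test_functions S"
proof -
  have ck: "Ck k \<psi>" for k using \<psi> by (auto simp: test_functions_def)
  let ?K = "closure {x. \<psi> x \<noteq> 0}"
  have "frechet_derivative \<psi> (at x) b = 0" if "x \<notin> ?K" for x
  proof -
    have "((\<lambda>x. 0) has_derivative (\<lambda>h. 0)) (at x)" by simp
    then have "(\<psi> has_derivative (\<lambda>h. 0)) (at x)"
      by (rule has_derivative_transform_within_open[of _ _ _ _ "- ?K"])
        (use that closure_subset[of "{x. \<psi> x \<noteq> 0}"] in auto)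
    then show ?thesis using frechet_derivative_at[of \<psi> "\<lambda>h. 0" x] by metis
  qed
  then have "{x. frechet_derivative \<psi> (at x) b \<noteq> 0} \<subseteq> ?K" by blast
  then have sub: "closure {x. frechet_derivative \<psi> (at x) b \<noteq> 0} \<subseteq> ?K" by (rule closure_minimal) simp
  moreover have "compact ?K" "?K \<subseteq> S" using \<psi> by (auto simp: test_functions_def)
  ultimately have "compact (closure {x. frechet_derivative \<psi> (at x) b \<noteq> 0})" "closure {x. frechet_derivative \<psi> (at x) b \<noteq> 0} \<subseteq> S"
    using compact_Int_closed[of ?K "closure {x. frechet_derivative \<psi> (at x) b \<noteq> 0}"] by (auto simp: Int_absorb1)
  then show ?thesis using Ck_SucD(2)[OF ck b] by (auto simp: test_functions_def)
qed

lemma weak_gradient_l2: "weak_gradient S u g \<Longrightarrow> b \<in> Basis \<Longrightarrow> (\<lambda>x. g x \<bullet> b) \<in> l2_on S"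
  by (simp add: weak_gradient_def)

lemma weak_gradient_ibp:
  assumes "weak_gradient S u g" "b \<in> Basis" "\<psi> \<in> test_functions S"
  shows "l2_inner S u (\<lambda>x. frechet_derivative \<psi> (at x) b) = - l2_inner S (\<lambda>x. g x \<bullet> b) \<psi>"
  using assms by (simp add: weak_gradient_def l2_inner_def)

lemma weak_gradientI:
  assumes "\<And>b. b \<in> Basis \<Longrightarrow> (\<lambda>x. g x \<bullet> b) \<in> l2_on S"
    and "\<And>b \<psi>. b \<in> Basis \<Longrightarrow> \<psi> \<in> test_functions S \<Longrightarrow>
      l2_inner S u (\<lambda>x. frechet_derivative \<psi> (at x) b) = - l2_inner S (\<lambda>x. g x \<bullet> b) \<psi>"
  shows "weak_gradient S u g"
  using assms by (simp add: weak_gradient_def l2_inner_def)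

text \<open>\<open>grad\<close> is an unspecified choice among the weak gradients. Uniqueness almost
  everywhere allows any explicit candidate to stand for it under an integral, which is how
  \<open>h1_inner_grads\<close> computes norms.\<close>

lemma weak_gradient_unique:
  fixes S :: "'a::euclidean_space set"
  assumes S: "open S" and g: "weak_gradient S u g" and h: "weak_gradient S u h"
  shows "AE x in lebesgue_on S. g x = h x"
proof -
  have "AE x in lebesgue_on S. g x \<bullet> b = h x \<bullet> b" if b: "b \<in> Basis" for b
  proof -
    note l = weak_gradient_l2[OF g b] weak_gradient_l2[OF h b]
    have "AE x in lebesgue_on S. 1 * (g x \<bullet> b) + (-1) * (h x \<bullet> b) = 0"
    proof (rule fundamental_lemma_variations[OF S l2_on_comb[OF l]])
      fix \<psi> :: "'a \<Rightarrow> real" assume \<psi>: "\<psi> \<in> test_functions S"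
      have "\<psi> \<in> l2_on S" using S by (intro test_functions_l2[OF _ \<psi>]) simp
      then have "l2_inner S (\<lambda>x. 1 * (g x \<bullet> b) + (-1) * (h x \<bullet> b)) \<psi> = 0"
        using weak_gradient_ibp[OF g b \<psi>] weak_gradient_ibp[OF h b \<psi>] l2.B_lin[OF l, of \<psi> 1 "-1"] by simp
      then show "(LINT x|lebesgue_on S. (1 * (g x \<bullet> b) + - 1 * (h x \<bullet> b)) * \<psi> x) = 0" by (simp add: l2_inner_def)
    qed
    then show ?thesis by eventually_elim simp
  qed
  then have "AE x in lebesgue_on S. \<forall>b\<in>Basis. g x \<bullet> b = h x \<bullet> b"
    by (intro AE_finite_allI) auto
  then show ?thesis by eventually_elim (rule euclidean_eqI, blast)
qed

lemma weak_gradient_comb: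
  assumes S: "S \<in> sets lebesgue" and u: "u \<in> l2_on S" "v \<in> l2_on S"
    and g: "weak_gradient S u g" and h: "weak_gradient S v h"
  shows "weak_gradient S (\<lambda>x. a * u x + b * v x) (\<lambda>x. a *\<^sub>R g x + b *\<^sub>R h x)"
proof (rule weak_gradientI)
  fix c :: 'a assume c: "c \<in> Basis"
  note l = weak_gradient_l2[OF g c] weak_gradient_l2[OF h c]
  have eq: "(\<lambda>x. (a *\<^sub>R g x + b *\<^sub>R h x) \<bullet> c) = (\<lambda>x. a * (g x \<bullet> c) + b * (h x \<bullet> c))" by (simp add: inner_add_left)
  show "(\<lambda>x. (a *\<^sub>R g x + b *\<^sub>R h x) \<bullet> c) \<in> l2_on S" unfolding eq by (rule l2_on_comb[OF l])
  fix \<psi> assume \<psi>: "\<psi> \<in> test_functions S"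
  show "l2_inner S (\<lambda>x. a * u x + b * v x) (\<lambda>x. frechet_derivative \<psi> (at x) c) =
      - l2_inner S (\<lambda>x. (a *\<^sub>R g x + b *\<^sub>R h x) \<bullet> c) \<psi>"
    unfolding eq l2.B_lin[OF l test_functions_l2[OF S \<psi>]] l2.B_lin[OF u test_functions_l2[OF S test_functions_deriv[OF \<psi> c]]]
    by (simp add: weak_gradient_ibp[OF g c \<psi>] weak_gradient_ibp[OF h c \<psi>])
qed

lemma h1_on_grad: "u \<in> h1_on S \<Longrightarrow> weak_gradient S u (grad S u)"
  unfolding h1_on_def grad_def using someI[of "weak_gradient S u"] by blast

lemma h1_onI: "u \<in> l2_on S \<Longrightarrow> weak_gradient S u g \<Longrightarrow> u \<in> h1_on S"
  by (auto simp: h1_on_def)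

lemma h1_on_l2: "u \<in> h1_on S \<Longrightarrow> u \<in> l2_on S" by (simp add: h1_on_def)

lemma h1_on_comb:
  assumes S: "open S" and u: "u \<in> h1_on S" and v: "v \<in> h1_on S"
  shows "(\<lambda>x. a * u x + b * v x) \<in> h1_on S"
    "AE x in lebesgue_on S. grad S (\<lambda>x. a * u x + b * v x) x = a *\<^sub>R grad S u x + b *\<^sub>R grad S v x"
proof -
  note w = weak_gradient_comb[OF _ h1_on_l2[OF u] h1_on_l2[OF v] h1_on_grad[OF u] h1_on_grad[OF v], of a b]
  show *: "(\<lambda>x. a * u x + b * v x) \<in> h1_on S"
    by (rule h1_onI[OF l2_on_comb[OF h1_on_l2[OF u] h1_on_l2[OF v]] w]) (use S in simp)
  show "AE x in lebesgue_on S. grad S (\<lambda>x. a * u x + b * v x) x = a *\<^sub>R grad S u x + b *\<^sub>R grad S v x"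
    by (rule weak_gradient_unique[OF S h1_on_grad[OF *] w]) (use S in simp)
qed

text \<open>Splitting the gradient into components reduces the Sobolev form to L2 inner products of
  scalar functions, for which linearity and completeness are already available.\<close>

lemma h1_inner_grads:
  fixes S :: "'a::euclidean_space set"
  assumes S: "open S" and u: "u \<in> h1_on S" "weak_gradient S u g" and v: "v \<in> h1_on S" "weak_gradient S v h"
  shows "h1_inner a b S u v = a * l2_inner S u v + b * (\<Sum>c\<in>Basis. l2_inner S (\<lambda>x. g x \<bullet> c) (\<lambda>x. h x \<bullet> c))"
proof -
  have e: "(\<lambda>x. y x \<bullet> c) \<in> borel_measurable (lebesgue_on S)" if "weak_gradient S w y" "c \<in> Basis" for w y c
    using weak_gradient_l2[OF that] by (simp add: l2_on_def)
  have m: "(\<lambda>x. y x \<bullet> z x) \<in> borel_measurable (lebesgue_on S)" if "weak_gradient S w y" "weak_gradient S w' z" for w w' y z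
    unfolding euclidean_inner[of "y _" "z _"] using e[OF that(1)] e[OF that(2)]
    by (intro borel_measurable_sum borel_measurable_times) auto
  have "(LINT x|lebesgue_on S. grad S u x \<bullet> grad S v x) = (LINT x|lebesgue_on S. g x \<bullet> h x)"
  proof (rule integral_cong_AE)
    show "AE x in lebesgue_on S. grad S u x \<bullet> grad S v x = g x \<bullet> h x"
      using weak_gradient_unique[OF S h1_on_grad[OF u(1)] u(2)] weak_gradient_unique[OF S h1_on_grad[OF v(1)] v(2)]
      by eventually_elim simp
  qed (intro m[OF h1_on_grad[OF u(1)] h1_on_grad[OF v(1)]], intro m[OF u(2) v(2)])
  also have "\<dots> = (\<Sum>c\<in>Basis. l2_inner S (\<lambda>x. g x \<bullet> c) (\<lambda>x. h x \<bullet> c))"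
    unfolding euclidean_inner[of "g _" "h _"] l2_inner_def
    by (intro Bochner_Integration.integral_sum l2_on_mult_integrable weak_gradient_l2[OF u(2)] weak_gradient_l2[OF v(2)])
  finally show ?thesis by (simp add: h1_inner_def)
qed

lemmas h1_inner_sum = h1_inner_grads[OF _ _ h1_on_grad _ h1_on_grad]

lemma l2_inner_AE_cong:
  assumes "f \<in> l2_on S" "f' \<in> l2_on S" "g \<in> l2_on S" "AE x in lebesgue_on S. f x = f' x"
  shows "l2_inner S f g = l2_inner S f' g"
  unfolding l2_inner_def
proof (rule integral_cong_AE)
  show "AE x in lebesgue_on S. f x * g x = f' x * g x" using assms(4) by eventually_elim simp
qed (use assms in \<open>auto simp: l2_on_def intro!: borel_measurable_times\<close>)

section \<open>The Sobolev seminorm and its completeness\<close>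

lemma semi_inner_h1:
  fixes S :: "'a::euclidean_space set"
  assumes S: "open S" and ab: "0 \<le> a" "0 \<le> b"
  shows "semi_inner (h1_on S) (h1_inner a b S)"
proof
  have "weak_gradient S (\<lambda>x. 0) (\<lambda>x. 0)"
    by (rule weak_gradientI) (simp_all add: l2.V_zero l2_inner_def)
  then show "(\<lambda>x. 0) \<in> h1_on S" by (rule h1_onI[OF l2.V_zero])
  show "(\<lambda>x. p * u x + q * v x) \<in> h1_on S" if "u \<in> h1_on S" "v \<in> h1_on S" for u v p q
    by (rule h1_on_comb(1)[OF S that])
  show "h1_inner a b S u v = h1_inner a b S v u" for u v
    by (simp add: h1_inner_def l2_inner_def inner_commute mult.commute)
  show "0 \<le> h1_inner a b S u u" for u
    using ab by (simp add: h1_inner_def l2_inner_def)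
  fix u v w p q assume u: "u \<in> h1_on S" and v: "v \<in> h1_on S" and w: "w \<in> h1_on S"
  have SM: "S \<in> sets lebesgue" using S by simp
  note uv = h1_on_l2[OF u] h1_on_l2[OF v]
  note wg = weak_gradient_comb[OF SM uv h1_on_grad[OF u] h1_on_grad[OF v], of p q]
  have "l2_inner S (\<lambda>x. (p *\<^sub>R grad S u x + q *\<^sub>R grad S v x) \<bullet> c) (\<lambda>x. grad S w x \<bullet> c) =
     p * l2_inner S (\<lambda>x. grad S u x \<bullet> c) (\<lambda>x. grad S w x \<bullet> c) + q * l2_inner S (\<lambda>x. grad S v x \<bullet> c) (\<lambda>x. grad S w x \<bullet> c)"
    if c: "c \<in> Basis" for c
    using l2.B_lin[OF weak_gradient_l2[OF h1_on_grad[OF u] c] weak_gradient_l2[OF h1_on_grad[OF v] c] weak_gradient_l2[OF h1_on_grad[OF w] c], of p q]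
    by (simp add: inner_add_left)
  then show "h1_inner a b S (\<lambda>x. p * u x + q * v x) w = p * h1_inner a b S u w + q * h1_inner a b S v w"
    unfolding h1_inner_grads[OF S h1_on_comb(1)[OF S u v] wg w h1_on_grad[OF w]] h1_inner_sum[OF S u u w w] h1_inner_sum[OF S v v w w]
      l2.B_lin[OF uv h1_on_l2[OF w]]
    by (simp add: sum.distrib sum_distrib_left algebra_simps)
qed

definition H1 :: "real \<Rightarrow> real \<Rightarrow> 'a::euclidean_space set \<Rightarrow> 'a fspace" where
  "H1 a b S = FSpace (h1_on S) (h1_norm a b S)"

lemma H1_sel [simp]: "elts (H1 a b S) = h1_on S" "nrm (H1 a b S) = h1_norm a b S"
  by (simp_all add: H1_def)

lemma seminormed_H1: "open S \<Longrightarrow> 0 \<le> a \<Longrightarrow> 0 \<le> b \<Longrightarrow> seminormed (H1 a b S)"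
  using semi_inner.seminormed_sqrt[OF semi_inner_h1, of S a b] by (simp add: H1_def h1_norm_def[abs_def])

lemma h1_norm_power2:
  assumes S: "open S" and u: "u \<in> h1_on S" "weak_gradient S u g" and ab: "0 \<le> a" "0 \<le> b"
  shows "(h1_norm a b S u)\<^sup>2 = a * (l2_norm S u)\<^sup>2 + b * (\<Sum>c\<in>Basis. (l2_norm S (\<lambda>x. g x \<bullet> c))\<^sup>2)"
proof -
  have n: "l2_inner S f f = (l2_norm S f)\<^sup>2" if "f \<in> l2_on S" for f :: "'a \<Rightarrow> real"
    using l2.B_pos[OF that] by (simp add: l2_norm_def)
  have "(h1_norm a b S u)\<^sup>2 = h1_inner a b S u u"
    using semi_inner.B_pos[OF semi_inner_h1[OF S ab] u(1)] by (simp add: h1_norm_def)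
  then show ?thesis
    unfolding h1_inner_grads[OF S u u] n[OF h1_on_l2[OF u(1)]] using n weak_gradient_l2[OF u(2)] by simp
qed

lemma weak_gradient_AE_cong:
  assumes S: "S \<in> sets lebesgue" and u: "u \<in> l2_on S" and g: "weak_gradient S u g"
    and uv: "AE x in lebesgue_on S. u x = v x"
  shows "weak_gradient S v g"
proof (rule weak_gradientI[OF weak_gradient_l2[OF g]])
  fix b :: 'a and \<psi> assume b: "b \<in> Basis" and \<psi>: "\<psi> \<in> test_functions S"
  note l = l2_on_AE_cong[OF S u uv] and t = test_functions_l2[OF S test_functions_deriv[OF \<psi> b]]
  show "l2_inner S v (\<lambda>x. frechet_derivative \<psi> (at x) b) = - l2_inner S (\<lambda>x. g x \<bullet> b) \<psi>"
    using weak_gradient_ibp[OF g b \<psi>] l2_inner_AE_cong[OF u l t uv] by simp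
qed

lemma h1_on_AE_cong:
  assumes S: "open S" and u: "u \<in> h1_on S" and uv: "AE x in lebesgue_on S. u x = v x"
  shows "v \<in> h1_on S" "0 \<le> a \<Longrightarrow> 0 \<le> b \<Longrightarrow> h1_norm a b S v = h1_norm a b S u"
    "0 \<le> a \<Longrightarrow> 0 \<le> b \<Longrightarrow> h1_norm a b S (\<lambda>x. u x - v x) = 0"
proof -
  have SM: "S \<in> sets lebesgue" using S by simp
  note l = l2_on_AE_cong[OF SM h1_on_l2[OF u] uv]
  note g = weak_gradient_AE_cong[OF SM h1_on_l2[OF u] h1_on_grad[OF u] uv]
  show v: "v \<in> h1_on S" by (rule h1_onI[OF l g])
  assume ab: "0 \<le> a" "0 \<le> b"
  interpret seminormed "H1 a b S" by (rule seminormed_H1[OF S ab])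
  have d: "(\<lambda>x. u x - v x) \<in> h1_on S" using diff_elts[of u v] u v by simp
  \<comment> \<open>One and the same field is a weak gradient of u and of v, so the difference has
    the zero field.\<close>
  have w: "weak_gradient S (\<lambda>x. u x - v x) (\<lambda>x. 0)"
    using weak_gradient_comb[OF SM h1_on_l2[OF u] l h1_on_grad[OF u] g, of 1 "-1"] by simp
  have "l2_norm S (\<lambda>x. u x - v x) = 0"
    unfolding l2_norm_eq_0[OF h1_on_l2[OF d]] using uv by eventually_elim simp
  then have "(h1_norm a b S (\<lambda>x. u x - v x))\<^sup>2 = 0"
    unfolding h1_norm_power2[OF S d w ab] by (simp add: L2.nrm_zero[unfolded L2_sel])
  then show z: "h1_norm a b S (\<lambda>x. u x - v x) = 0" by simp
  show "h1_norm a b S v = h1_norm a b S u" using nrm_cong_zero[of u v] u v z by simp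
qed

lemma l2_norm_le_h1:
  assumes S: "open S" and u: "u \<in> h1_on S" "weak_gradient S u g" 
  shows "l2_norm S u \<le> h1_norm 1 1 S u" "c \<in> Basis \<Longrightarrow> l2_norm S (\<lambda>x. g x \<bullet> c) \<le> h1_norm 1 1 S u"
proof -
  interpret seminormed "H1 1 1 S" by (rule seminormed_H1[OF S]) auto
  note p = h1_norm_power2[OF S u zero_le_one zero_le_one] and nn = nrm_nonneg[of u, simplified, OF u(1)]
  have "(l2_norm S u)\<^sup>2 \<le> (h1_norm 1 1 S u)\<^sup>2" unfolding p by (simp add: sum_nonneg)
  then show "l2_norm S u \<le> h1_norm 1 1 S u" using nn by (rule power2_le_imp_le)
  assume c: "c \<in> Basis"
  have "(l2_norm S (\<lambda>x. g x \<bullet> c))\<^sup>2 \<le> (\<Sum>c\<in>Basis. (l2_norm S (\<lambda>x. g x \<bullet> c))\<^sup>2)"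
    using c by (intro member_le_sum) auto
  then have "(l2_norm S (\<lambda>x. g x \<bullet> c))\<^sup>2 \<le> (h1_norm 1 1 S u)\<^sup>2" unfolding p by (simp add: add_increasing)
  then show "l2_norm S (\<lambda>x. g x \<bullet> c) \<le> h1_norm 1 1 S u" using nn by (rule power2_le_imp_le)
qed

lemma l2_inner_tendsto:
  assumes "\<And>k. f k \<in> l2_on S" "g \<in> l2_on S" "h \<in> l2_on S" "(\<lambda>k. l2_norm S (\<lambda>x. f k x - g x)) \<longlonglongrightarrow> 0"
  shows "(\<lambda>k. l2_inner S (f k) h) \<longlonglongrightarrow> l2_inner S g h"
proof -
  have d: "(\<lambda>x. f k x - g x) \<in> l2_on S" for k using L2.diff_elts[of "f k" S g] assms by simp
  have "(\<lambda>k. l2_inner S (f k) h - l2_inner S g h) \<longlonglongrightarrow> 0"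
  proof (rule Lim_null_comparison[OF always_eventually])
    show "(\<lambda>k. l2_norm S (\<lambda>x. f k x - g x) * l2_norm S h) \<longlonglongrightarrow> 0"
      using tendsto_mult_right[OF assms(4), of "l2_norm S h"] by simp
    show "\<forall>k. norm (l2_inner S (f k) h - l2_inner S g h) \<le> l2_norm S (\<lambda>x. f k x - g x) * l2_norm S h"
      using l2.cauchy_schwarz[OF d assms(3)] l2.B_lin[OF assms(1,2,3), where a=1 and b="-1"] by (simp add: l2_norm_def)
  qed
  then show ?thesis by (simp add: LIM_zero_iff)
qed

text \<open>The weak gradient is a closed operator: both sides of the integration by parts identity,
  for a fixed test function, are continuous under L2 convergence. The limits of the gradient
  components therefore form a weak gradient of the limit.\<close>

lemma h1_complete:
  fixes f :: "nat \<Rightarrow> 'a::euclidean_space \<Rightarrow> real"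
  assumes S: "open S" and f: "\<And>k. f k \<in> h1_on S"
    and cauchy: "\<And>e. e > 0 \<Longrightarrow> \<exists>N. \<forall>m\<ge>N. \<forall>n\<ge>N. h1_norm 1 1 S (\<lambda>x. f m x - f n x) < e"
  obtains u where "u \<in> h1_on S" "(\<lambda>k. h1_norm 1 1 S (\<lambda>x. f k x - u x)) \<longlonglongrightarrow> 0"
proof -
  have SM: "S \<in> sets lebesgue" using S by simp
  interpret seminormed "H1 1 1 S" by (rule seminormed_H1[OF S]) auto
  note fg = h1_on_grad[OF f] and fl = h1_on_l2[OF f]
  have d: "(\<lambda>x. f m x - f n x) \<in> h1_on S" for m n using diff_elts[of "f m" "f n"] f by simp
  have dg: "weak_gradient S (\<lambda>x. f m x - f n x) (\<lambda>x. grad S (f m) x - grad S (f n) x)" for m n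
    using weak_gradient_comb[OF SM fl fl fg fg, where a=1 and b="-1"] by simp
  obtain u where u: "u \<in> l2_on S" "(\<lambda>k. l2_norm S (\<lambda>x. f k x - u x)) \<longlonglongrightarrow> 0"
  proof (rule l2_complete[OF SM fl])
    show "\<exists>N. \<forall>m\<ge>N. \<forall>n\<ge>N. l2_norm S (\<lambda>x. f m x - f n x) < e" if "e > 0" for e
      using cauchy[OF that] l2_norm_le_h1(1)[OF S d dg] by (meson le_less_trans)
  qed
  have "\<exists>g. g \<in> l2_on S \<and> (\<lambda>k. l2_norm S (\<lambda>x. grad S (f k) x \<bullet> c - g x)) \<longlonglongrightarrow> 0" if c: "c \<in> Basis" for c
  proof (rule l2_complete[OF SM weak_gradient_l2[OF fg c]])
    show "\<exists>N. \<forall>m\<ge>N. \<forall>n\<ge>N. l2_norm S (\<lambda>x. grad S (f m) x \<bullet> c - grad S (f n) x \<bullet> c) < e" if "e > 0" for e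
      using cauchy[OF that] l2_norm_le_h1(2)[OF S d dg c] unfolding inner_diff_left by (meson le_less_trans)
  qed blast
  then have "\<exists>g. \<forall>c\<in>Basis. g c \<in> l2_on S \<and> (\<lambda>k. l2_norm S (\<lambda>x. grad S (f k) x \<bullet> c - g c x)) \<longlonglongrightarrow> 0"
    by (intro bchoice ballI)
  then obtain g where g: "\<And>c. c \<in> Basis \<Longrightarrow> g c \<in> l2_on S"
    "\<And>c. c \<in> Basis \<Longrightarrow> (\<lambda>k. l2_norm S (\<lambda>x. grad S (f k) x \<bullet> c - g c x)) \<longlonglongrightarrow> 0" by blast
  define G where "G x = (\<Sum>c\<in>Basis. g c x *\<^sub>R c)" for x
  have Gc: "(\<lambda>x. G x \<bullet> c) = g c" if "c \<in> Basis" for c using that by (simp add: G_def)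
  have wG: "weak_gradient S u G"
  proof (rule weak_gradientI)
    fix c :: 'a assume c: "c \<in> Basis"
    show "(\<lambda>x. G x \<bullet> c) \<in> l2_on S" unfolding Gc[OF c] by (rule g(1)[OF c])
    fix \<psi> :: "'a \<Rightarrow> real" assume \<psi>: "\<psi> \<in> test_functions S"
    note t = test_functions_l2[OF SM \<psi>] and dt = test_functions_l2[OF SM test_functions_deriv[OF \<psi> c]]
    have "(\<lambda>k. l2_inner S (f k) (\<lambda>x. frechet_derivative \<psi> (at x) c)) \<longlonglongrightarrow> l2_inner S u (\<lambda>x. frechet_derivative \<psi> (at x) c)"
      by (rule l2_inner_tendsto[OF fl u(1) dt u(2)])
    moreover have "(\<lambda>k. - l2_inner S (\<lambda>x. grad S (f k) x \<bullet> c) \<psi>) \<longlonglongrightarrow> - l2_inner S (g c) \<psi>"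
      by (intro tendsto_minus l2_inner_tendsto[OF weak_gradient_l2[OF fg c] g(1)[OF c] t g(2)[OF c]])
    ultimately show "l2_inner S u (\<lambda>x. frechet_derivative \<psi> (at x) c) = - l2_inner S (\<lambda>x. G x \<bullet> c) \<psi>"
      unfolding weak_gradient_ibp[OF fg c \<psi>] Gc[OF c] by (rule LIMSEQ_unique)
  qed
  have uh: "u \<in> h1_on S" by (rule h1_onI[OF u(1) wG])
  have dh: "(\<lambda>x. f k x - u x) \<in> h1_on S" for k using diff_elts[of "f k" u] f uh by simp
  have dw: "weak_gradient S (\<lambda>x. f k x - u x) (\<lambda>x. grad S (f k) x - G x)" for k
    using weak_gradient_comb[OF SM fl u(1) fg wG, where a=1 and b="-1"] by simp
  have "(\<lambda>k. 1 * (l2_norm S (\<lambda>x. f k x - u x))\<^sup>2 + 1 * (\<Sum>c\<in>Basis. (l2_norm S (\<lambda>x. grad S (f k) x \<bullet> c - g c x))\<^sup>2))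
     \<longlonglongrightarrow> 1 * 0\<^sup>2 + 1 * (\<Sum>c\<in>(Basis::'a set). 0\<^sup>2)"
    by (intro tendsto_intros u g)
  moreover have "1 * (l2_norm S (\<lambda>x. f k x - u x))\<^sup>2 + 1 * (\<Sum>c\<in>Basis. (l2_norm S (\<lambda>x. grad S (f k) x \<bullet> c - g c x))\<^sup>2)
     = (h1_norm 1 1 S (\<lambda>x. f k x - u x))\<^sup>2" for k
  proof -
    have "(\<lambda>x. (grad S (f k) x - G x) \<bullet> c) = (\<lambda>x. grad S (f k) x \<bullet> c - g c x)" if "c \<in> Basis" for c
      using Gc[OF that] by (simp add: inner_diff_left fun_eq_iff)
    then show ?thesis unfolding h1_norm_power2[OF S dh dw zero_le_one zero_le_one] by simp
  qed
  ultimately have "(\<lambda>k. (h1_norm 1 1 S (\<lambda>x. f k x - u x))\<^sup>2) \<longlonglongrightarrow> 0" by simp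
  from tendsto_real_sqrt[OF this] have "(\<lambda>k. h1_norm 1 1 S (\<lambda>x. f k x - u x)) \<longlonglongrightarrow> 0"
    using nrm_nonneg[OF diff_elts, simplified, OF f uh] by simp
  then show ?thesis by (rule that[OF uh])
qed

subsection \<open>Flat traces\<close>

text \<open>\<open>slice_closure\<close> makes the restriction of a function continuous on
  \<open>closure S\<close> meaningful on the piece, and boundedness of S makes that restriction
  square integrable.\<close>

locale flat_piece =
  fixes S :: "('a::euclidean_space \<times> real) set" and G :: "('a \<times> real) set" and c :: real
  assumes S_open: "open S" and S_bounded: "bounded S"
    and slice: "{x. (x, c) \<in> G} \<in> sets lebesgue"
    and slice_closure: "\<And>x. (x, c) \<in> G \<Longrightarrow> (x, c) \<in> closure S"
begin

sublocale h1: seminormed "H1 1 1 S" by (rule seminormed_H1[OF S_open]) auto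

lemma slice_bounded: "bounded {x. (x, c) \<in> G}"
proof (rule bounded_subset)
  show "bounded (fst ` closure S)" using S_bounded by (intro bounded_fst) (rule bounded_closure)
  show "{x. (x, c) \<in> G} \<subseteq> fst ` closure S" using slice_closure by force
qed

lemma slice_l2: assumes u: "continuous_on (closure S) u" shows "(\<lambda>x. u (x, c)) \<in> l2_on {x. (x, c) \<in> G}"
proof -
  let ?P = "{x. (x, c) \<in> G}"
  have cont: "continuous_on ?P (\<lambda>x. u (x, c))"
    by (rule continuous_on_compose2[OF u]) (auto intro!: continuous_intros slice_closure)
  have m: "(\<lambda>x. u (x, c)) \<in> borel_measurable (lebesgue_on ?P)"
    by (rule continuous_imp_measurable_on_sets_lebesgue[OF cont slice])
  have "compact (u ` closure S)" using u S_bounded by (intro compact_continuous_image) simp_all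
  then obtain B where "\<forall>y\<in>closure S. norm (u y) \<le> B"
    by (auto dest!: compact_imp_bounded simp: bounded_iff)
  then have B: "\<And>y. y \<in> closure S \<Longrightarrow> norm (u y) \<le> B" by blast
  have "finite_measure (lebesgue_on ?P)"
    using slice slice_bounded by (intro finite_measure_lebesgue_on bounded_set_imp_lmeasurable)
  then have "integrable (lebesgue_on ?P) (\<lambda>x. (u (x, c))\<^sup>2)"
  proof (rule finite_measure.integrable_const_bound)
    show "AE x in lebesgue_on ?P. norm ((u (x, c))\<^sup>2) \<le> B\<^sup>2"
    proof (rule AE_I2)
      fix x assume "x \<in> space (lebesgue_on ?P)"
      then have "norm (u (x, c)) \<le> B" by (intro B slice_closure) simp
      then have "\<bar>u (x, c)\<bar>\<^sup>2 \<le> B\<^sup>2" by (intro power_mono) auto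
      then show "norm ((u (x, c))\<^sup>2) \<le> B\<^sup>2" by simp
    qed
    show "(\<lambda>x. (u (x, c))\<^sup>2) \<in> borel_measurable (lebesgue_on ?P)" using m by measurable
  qed
  then show ?thesis using m by (simp add: l2_on_def)
qed

abbreviation trace0 :: "('a \<times> real \<Rightarrow> real) \<Rightarrow> bool" where
  "trace0 v \<equiv> has_flat_trace S G c v (\<lambda>_. 0)"

lemma trace0E: assumes "trace0 v"
  obtains u where "\<And>k. u k \<in> h1_on S" "\<And>k. continuous_on (closure S) (u k)"
    "(\<lambda>k. h1_norm 1 1 S (\<lambda>x. u k x - v x)) \<longlonglongrightarrow> 0" "(\<lambda>k. l2_norm {x. (x, c) \<in> G} (\<lambda>x. u k (x, c))) \<longlonglongrightarrow> 0"
  using assms unfolding has_flat_trace_def by auto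

lemma trace0I: assumes "\<And>k. u k \<in> h1_on S" "\<And>k. continuous_on (closure S) (u k)"
    "(\<lambda>k. h1_norm 1 1 S (\<lambda>x. u k x - v x)) \<longlonglongrightarrow> 0" "(\<lambda>k. l2_norm {x. (x, c) \<in> G} (\<lambda>x. u k (x, c))) \<longlonglongrightarrow> 0"
  shows "trace0 v"
  using assms l2.V_zero unfolding has_flat_trace_def by auto

lemma trace0_zero: "trace0 (\<lambda>x. 0)"
  by (rule trace0I[of "\<lambda>_ _. 0"]) (use h1.zero_elts h1.nrm_zero in \<open>simp_all add: L2.nrm_zero[unfolded L2_sel]\<close>)

lemma trace0_comb:
  assumes u: "u \<in> h1_on S" "trace0 u" and v: "v \<in> h1_on S" "trace0 v"
  shows "trace0 (\<lambda>x. a * u x + b * v x)"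
proof -
  obtain p where p: "\<And>k. p k \<in> h1_on S" "\<And>k. continuous_on (closure S) (p k)"
    "(\<lambda>k. h1_norm 1 1 S (\<lambda>x. p k x - u x)) \<longlonglongrightarrow> 0" "(\<lambda>k. l2_norm {x. (x, c) \<in> G} (\<lambda>x. p k (x, c))) \<longlonglongrightarrow> 0"
    using trace0E[OF u(2)] by blast
  obtain q where q: "\<And>k. q k \<in> h1_on S" "\<And>k. continuous_on (closure S) (q k)"
    "(\<lambda>k. h1_norm 1 1 S (\<lambda>x. q k x - v x)) \<longlonglongrightarrow> 0" "(\<lambda>k. l2_norm {x. (x, c) \<in> G} (\<lambda>x. q k (x, c))) \<longlonglongrightarrow> 0"
    using trace0E[OF v(2)] by blast
  have lim0: "(\<lambda>k. \<bar>a\<bar> * f k + \<bar>b\<bar> * g k) \<longlonglongrightarrow> 0" if "f \<longlonglongrightarrow> 0" "g \<longlonglongrightarrow> 0" for f g :: "nat \<Rightarrow> real"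
    using tendsto_add[OF tendsto_mult[OF tendsto_const that(1), of "\<bar>a\<bar>"] tendsto_mult[OF tendsto_const that(2), of "\<bar>b\<bar>"]] by simp
  show ?thesis
  proof (rule trace0I[of "\<lambda>k x. a * p k x + b * q k x"])
    show "(\<lambda>x. a * p k x + b * q k x) \<in> h1_on S" for k using h1.comb_elts[of "p k" "q k" a b] p q by simp
    show "continuous_on (closure S) (\<lambda>x. a * p k x + b * q k x)" for k by (intro continuous_intros p q)
    have dp: "(\<lambda>x. p k x - u x) \<in> h1_on S" and dq: "(\<lambda>x. q k x - v x) \<in> h1_on S" for k
      using h1.diff_elts[of "p k" u] h1.diff_elts[of "q k" v] p q u v by simp_all
    have eq: "(\<lambda>x. a * p k x + b * q k x - (a * u x + b * v x)) = (\<lambda>x. a * (p k x - u x) + b * (q k x - v x))" for k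
      by (simp add: algebra_simps)
    show "(\<lambda>k. h1_norm 1 1 S (\<lambda>x. a * p k x + b * q k x - (a * u x + b * v x))) \<longlonglongrightarrow> 0"
      unfolding eq
    proof (rule Lim_null_comparison[OF always_eventually lim0[OF p(3) q(3)]], rule allI)
      fix k
      show "norm (h1_norm 1 1 S (\<lambda>x. a * (p k x - u x) + b * (q k x - v x)))
          \<le> \<bar>a\<bar> * h1_norm 1 1 S (\<lambda>x. p k x - u x) + \<bar>b\<bar> * h1_norm 1 1 S (\<lambda>x. q k x - v x)"
        using h1.nrm_comb[of "\<lambda>x. p k x - u x" "\<lambda>x. q k x - v x" a b] dp dq
          h1.nrm_nonneg[OF h1.comb_elts[of "\<lambda>x. p k x - u x" "\<lambda>x. q k x - v x" a b]] by simp
    qed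
    let ?P = "{x. (x, c) \<in> G}"
    note s = slice_l2[OF p(2)] slice_l2[OF q(2)]
    show "(\<lambda>k. l2_norm ?P (\<lambda>x. a * p k (x, c) + b * q k (x, c))) \<longlonglongrightarrow> 0"
    proof (rule Lim_null_comparison[OF always_eventually lim0[OF p(4) q(4)]], rule allI)
      fix k
      show "norm (l2_norm ?P (\<lambda>x. a * p k (x, c) + b * q k (x, c)))
          \<le> \<bar>a\<bar> * l2_norm ?P (\<lambda>x. p k (x, c)) + \<bar>b\<bar> * l2_norm ?P (\<lambda>x. q k (x, c))"
        using L2.nrm_comb[of "\<lambda>x. p k (x, c)" ?P "\<lambda>x. q k (x, c)" a b] s[of k]
          L2.nrm_nonneg[OF L2.comb_elts[of "\<lambda>x. p k (x, c)" ?P "\<lambda>x. q k (x, c)" a b]] by simp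
    qed
  qed
qed

text \<open>A diagonal choice among the approximating sequences.\<close>

lemma trace0_limit:
  assumes f: "\<And>k. f k \<in> h1_on S" "\<And>k. trace0 (f k)" and v: "v \<in> h1_on S"
    and lim: "(\<lambda>k. h1_norm 1 1 S (\<lambda>x. f k x - v x)) \<longlonglongrightarrow> 0"
  shows "trace0 v"
proof -
  let ?P = "{x. (x, c) \<in> G}"
  \<comment> \<open>For each k, one approximant of \<open>f k\<close> is chosen whose two errors are
    both below 1/(k+1).\<close>
  have ex: "\<exists>u. u \<in> h1_on S \<and> continuous_on (closure S) u \<and> h1_norm 1 1 S (\<lambda>x. u x - f k x) < inverse (real (Suc k)) \<and>
     l2_norm ?P (\<lambda>x. u (x, c)) < inverse (real (Suc k))" for k
  proof -
    obtain p where p: "\<And>k. p k \<in> h1_on S" "\<And>k. continuous_on (closure S) (p k)"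
      "(\<lambda>j. h1_norm 1 1 S (\<lambda>x. p j x - f k x)) \<longlonglongrightarrow> 0" "(\<lambda>k. l2_norm ?P (\<lambda>x. p k (x, c))) \<longlonglongrightarrow> 0"
      using trace0E[OF f(2)] by blast
    have pos: "inverse (real (Suc k)) > 0" by simp
    have "\<forall>\<^sub>F j in sequentially. h1_norm 1 1 S (\<lambda>x. p j x - f k x) < inverse (real (Suc k)) \<and>
      l2_norm ?P (\<lambda>x. p j (x, c)) < inverse (real (Suc k))"
      by (intro eventually_conj order_tendstoD(2)[OF p(3) pos] order_tendstoD(2)[OF p(4) pos])
    then obtain j where "h1_norm 1 1 S (\<lambda>x. p j x - f k x) < inverse (real (Suc k)) \<and>
      l2_norm ?P (\<lambda>x. p j (x, c)) < inverse (real (Suc k))" by (auto simp: eventually_sequentially)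
    then show ?thesis using p by blast
  qed
  from choice[OF allI[OF ex]] obtain u where "\<forall>k. u k \<in> h1_on S \<and> continuous_on (closure S) (u k) \<and>
      h1_norm 1 1 S (\<lambda>x. u k x - f k x) < inverse (real (Suc k)) \<and> l2_norm ?P (\<lambda>x. u k (x, c)) < inverse (real (Suc k))"
    ..
  then have u: "\<And>k. u k \<in> h1_on S" "\<And>k. continuous_on (closure S) (u k)"
    "\<And>k. h1_norm 1 1 S (\<lambda>x. u k x - f k x) < inverse (real (Suc k))"
    "\<And>k. l2_norm ?P (\<lambda>x. u k (x, c)) < inverse (real (Suc k))" by blast+
  show ?thesis
  proof (rule trace0I[of u, OF u(1,2)])
    show "(\<lambda>k. h1_norm 1 1 S (\<lambda>x. u k x - v x)) \<longlonglongrightarrow> 0"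
    proof (rule Lim_null_comparison[OF always_eventually], rule allI)
      fix k
      show "norm (h1_norm 1 1 S (\<lambda>x. u k x - v x)) \<le> inverse (real (Suc k)) + h1_norm 1 1 S (\<lambda>x. f k x - v x)"
        using h1.nrm_triangle[of "u k" "f k" v] u(1,3)[of k] f(1) v h1.nrm_nonneg[OF h1.diff_elts[of "u k" v]] by simp
      show "(\<lambda>k. inverse (real (Suc k)) + h1_norm 1 1 S (\<lambda>x. f k x - v x)) \<longlonglongrightarrow> 0"
        using tendsto_add[OF LIMSEQ_inverse_real_of_nat lim] by simp
    qed
    show "(\<lambda>k. l2_norm ?P (\<lambda>x. u k (x, c))) \<longlonglongrightarrow> 0"
    proof (rule Lim_null_comparison[OF always_eventually LIMSEQ_inverse_real_of_nat], rule allI)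
      fix k
      show "norm (l2_norm ?P (\<lambda>x. u k (x, c))) \<le> inverse (real (Suc k))"
        using u(4)[of k] L2.nrm_nonneg[of "\<lambda>x. u k (x, c)" ?P] slice_l2[OF u(2)] by simp
    qed
  qed
qed

text \<open>The constant sequence u converges to v in the seminorm, so this is an instance of the
  limit lemma.\<close>

lemma trace0_AE_cong:
  assumes u: "u \<in> h1_on S" "trace0 u" and uv: "AE x in lebesgue_on S. u x = v x"
  shows "trace0 v"
  by (rule trace0_limit[of "\<lambda>_. u"]) (use u h1_on_AE_cong[OF S_open u(1) uv] in simp_all)

end

text \<open>The weights cover the cell, with 1 and 1, and the layer, with
  \<open>1 / \<epsilon>\<close> and \<epsilon>. They enter only the norm of the space; the trace
  condition is always measured with unit weights.\<close>

locale two_pieces = P: flat_piece S G1 c1 + M: flat_piece S G2 c2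
  for S :: "('a::euclidean_space \<times> real) set" and G1 c1 G2 c2 +
  fixes a b :: real
  assumes a: "0 < a" and b: "0 < b"
begin

definition H0 :: "('a \<times> real) fspace" where
  "H0 = FSpace {v \<in> h1_on S. has_flat_trace S G1 c1 v (\<lambda>_. 0) \<and> has_flat_trace S G2 c2 v (\<lambda>_. 0)} (h1_norm a b S)"

sublocale H1: seminormed "H1 a b S" by (rule seminormed_H1[OF P.S_open]) (use a b in auto)

sublocale H0: seminormed H0
proof
  show "(\<lambda>x. 0) \<in> elts H0" using H1.zero_elts P.trace0_zero M.trace0_zero by (simp add: H0_def)
  fix u v p q assume "u \<in> elts H0" "v \<in> elts H0"
  then show "(\<lambda>x. p * u x + q * v x) \<in> elts H0"
    "nrm H0 (\<lambda>x. p * u x + q * v x) \<le> \<bar>p\<bar> * nrm H0 u + \<bar>q\<bar> * nrm H0 v"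
    using H1.comb_elts[of u v p q] H1.nrm_comb[of u v p q] P.trace0_comb M.trace0_comb by (auto simp: H0_def)
qed

lemma H0_h1: "u \<in> elts H0 \<Longrightarrow> u \<in> h1_on S" by (simp add: H0_def)

lemma H0_AE_cong:
  assumes u: "u \<in> elts H0" and uv: "AE x in lebesgue_on S. u x = v x"
  shows "v \<in> elts H0" "nrm H0 v = nrm H0 u" "nrm H0 (\<lambda>x. u x - v x) = 0"
  using u h1_on_AE_cong(1)[OF P.S_open _ uv] h1_on_AE_cong(2,3)[OF P.S_open _ uv, of a b] P.trace0_AE_cong[OF _ _ uv] M.trace0_AE_cong[OF _ _ uv] a b
  by (auto simp: H0_def)

end

text \<open>With unit weights the norm is the one in which \<open>trace0_limit\<close> is phrased,
  so the zero traces survive in the limit given by \<open>h1_complete\<close>.\<close>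

lemma (in two_pieces) H0_complete:
  assumes one: "a = 1" "b = 1" and f: "\<And>k. f k \<in> elts H0"
    and cauchy: "\<And>e. e > 0 \<Longrightarrow> \<exists>N. \<forall>m\<ge>N. \<forall>n\<ge>N. nrm H0 (\<lambda>x. f m x - f n x) < e"
  obtains u where "u \<in> elts H0" "(\<lambda>k. nrm H0 (\<lambda>x. f k x - u x)) \<longlonglongrightarrow> 0"
proof -
  have h: "f k \<in> h1_on S" for k using f[of k] by (rule H0_h1)
  have n: "nrm H0 v = h1_norm 1 1 S v" for v unfolding H0_def fspace.sel unfolding one ..
  obtain u where u: "u \<in> h1_on S" "(\<lambda>k. h1_norm 1 1 S (\<lambda>x. f k x - u x)) \<longlonglongrightarrow> 0"
    by (rule h1_complete[OF P.S_open h cauchy[unfolded n]])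
  have "u \<in> elts H0"
    using u P.trace0_limit[OF h _ u] M.trace0_limit[OF h _ u] f by (simp add: H0_def)
  then show ?thesis using u(2) by (rule that[unfolded n])
qed

subsection \<open>Fubini for the Lebesgue measure\<close>

text \<open>On a product space \<open>lebesgue\<close> is the completion of the Borel product
  measure, not the product of the completed factors. Fubini and Tonelli are therefore brought over
  from \<open>lborel\<close>, through Borel modifications where functions are involved.\<close>

lemma AE_lebesgue_prod:
  fixes P :: "'a::euclidean_space \<times> 'b::euclidean_space \<Rightarrow> bool"
  assumes "AE z in lebesgue. P z"
  shows "AE x in lebesgue. AE y in lebesgue. P (x, y)" "AE y in lebesgue. AE x in lebesgue. P (x, y)"
proof -
  have ae: "AE z in lborel \<Otimes>\<^sub>M lborel. P z" using assms unfolding AE_completion_iff lborel_prod .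
  show "AE x in lebesgue. AE y in lebesgue. P (x, y)"
    using lborel_pair.AE_pair[OF ae] by (simp add: AE_completion_iff)
  have "AE z in distr (lborel \<Otimes>\<^sub>M lborel) (lborel \<Otimes>\<^sub>M lborel) (\<lambda>(y::'b, x::'a). (x, y)). P z"
    using ae by (subst (asm) lborel_pair.distr_pair_swap)
  then have "AE z in lborel \<Otimes>\<^sub>M lborel. P ((\<lambda>(y::'b, x::'a). (x, y)) z)"
    by (rule AE_distrD[rotated]) measurable
  from lborel_pair.AE_pair[OF this]
  show "AE y in lebesgue. AE x in lebesgue. P (x, y)" by (simp add: AE_completion_iff)
qed

text \<open>Composition with a Borel map preserves statements valid almost everywhere once preimages
  of null sets are null. The condition is stated by sections because there it is immediate for the
  two projections.\<close>

lemma AE_lebesgue_lborel_prod: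
  fixes q :: "'a::euclidean_space \<times> 'b::euclidean_space \<Rightarrow> 'c::euclidean_space"
  assumes q: "q \<in> lborel \<Otimes>\<^sub>M lborel \<rightarrow>\<^sub>M lborel"
    and null: "\<And>N. N \<in> null_sets lborel \<Longrightarrow> AE x in lborel. AE y in lborel. q (x, y) \<notin> N"
    and P: "AE u in lebesgue. P u"
  shows "AE z in lebesgue. P (q z)"
proof -
  obtain N where N: "N \<in> null_sets lborel" "{u. \<not> P u} \<subseteq> N"
    using P unfolding AE_completion_iff by (auto simp: eventually_ae_filter)
  have "AE z in lborel \<Otimes>\<^sub>M lborel. q z \<notin> N"
  proof (rule lborel_pair.AE_pair_measure)
    show "{z \<in> space (lborel \<Otimes>\<^sub>M lborel). q z \<notin> N} \<in> sets (lborel \<Otimes>\<^sub>M lborel)"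
      using q N(1)[THEN null_setsD2] by measurable
  qed (rule null[OF N(1)])
  then have "AE z in lborel. P (q z)" unfolding lborel_prod using N(2) by (auto elim!: eventually_mono)
  then show ?thesis by (rule AE_completion)
qed

lemma AE_lebesgue_snd:
  "AE y in lebesgue. P y \<Longrightarrow> AE z in (lebesgue :: ('a::euclidean_space \<times> 'b::euclidean_space) measure). P (snd z)"
  by (rule AE_lebesgue_lborel_prod) (auto intro: AE_not_in)

lemma AE_lebesgue_fst:
  "AE x in lebesgue. P x \<Longrightarrow> AE z in (lebesgue :: ('a::euclidean_space \<times> 'b::euclidean_space) measure). P (fst z)"
  by (rule AE_lebesgue_lborel_prod) (auto dest!: AE_not_in elim: eventually_mono)

lemma borel_measurable_lebesgue_compose:
  fixes f :: "'c::euclidean_space \<Rightarrow> real" and q :: "'a::euclidean_space \<times> 'b::euclidean_space \<Rightarrow> 'c"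
  assumes f: "f \<in> borel_measurable lebesgue" and q: "q \<in> lborel \<Otimes>\<^sub>M lborel \<rightarrow>\<^sub>M lborel"
    and ae: "\<And>P. AE u in lebesgue. P u \<Longrightarrow> AE z in lebesgue. P (q z)"
  shows "(\<lambda>z. f (q z)) \<in> borel_measurable lebesgue"
proof -
  obtain f' where f': "f' \<in> borel_measurable lborel" "AE u in lborel. f u = f' u"
    using completion_ex_borel_measurable_real[OF f] by blast
  have "(\<lambda>z. f' (q z)) \<in> borel_measurable lebesgue"
    using measurable_compose[OF q f'(1)] unfolding lborel_prod by (rule measurable_completion)
  moreover have "AE z in lebesgue. f' (q z) = f (q z)"
    using ae[OF AE_completion[OF f'(2)]] by (auto elim: eventually_mono)
  ultimately show ?thesis by (rule borel_measurable_AE)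
qed

lemma borel_measurable_lebesgue_snd:
  fixes f :: "'b::euclidean_space \<Rightarrow> real"
  shows "f \<in> borel_measurable lebesgue \<Longrightarrow> (\<lambda>z. f (snd z)) \<in> borel_measurable (lebesgue :: ('a::euclidean_space \<times> 'b) measure)"
  by (rule borel_measurable_lebesgue_compose[OF _ measurable_snd AE_lebesgue_snd])

lemma borel_measurable_lebesgue_fst:
  fixes f :: "'a::euclidean_space \<Rightarrow> real"
  shows "f \<in> borel_measurable lebesgue \<Longrightarrow> (\<lambda>z. f (fst z)) \<in> borel_measurable (lebesgue :: ('a \<times> 'b::euclidean_space) measure)"
  by (rule borel_measurable_lebesgue_compose[OF _ measurable_fst AE_lebesgue_fst])

lemma nn_integral_lebesgue_prod:
  fixes f :: "'a::euclidean_space \<times> 'b::euclidean_space \<Rightarrow> real"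
  assumes "f \<in> borel_measurable lebesgue"
  shows "(\<integral>\<^sup>+x. (\<integral>\<^sup>+y. ennreal (f (x, y)) \<partial>lebesgue) \<partial>lebesgue) = (\<integral>\<^sup>+z. ennreal (f z) \<partial>lebesgue)"
    "(\<integral>\<^sup>+y. (\<integral>\<^sup>+x. ennreal (f (x, y)) \<partial>lebesgue) \<partial>lebesgue) = (\<integral>\<^sup>+z. ennreal (f z) \<partial>lebesgue)"
proof -
  obtain f' where f': "f' \<in> borel_measurable lborel" "AE z in lborel. f z = f' z"
    using completion_ex_borel_measurable_real[OF assms] by blast
  note ae = AE_completion[OF f'(2)]
  have [measurable]: "f' \<in> borel_measurable (lborel \<Otimes>\<^sub>M lborel)" using f'(1) by (simp add: lborel_prod)
  have all: "(\<integral>\<^sup>+z. ennreal (f z) \<partial>lebesgue) = (\<integral>\<^sup>+z. ennreal (f' z) \<partial>(lborel \<Otimes>\<^sub>M lborel))"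
    unfolding lborel_prod nn_integral_completion by (rule nn_integral_cong_AE) (use f'(2) in \<open>auto elim: eventually_mono\<close>)
  have "(\<integral>\<^sup>+x. (\<integral>\<^sup>+y. ennreal (f (x, y)) \<partial>lebesgue) \<partial>lebesgue) = (\<integral>\<^sup>+x. (\<integral>\<^sup>+y. ennreal (f' (x, y)) \<partial>lebesgue) \<partial>lebesgue)"
    using AE_lebesgue_prod(1)[OF ae]
    by (intro nn_integral_cong_AE) (auto intro: nn_integral_cong_AE elim!: eventually_mono)
  also have "\<dots> = (\<integral>\<^sup>+z. ennreal (f' z) \<partial>(lborel \<Otimes>\<^sub>M lborel))"
    unfolding nn_integral_completion by (rule lborel.nn_integral_fst) measurable
  finally show "(\<integral>\<^sup>+x. (\<integral>\<^sup>+y. ennreal (f (x, y)) \<partial>lebesgue) \<partial>lebesgue) = (\<integral>\<^sup>+z. ennreal (f z) \<partial>lebesgue)" unfolding all .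
  have "(\<integral>\<^sup>+y. (\<integral>\<^sup>+x. ennreal (f (x, y)) \<partial>lebesgue) \<partial>lebesgue) = (\<integral>\<^sup>+y. (\<integral>\<^sup>+x. ennreal (f' (x, y)) \<partial>lebesgue) \<partial>lebesgue)"
    using AE_lebesgue_prod(2)[OF ae]
    by (intro nn_integral_cong_AE) (auto intro: nn_integral_cong_AE elim!: eventually_mono)
  also have "\<dots> = (\<integral>\<^sup>+z. ennreal (f' z) \<partial>(lborel \<Otimes>\<^sub>M lborel))"
    unfolding nn_integral_completion by (rule lborel_pair.nn_integral_snd) measurable
  finally show "(\<integral>\<^sup>+y. (\<integral>\<^sup>+x. ennreal (f (x, y)) \<partial>lebesgue) \<partial>lebesgue) = (\<integral>\<^sup>+z. ennreal (f z) \<partial>lebesgue)" unfolding all .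
qed

lemma integral_lebesgue_prod:
  fixes f :: "'a::euclidean_space \<times> 'b::euclidean_space \<Rightarrow> real"
  assumes f: "integrable lebesgue f"
  shows "AE y in lebesgue. integrable lebesgue (\<lambda>x. f (x, y))"
    "integrable lebesgue (\<lambda>y. LINT x|lebesgue. f (x, y))"
    "(LINT y|lebesgue. LINT x|lebesgue. f (x, y)) = (LINT z|lebesgue. f z)"
proof -
  have fm: "f \<in> borel_measurable lebesgue" using f by auto
  obtain f' where f': "f' \<in> borel_measurable lborel" "AE z in lborel. f z = f' z"
    using completion_ex_borel_measurable_real[OF fm] by blast
  note ae = AE_completion[OF f'(2)]
  have f'm: "f' \<in> borel_measurable lebesgue" using f'(1) by (rule measurable_completion)
  have "integrable lebesgue f'" by (rule integrable_cong_AE_imp[OF f f'm]) (use ae in \<open>auto elim: eventually_mono\<close>)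
  then have "integrable lborel f'" unfolding integrable_completion[OF f'(1)] .
  then have i: "integrable (lborel \<Otimes>\<^sub>M lborel) (\<lambda>(x, y). f' (x, y))" by (simp add: lborel_prod)
  have [measurable]: "f' \<in> borel_measurable (lborel \<Otimes>\<^sub>M lborel)" using f'(1) by (simp add: lborel_prod)
  have sec: "AE y in lebesgue. (AE x in lebesgue. f (x, y) = f' (x, y)) \<and> integrable lborel (\<lambda>x. f' (x, y))"
    using AE_lebesgue_prod(2)[OF ae] AE_completion[OF lborel_pair.AE_integrable_snd[OF i]] by eventually_elim simp
  have sm: "(\<lambda>x. f' (x, y)) \<in> borel_measurable lborel" for y by measurable
  have sec2: "AE y in lebesgue. integrable lebesgue (\<lambda>x. f (x, y)) \<and> (LINT x|lebesgue. f (x, y)) = (LINT x|lborel. f' (x, y))"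
    using sec
  proof eventually_elim
    case (elim y)
    have "integrable lebesgue (\<lambda>x. f' (x, y))" using elim by (simp add: integrable_completion)
    moreover have "AE x in lebesgue. f' (x, y) = f (x, y)" using elim by (auto elim: eventually_mono)
    moreover from this have m: "(\<lambda>x. f (x, y)) \<in> borel_measurable lebesgue"
      by (rule borel_measurable_AE[OF measurable_completion[OF sm]])
    ultimately have "integrable lebesgue (\<lambda>x. f (x, y))" using integrable_cong_AE_imp by blast
    moreover have "(LINT x|lebesgue. f (x, y)) = (LINT x|lebesgue. f' (x, y))"
      by (rule integral_cong_AE[OF m measurable_completion[OF sm]]) (use elim in blast)
    ultimately show ?case by (simp add: integral_completion)
  qed
  then show "AE y in lebesgue. integrable lebesgue (\<lambda>x. f (x, y))" by (auto elim: eventually_mono)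
  have i2: "integrable lborel (\<lambda>y. LINT x|lborel. f' (x, y))" using lborel_pair.integrable_snd[OF i] by simp
  have m2: "(\<lambda>y. LINT x|lborel. f' (x, y)) \<in> borel_measurable lborel" using i2 by auto
  then have m3: "(\<lambda>y. LINT x|lborel. f' (x, y)) \<in> borel_measurable lebesgue" by (rule measurable_completion)
  have i3: "integrable lebesgue (\<lambda>y. LINT x|lborel. f' (x, y))" using i2 m2 by (simp add: integrable_completion)
  have ae2: "AE y in lebesgue. (LINT x|lborel. f' (x, y)) = (LINT x|lebesgue. f (x, y))"
    using sec2 by (auto elim: eventually_mono)
  have m4: "(\<lambda>y. LINT x|lebesgue. f (x, y)) \<in> borel_measurable lebesgue" by (rule borel_measurable_AE[OF m3 ae2])
  show "integrable lebesgue (\<lambda>y. LINT x|lebesgue. f (x, y))" by (rule integrable_cong_AE_imp[OF i3 m4 ae2])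
  have "(LINT y|lebesgue. LINT x|lebesgue. f (x, y)) = (LINT y|lebesgue. LINT x|lborel. f' (x, y))"
    by (rule integral_cong_AE[OF m4 m3]) (use sec2 in \<open>auto elim: eventually_mono\<close>)
  also have "\<dots> = (LINT y|lborel. LINT x|lborel. f' (x, y))" by (rule integral_completion[OF m2])
  also have "\<dots> = (LINT z|lborel. f' z)" using lborel_pair.integral_snd[OF i] by (simp add: lborel_prod)
  also have "\<dots> = (LINT z|lebesgue. f' z)" by (rule integral_completion[symmetric, OF f'(1)])
  also have "\<dots> = (LINT z|lebesgue. f z)"
    by (rule integral_cong_AE[OF f'm fm]) (use ae in \<open>auto elim: eventually_mono\<close>)
  finally show "(LINT y|lebesgue. LINT x|lebesgue. f (x, y)) = (LINT z|lebesgue. f z)" .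
qed

text \<open>The indicator of the product is a product of indicators pulled back along the
  projections, and those preserve Lebesgue measurability.\<close>

lemma Times_sets_lebesgue:
  fixes A :: "'a::euclidean_space set" and B :: "'b::euclidean_space set"
  assumes "A \<in> sets lebesgue" "B \<in> sets lebesgue"
  shows "A \<times> B \<in> sets lebesgue"
proof -
  have "(\<lambda>z. indicator A (fst z) * indicator B (snd z) :: real) \<in> borel_measurable (lebesgue :: ('a \<times> 'b) measure)"
    using borel_measurable_lebesgue_fst[OF borel_measurable_indicator[OF assms(1)]]
      borel_measurable_lebesgue_snd[OF borel_measurable_indicator[OF assms(2)]] by (rule borel_measurable_times)
  moreover have "(\<lambda>z. indicator A (fst z) * indicator B (snd z) :: real) = indicator (A \<times> B)"
    by (auto simp: indicator_def fun_eq_iff)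
  ultimately show ?thesis by (simp add: borel_measurable_indicator_iff)
qed

subsection \<open>Square integrable functions with values in a Sobolev space\<close>

lemma l2_norm_mono:
  assumes f: "f \<in> l2_on S" and g: "g \<in> l2_on S" and le: "AE x in lebesgue_on S. \<bar>f x\<bar> \<le> \<bar>g x\<bar>"
  shows "l2_norm S f \<le> l2_norm S g"
proof -
  have "(LINT x|lebesgue_on S. (f x)\<^sup>2) \<le> (LINT x|lebesgue_on S. (g x)\<^sup>2)"
  proof (rule integral_mono_AE)
    show "AE x in lebesgue_on S. (f x)\<^sup>2 \<le> (g x)\<^sup>2"
      using le by eventually_elim (simp add: abs_le_square_iff)
  qed (use f g in \<open>simp_all add: l2_on_def\<close>)
  then have "(l2_norm S f)\<^sup>2 \<le> (l2_norm S g)\<^sup>2" by (simp add: l2_norm_power2 f g)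
  then show ?thesis by (rule power2_le_imp_le) (use L2.nrm_nonneg[of g S] g in simp)
qed

lemma (in seminormed) bochner_l2_nrm_l2:
  assumes S: "S \<in> sets lebesgue" and f: "f \<in> bochner_l2 (lebesgue_on S) X"
  shows "(\<lambda>t. nrm X (f t)) \<in> l2_on S" "bochner_l2_norm (lebesgue_on S) X f = l2_norm S (\<lambda>t. nrm X (f t))"
  using bochner_l2D[OF complete_measure_lebesgue_on[OF S] f]
  by (simp_all add: l2_on_def bochner_l2_norm_def l2_norm_def l2_inner_def power2_eq_square)

lemma l1_le_l2:
  assumes S: "S \<in> lmeasurable" and f: "f \<in> l2_on S"
  shows "(LINT x|lebesgue_on S. \<bar>f x\<bar>) \<le> l2_norm S (\<lambda>_. 1) * l2_norm S f"
proof -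
  have one: "(\<lambda>_. 1) \<in> l2_on S"
    using finite_measure.integrable_const[OF finite_measure_lebesgue_on[OF S], of "1::real"] by (simp add: l2_on_def)
  have a: "(\<lambda>x. \<bar>f x\<bar>) \<in> l2_on S" using f by (auto simp: l2_on_def)
  have "l2_inner S (\<lambda>_. 1) (\<lambda>x. \<bar>f x\<bar>) \<le> l2_norm S (\<lambda>_. 1) * l2_norm S (\<lambda>x. \<bar>f x\<bar>)"
    using l2.cauchy_schwarz[OF one a] by (simp add: l2_norm_def)
  then show ?thesis by (simp add: l2_inner_def l2_norm_def)
qed

lemma (in seminormed) simple_integral_bound:
  assumes M: "finite_measure M" and r: "simple_function M r" "r ` space M \<subseteq> elts X"
  shows "(\<lambda>y. LINT x|M. r x y) \<in> elts X" "nrm X (\<lambda>y. LINT x|M. r x y) \<le> (LINT x|M. nrm X (r x))"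
proof -
  have eq: "(\<lambda>y. LINT x|M. r x y) = (\<lambda>y. \<Sum>c\<in>r ` space M. measure M {t \<in> space M. r t = c} * c y)"
    using simple_integral_in_eq[OF M r(1)] by (simp add: simple_integral_in_def fun_eq_iff)
  note s = sum_elts[OF simple_functionD(1)[OF r(1)], of "\<lambda>c. c" "\<lambda>c. measure M {t \<in> space M. r t = c}"]
  show "(\<lambda>y. LINT x|M. r x y) \<in> elts X" unfolding eq using s r(2) by blast
  show "nrm X (\<lambda>y. LINT x|M. r x y) \<le> (LINT x|M. nrm X (r x))"
    unfolding eq finite_measure.integral_simple_compose(2)[OF M r(1), of "nrm X"] using s r(2) by auto
qed

lemma strongly_measurable_subset:
  assumes A: "A \<in> sets lebesgue" "A \<subseteq> S" and S: "S \<in> sets lebesgue" and f: "strongly_measurable (lebesgue_on S) X f"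
  shows "strongly_measurable (lebesgue_on A) X f"
proof -
  obtain s where s: "\<And>k. simple_function (lebesgue_on S) (s k)" "\<And>k. s k ` space (lebesgue_on S) \<subseteq> elts X"
    "AE t in lebesgue_on S. (\<lambda>k. nrm X (\<lambda>x. s k t x - f t x)) \<longlonglongrightarrow> 0" using f unfolding strongly_measurable_def by blast
  show ?thesis unfolding strongly_measurable_def
  proof (intro exI[of _ s] conjI allI)
    fix k
    show "s k ` space (lebesgue_on A) \<subseteq> elts X" using s(2)[of k] A(2) by auto
    show "simple_function (lebesgue_on A) (s k)" unfolding simple_function_def
    proof (intro conjI ballI)
      show "finite (s k ` space (lebesgue_on A))"
        using simple_functionD(1)[OF s(1)[of k]] A(2) by (auto intro: finite_subset[OF image_mono])
      fix c
      have "s k -` {c} \<inter> space (lebesgue_on S) \<in> sets (lebesgue_on S)" by (rule simple_functionD(2)[OF s(1)])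
      then have "s k -` {c} \<inter> S \<in> sets lebesgue" using S by (simp add: sets_restrict_space_iff)
      then have "(s k -` {c} \<inter> S) \<inter> A \<in> sets lebesgue" using A(1) by (rule sets.Int)
      moreover have "(s k -` {c} \<inter> S) \<inter> A = s k -` {c} \<inter> A" using A(2) by blast
      ultimately show "s k -` {c} \<inter> space (lebesgue_on A) \<in> sets (lebesgue_on A)"
        using A(1) by (simp add: sets_restrict_space_iff)
    qed
  next
    show "AE t in lebesgue_on A. (\<lambda>k. nrm X (\<lambda>x. s k t x - f t x)) \<longlonglongrightarrow> 0"
      using s(3) A(2) unfolding AE_lebesgue_on[OF A(1)] AE_lebesgue_on[OF S] by (auto elim: eventually_mono)
  qed
qed

lemma (in seminormed) bochner_l2_subset:
  assumes A: "A \<in> sets lebesgue" "A \<subseteq> S" and S: "S \<in> sets lebesgue" and f: "f \<in> bochner_l2 (lebesgue_on S) X"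
  shows "f \<in> bochner_l2 (lebesgue_on A) X"
proof -
  note F = bochner_l2D[OF complete_measure_lebesgue_on[OF S] f]
  have "(\<lambda>t. nrm X (f t)) \<in> l2_on A"
    by (rule l2_on_subset[OF bochner_l2_nrm_l2(1)[OF S f] S A])
  moreover have "AE t in lebesgue_on A. f t \<in> elts X"
    using F(1) A(2) unfolding AE_lebesgue_on[OF A(1)] AE_lebesgue_on[OF S] by (auto elim: eventually_mono)
  ultimately show ?thesis using strongly_measurable_subset[OF A S F(2)] by (simp add: bochner_l2_def l2_on_def)
qed

context two_pieces
begin

text \<open>The abstract form of \<open>L2_H_cell\<close>. Membership in \<open>l2_on\<close> of the
  product supplies the joint measurability that lets the vector-valued integral be compared with the
  pointwise one.\<close>

definition L2V :: "'c::euclidean_space set \<Rightarrow> ('c \<times> 'a \<times> real) fspace" where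
  "L2V \<Sigma> = FSpace {\<phi> \<in> l2_on (\<Sigma> \<times> S). (\<lambda>x y. \<phi> (x, y)) \<in> bochner_l2 (lebesgue_on \<Sigma>) H0}
    (\<lambda>\<phi>. bochner_l2_norm (lebesgue_on \<Sigma>) H0 (\<lambda>x y. \<phi> (x, y)))"

lemma L2VD: assumes "\<phi> \<in> elts (L2V \<Sigma>)"
  shows "\<phi> \<in> l2_on (\<Sigma> \<times> S)" "(\<lambda>x y. \<phi> (x, y)) \<in> bochner_l2 (lebesgue_on \<Sigma>) H0"
  using assms by (auto simp: L2V_def)

lemma S_lebesgue: "S \<in> sets lebesgue" using P.S_open by simp

lemma S_lmeasurable: "S \<in> lmeasurable" using P.S_open P.S_bounded by (simp add: lmeasurable_open)

lemma seminormed_L2V: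
  assumes \<Sigma>: "\<Sigma> \<in> sets lebesgue"
  shows "seminormed (L2V \<Sigma>)"
proof
  have C: "complete_measure (lebesgue_on \<Sigma>)" by (rule complete_measure_lebesgue_on[OF \<Sigma>])
  have "(\<lambda>x y. 0) \<in> bochner_l2 (lebesgue_on \<Sigma>) H0"
    using H0.zero_elts H0.nrm_zero H0.strongly_measurable_simple[of "lebesgue_on \<Sigma>" "\<lambda>_ _. 0"]
    by (auto simp: bochner_l2_def)
  then show "(\<lambda>x. 0) \<in> elts (L2V \<Sigma>)" by (simp add: L2V_def l2.V_zero)
  fix u v p q assume uv: "u \<in> elts (L2V \<Sigma>)" "v \<in> elts (L2V \<Sigma>)"
  note U = L2VD[OF uv(1)] and V = L2VD[OF uv(2)]
  note b = H0.bochner_l2_comb[OF C U(2) V(2), of p q]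
  show "(\<lambda>x. p * u x + q * v x) \<in> elts (L2V \<Sigma>)"
    using b l2_on_comb[OF U(1) V(1), of p q] by (simp add: L2V_def)
  note nu = H0.bochner_l2_nrm_l2[OF \<Sigma> U(2)] and nv = H0.bochner_l2_nrm_l2[OF \<Sigma> V(2)] and nb = H0.bochner_l2_nrm_l2[OF \<Sigma> b]
  let ?u = "\<lambda>x. nrm H0 (\<lambda>y. u (x, y))" and ?v = "\<lambda>x. nrm H0 (\<lambda>y. v (x, y))"
  have "l2_norm \<Sigma> (\<lambda>x. nrm H0 (\<lambda>y. p * u (x, y) + q * v (x, y))) \<le> l2_norm \<Sigma> (\<lambda>x. \<bar>p\<bar> * ?u x + \<bar>q\<bar> * ?v x)"
  proof (rule l2_norm_mono[OF nb(1) l2_on_comb[OF nu(1) nv(1)]])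
    show "AE x in lebesgue_on \<Sigma>. \<bar>nrm H0 (\<lambda>y. p * u (x, y) + q * v (x, y))\<bar> \<le> \<bar>\<bar>p\<bar> * ?u x + \<bar>q\<bar> * ?v x\<bar>"
      using H0.bochner_l2D(1)[OF C U(2)] H0.bochner_l2D(1)[OF C V(2)]
    proof eventually_elim
      case (elim x)
      show ?case using H0.nrm_comb[OF elim, of p q] H0.nrm_nonneg[OF H0.comb_elts[OF elim, of p q]] by simp
    qed
  qed
  also have "\<dots> \<le> \<bar>p\<bar> * l2_norm \<Sigma> ?u + \<bar>q\<bar> * l2_norm \<Sigma> ?v"
    using L2.nrm_comb[of ?u \<Sigma> ?v "\<bar>p\<bar>" "\<bar>q\<bar>"] nu(1) nv(1) by simp
  finally show "nrm (L2V \<Sigma>) (\<lambda>x. p * u x + q * v x) \<le> \<bar>p\<bar> * nrm (L2V \<Sigma>) u + \<bar>q\<bar> * nrm (L2V \<Sigma>) v"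
    by (simp add: L2V_def nu(2) nv(2) nb(2))
qed

lemma L2V_subset:
  assumes "\<phi> \<in> elts (L2V \<Sigma>)" "\<Sigma> \<in> sets lebesgue" "Q \<in> sets lebesgue" "Q \<subseteq> \<Sigma>"
  shows "\<phi> \<in> elts (L2V Q)"
proof -
  have "\<phi> \<in> l2_on (Q \<times> S)"
    by (rule l2_on_subset[OF L2VD(1)[OF assms(1)]]) (use assms S_lebesgue in \<open>auto intro: Times_sets_lebesgue\<close>)
  then show ?thesis
    using H0.bochner_l2_subset[OF assms(3,4,2) L2VD(2)[OF assms(1)]] by (simp add: L2V_def)
qed

end

section \<open>Sections of functions on a product set\<close>

lemma lebesgue_on_Times_section:
  fixes f :: "'c::euclidean_space \<times> 'b::euclidean_space \<Rightarrow> real"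
  assumes \<Sigma>: "\<Sigma> \<in> sets lebesgue" and S: "S \<in> sets lebesgue" and f: "integrable (lebesgue_on (\<Sigma> \<times> S)) f"
  shows "AE y in lebesgue_on S. integrable (lebesgue_on \<Sigma>) (\<lambda>x. f (x, y))"
    "integrable (lebesgue_on S) (\<lambda>y. LINT x|lebesgue_on \<Sigma>. f (x, y))"
    "(LINT y|lebesgue_on S. LINT x|lebesgue_on \<Sigma>. f (x, y)) = (LINT z|lebesgue_on (\<Sigma> \<times> S). f z)"
proof -
  note T = Times_sets_lebesgue[OF \<Sigma> S]
  have i: "integrable lebesgue (\<lambda>z. indicator (\<Sigma> \<times> S) z * f z)" using f by (simp add: integrable_lebesgue_on[OF T])
  have ind: "indicator (\<Sigma> \<times> S) (x, y) * f (x, y) = indicator S y * (indicator \<Sigma> x * f (x, y))" for x y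
    by (simp add: indicator_times)
  note L = integral_lebesgue_prod[OF i, unfolded ind]
  show "AE y in lebesgue_on S. integrable (lebesgue_on \<Sigma>) (\<lambda>x. f (x, y))"
    unfolding AE_lebesgue_on[OF S] integrable_lebesgue_on[OF \<Sigma>]
    using L(1) by eventually_elim (auto simp: indicator_def)
  show "integrable (lebesgue_on S) (\<lambda>y. LINT x|lebesgue_on \<Sigma>. f (x, y))"
    unfolding integrable_lebesgue_on[OF S] LINT_lebesgue_on[OF \<Sigma>] using L(2) by simp
  show "(LINT y|lebesgue_on S. LINT x|lebesgue_on \<Sigma>. f (x, y)) = (LINT z|lebesgue_on (\<Sigma> \<times> S). f z)"
    unfolding LINT_lebesgue_on[OF S] LINT_lebesgue_on[OF \<Sigma>] LINT_lebesgue_on[OF T] using L(3) by simp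
qed

lemma l2_on_snd:
  fixes w :: "'b::euclidean_space \<Rightarrow> real" and \<Sigma> :: "'c::euclidean_space set"
  assumes \<Sigma>: "\<Sigma> \<in> lmeasurable" and S: "S \<in> sets lebesgue" and w: "w \<in> l2_on S"
  shows "(\<lambda>z. w (snd z)) \<in> l2_on (\<Sigma> \<times> S)"
proof -
  have sets: "\<Sigma> \<in> sets lebesgue" using \<Sigma> by auto
  note T = Times_sets_lebesgue[OF sets S]
  note W = w[unfolded l2_on_zero_extension[OF S]]
  have ind: "indicator (\<Sigma> \<times> S) z * g (snd z) = indicator \<Sigma> (fst z) * (indicator S (snd z) * g (snd z))" for z and g :: "'b \<Rightarrow> real"
    by (cases z) (simp add: indicator_times)
  have m: "(\<lambda>z. indicator (\<Sigma> \<times> S) z * g (snd z)) \<in> borel_measurable lebesgue"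
    if "(\<lambda>y. indicator S y * g y) \<in> borel_measurable lebesgue" for g :: "'b \<Rightarrow> real"
    unfolding ind by (rule borel_measurable_times[OF borel_measurable_lebesgue_fst[OF borel_measurable_indicator[OF sets]]
      borel_measurable_lebesgue_snd[OF that]])
  have m2: "(\<lambda>z. indicator (\<Sigma> \<times> S) z * (w (snd z))\<^sup>2) \<in> borel_measurable lebesgue"
    using W by (intro m[of "\<lambda>y. (w y)\<^sup>2"]) auto
  have "(\<integral>\<^sup>+z. ennreal (indicator (\<Sigma> \<times> S) z * (w (snd z))\<^sup>2) \<partial>lebesgue) =
    (\<integral>\<^sup>+x. (\<integral>\<^sup>+y. ennreal (indicator (\<Sigma> \<times> S) (x, y) * (w y)\<^sup>2) \<partial>lebesgue) \<partial>lebesgue)"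
    using nn_integral_lebesgue_prod(1)[OF m2] by simp
  also have "\<dots> = (\<integral>\<^sup>+x. indicator \<Sigma> x * (\<integral>\<^sup>+y. ennreal (indicator S y * (w y)\<^sup>2) \<partial>lebesgue) \<partial>lebesgue)"
    by (intro nn_integral_cong) (auto simp: indicator_times split: split_indicator)
  also have "\<dots> = emeasure lebesgue \<Sigma> * (\<integral>\<^sup>+y. ennreal (indicator S y * (w y)\<^sup>2) \<partial>lebesgue)"
    using sets by (simp add: nn_integral_multc)
  also have "\<dots> < \<infinity>"
  proof -
    have "(\<integral>\<^sup>+y. ennreal (indicator S y * (w y)\<^sup>2) \<partial>lebesgue) = ennreal (LINT y|lebesgue. indicator S y * (w y)\<^sup>2)"
      by (rule nn_integral_eq_integral) (use W in auto)
    then show ?thesis using \<Sigma> by (auto simp: fmeasurable_def ennreal_mult_less_top)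
  qed
  finally have "integrable lebesgue (\<lambda>z. indicator (\<Sigma> \<times> S) z * (w (snd z))\<^sup>2)"
    using m2 by (intro integrableI_bounded) auto
  then show ?thesis unfolding l2_on_zero_extension[OF T] using m[of w] W by simp
qed

lemma l2_on_Times_section:
  fixes \<phi> :: "'c::euclidean_space \<times> 'b::euclidean_space \<Rightarrow> real"
  assumes \<Sigma>: "\<Sigma> \<in> lmeasurable" and S: "S \<in> lmeasurable" and \<phi>: "\<phi> \<in> l2_on (\<Sigma> \<times> S)"
  shows "AE y in lebesgue_on S. integrable (lebesgue_on \<Sigma>) (\<lambda>x. \<phi> (x, y))"
    "integrable (lebesgue_on S) (\<lambda>y. LINT x|lebesgue_on \<Sigma>. \<phi> (x, y))"
proof -
  have sets: "\<Sigma> \<in> sets lebesgue" "S \<in> sets lebesgue" using \<Sigma> S by auto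
  have "(\<lambda>_. 1 :: real) \<in> l2_on S"
    using finite_measure.integrable_const[OF finite_measure_lebesgue_on[OF S], of "1::real"] by (simp add: l2_on_def)
  from l2_on_mult_integrable[OF l2_on_snd[OF \<Sigma> sets(2) this] \<phi>]
  have "integrable (lebesgue_on (\<Sigma> \<times> S)) \<phi>" by simp
  note lebesgue_on_Times_section[OF sets this]
  then show "AE y in lebesgue_on S. integrable (lebesgue_on \<Sigma>) (\<lambda>x. \<phi> (x, y))"
    "integrable (lebesgue_on S) (\<lambda>y. LINT x|lebesgue_on \<Sigma>. \<phi> (x, y))" by blast+
qed

text \<open>A simple function with function values is a finite sum of terms, each an indicator in
  the first variable times a fixed measurable function of the second.\<close>

lemma borel_measurable_simple_function_joint:
  fixes r :: "'c::euclidean_space \<Rightarrow> 'b::euclidean_space \<Rightarrow> real"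
  assumes \<Sigma>: "\<Sigma> \<in> sets lebesgue" and S: "S \<in> sets lebesgue" and r: "simple_function (lebesgue_on \<Sigma>) r"
    and m: "\<And>x. x \<in> \<Sigma> \<Longrightarrow> r x \<in> borel_measurable (lebesgue_on S)"
  shows "(\<lambda>z. indicator (\<Sigma> \<times> S) z * r (fst z) (snd z)) \<in> borel_measurable lebesgue"
proof -
  have fin: "finite (r ` \<Sigma>)" using simple_functionD(1)[OF r] by simp
  have "indicator (\<Sigma> \<times> S) z * r (fst z) (snd z) =
      (\<Sum>c\<in>r ` \<Sigma>. indicator (r -` {c} \<inter> \<Sigma>) (fst z) * (indicator S (snd z) * c (snd z)))" for z
  proof (cases "fst z \<in> \<Sigma>")
    case True
    have "(\<Sum>c\<in>r ` \<Sigma>. indicator (r -` {c} \<inter> \<Sigma>) (fst z) * (indicator S (snd z) * c (snd z))) =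
      (\<Sum>c\<in>r ` \<Sigma>. if c = r (fst z) then indicator S (snd z) * c (snd z) else 0)"
      using True by (intro sum.cong) (auto simp: indicator_def)
    also have "\<dots> = indicator S (snd z) * r (fst z) (snd z)" using fin True by simp
    finally show ?thesis using True by (cases z) (simp add: indicator_times)
  qed (cases z, simp add: indicator_times)
  moreover have "(\<lambda>z::'c \<times> 'b. \<Sum>c\<in>r ` \<Sigma>. indicator (r -` {c} \<inter> \<Sigma>) (fst z) * (indicator S (snd z) * c (snd z))) \<in> borel_measurable lebesgue"
  proof (rule borel_measurable_sum)
    fix c assume "c \<in> r ` \<Sigma>"
    then have "(\<lambda>y. indicator S y * c y) \<in> borel_measurable lebesgue"
      using m by (auto simp: measurable_lebesgue_on[OF S])
    moreover have "r -` {c} \<inter> \<Sigma> \<in> sets lebesgue"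
      using simple_functionD(2)[OF r, of "{c}"] \<Sigma> by (simp add: sets_restrict_space_iff)
    ultimately show "(\<lambda>z::'c \<times> 'b. indicator (r -` {c} \<inter> \<Sigma>) (fst z) * (indicator S (snd z) * c (snd z))) \<in> borel_measurable lebesgue"
      by (intro borel_measurable_times[OF borel_measurable_lebesgue_fst[OF borel_measurable_indicator] borel_measurable_lebesgue_snd])
  qed
  ultimately show ?thesis by simp
qed

context two_pieces
begin

lemma H0_l2: "u \<in> elts H0 \<Longrightarrow> u \<in> l2_on S" by (simp add: H0_def h1_on_def)

text \<open>By Cauchy-Schwarz against the constant 1, the seminorm controls the L1 norm on the
  bounded set S; this makes limits in the space comparable with pointwise integrals.\<close>

lemma H0_l1:
  assumes one: "a = 1" "b = 1" and u: "u \<in> elts H0"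
  shows "(\<integral>\<^sup>+y. ennreal (indicator S y * \<bar>u y\<bar>) \<partial>lebesgue) \<le> ennreal (l2_norm S (\<lambda>_. 1) * nrm H0 u)"
proof -
  have l: "u \<in> l2_on S" by (rule H0_l2[OF u])
  have i: "integrable lebesgue (\<lambda>y. indicator S y * \<bar>u y\<bar>)"
    using integrable_abs[OF l2_on_integrable[OF l S_lmeasurable]] by (simp add: integrable_lebesgue_on[OF S_lebesgue])
  have "(\<integral>\<^sup>+y. ennreal (indicator S y * \<bar>u y\<bar>) \<partial>lebesgue) = ennreal (LINT y|lebesgue_on S. \<bar>u y\<bar>)"
    unfolding LINT_lebesgue_on[OF S_lebesgue] by (rule nn_integral_eq_integral[OF i]) simp
  also have "\<dots> \<le> ennreal (l2_norm S (\<lambda>_. 1) * nrm H0 u)"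
  proof (rule ennreal_leI)
    have "l2_norm S u \<le> nrm H0 u"
      using l2_norm_le_h1(1)[OF P.S_open H0_h1[OF u] h1_on_grad[OF H0_h1[OF u]]] unfolding H0_def fspace.sel unfolding one .
    moreover have "0 \<le> l2_norm S (\<lambda>_. 1)" by (simp add: l2_norm_def l2_inner_def)
    ultimately show "(LINT y|lebesgue_on S. \<bar>u y\<bar>) \<le> l2_norm S (\<lambda>_. 1) * nrm H0 u"
      using l1_le_l2[OF S_lmeasurable l] by (meson mult_left_mono order_trans)
  qed
  finally show ?thesis .
qed

text \<open>The simple approximations of \<open>\<phi>\<close> have integrals that converge in \<^term>\<open>H0\<close> by completeness
  and, by Tonelli, to the pointwise integral of \<open>\<phi>\<close> in \<open>L\<^sup>1\<close>.\<close>

lemma L2V_integral: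
  fixes \<Sigma> :: "'c::euclidean_space set"
  assumes one: "a = 1" "b = 1" and \<Sigma>: "\<Sigma> \<in> lmeasurable" and \<phi>: "\<phi> \<in> elts (L2V \<Sigma>)"
  shows "(\<lambda>y. LINT x|lebesgue_on \<Sigma>. \<phi> (x, y)) \<in> elts H0"
    "nrm H0 (\<lambda>y. LINT x|lebesgue_on \<Sigma>. \<phi> (x, y)) \<le> (LINT x|lebesgue_on \<Sigma>. nrm H0 (\<lambda>y. \<phi> (x, y)))"
proof -
  let ?M = "lebesgue_on \<Sigma>"
  have sets: "\<Sigma> \<in> sets lebesgue" using \<Sigma> by auto
  have C: "complete_measure ?M" by (rule complete_measure_lebesgue_on[OF sets])
  have F: "finite_measure ?M" by (rule finite_measure_lebesgue_on[OF \<Sigma>])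
  note \<phi>l = L2VD(1)[OF \<phi>] and \<phi>b = L2VD(2)[OF \<phi>]
  note \<phi>D = H0.bochner_l2D[OF C \<phi>b]
  note \<phi>i = H0.bochner_l2_integrable[OF C F \<phi>b]
  note sec = l2_on_Times_section[OF \<Sigma> S_lmeasurable \<phi>l]
  obtain s where s: "\<And>k. simple_function ?M (s k)" "\<And>k. s k ` space ?M \<subseteq> elts H0"
    and si: "\<And>k. integrable ?M (\<lambda>x. nrm H0 (\<lambda>y. s k x y - \<phi> (x, y)))"
    and slim: "(\<lambda>k. LINT x|?M. nrm H0 (\<lambda>y. s k x y - \<phi> (x, y))) \<longlonglongrightarrow> 0"
    using H0.bochner_l2_simple_approx[OF C F \<phi>b] by blast
  define e where "e k = (LINT x|?M. nrm H0 (\<lambda>y. s k x y - \<phi> (x, y)))" for k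
  define B where "B k y = (LINT x|?M. s k x y)" for k y
  define A where "A y = (LINT x|?M. \<phi> (x, y))" for y
  have elim0: "e \<longlonglongrightarrow> 0" using slim unfolding e_def[abs_def] .
  have sM: "s k x \<in> elts H0" if "x \<in> \<Sigma>" for k x using s(2)[of k] that by auto
  have B: "B k \<in> elts H0" "nrm H0 (B k) \<le> (LINT x|?M. nrm H0 (s k x))" for k
    unfolding B_def[abs_def] by (rule H0.simple_integral_bound[OF F s])+
  have isy: "integrable ?M (\<lambda>x. s k x y)" for k y
    using finite_measure.integral_simple_compose(1)[OF F s(1), of "\<lambda>c. c y"] by simp
  \<comment> \<open>The integral bound is available for simple functions, and the difference of two
    approximants is simple; the triangle inequality through \<phi> then gives a Cauchy
    sequence.\<close>
  have diff: "nrm H0 (\<lambda>y. B k y - B l y) \<le> e k + e l" for k l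
  proof -
    let ?r = "\<lambda>x y. s k x y - s l x y"
    have r: "simple_function ?M ?r" "?r ` space ?M \<subseteq> elts H0"
      using simple_function_compose2[OF s(1) s(1), of "\<lambda>u v x. u x - v x" k l] sM H0.diff_elts by auto
    have "nrm H0 (\<lambda>y. B k y - B l y) = nrm H0 (\<lambda>y. LINT x|?M. ?r x y)" by (simp add: B_def isy)
    also have "\<dots> \<le> (LINT x|?M. nrm H0 (?r x))" by (rule H0.simple_integral_bound[OF F r])
    also have "\<dots> \<le> (LINT x|?M. nrm H0 (\<lambda>y. s k x y - \<phi> (x, y)) + nrm H0 (\<lambda>y. s l x y - \<phi> (x, y)))"
    proof (rule integral_mono_AE)
      show "integrable ?M (\<lambda>x. nrm H0 (?r x))" by (rule finite_measure.integral_simple_compose(1)[OF F r(1)])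
      show "AE x in ?M. nrm H0 (?r x) \<le> nrm H0 (\<lambda>y. s k x y - \<phi> (x, y)) + nrm H0 (\<lambda>y. s l x y - \<phi> (x, y))"
        using \<phi>D(1) AE_space
      proof eventually_elim
        case (elim x)
        then have x: "x \<in> \<Sigma>" by simp
        show ?case using H0.nrm_triangle[OF sM[OF x] elim(1) sM[OF x], of k l]
            H0.nrm_minus_commute[OF elim(1) sM[OF x], of l] by simp
      qed
    qed (intro Bochner_Integration.integrable_add si)
    also have "\<dots> = e k + e l" unfolding e_def by (rule Bochner_Integration.integral_add[OF si si])
    finally show ?thesis .
  qed
  obtain u where u: "u \<in> elts H0" "(\<lambda>k. nrm H0 (\<lambda>y. B k y - u y)) \<longlonglongrightarrow> 0"
  proof (rule H0_complete[OF one B(1)])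
    fix \<delta> :: real assume "\<delta> > 0"
    then obtain N where N: "\<And>k. k \<ge> N \<Longrightarrow> norm (e k) < \<delta> / 2" using LIMSEQ_D[OF elim0, of "\<delta> / 2"] by auto
    have "nrm H0 (\<lambda>y. B m y - B n y) < \<delta>" if "m \<ge> N" "n \<ge> N" for m n
      using diff[of m n] N[OF that(1)] N[OF that(2)] by simp
    then show "\<exists>N. \<forall>m\<ge>N. \<forall>n\<ge>N. nrm H0 (\<lambda>y. B m y - B n y) < \<delta>" by blast
  qed
  define K where "K = l2_norm S (\<lambda>_. 1)"
  have K: "0 \<le> K" by (simp add: K_def l2_norm_def l2_inner_def)
  \<comment> \<open>Integrating first over x is natural for the pointwise integral \<open>A\<close>,
    integrating first over y produces the norm of a section; Tonelli exchanges the two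
    orders.\<close>
  have BA: "(\<integral>\<^sup>+y. ennreal (indicator S y * \<bar>B k y - A y\<bar>) \<partial>lebesgue) \<le> ennreal (K * e k)" for k
  proof -
    \<comment> \<open>The distance between approximant and \<phi>, extended by zero so that Tonelli
      applies to one jointly measurable function on the whole product.\<close>
    define g where "g z = \<bar>indicator (\<Sigma> \<times> S) z * s k (fst z) (snd z) - indicator (\<Sigma> \<times> S) z * \<phi> z\<bar>" for z
    have T: "\<Sigma> \<times> S \<in> sets lebesgue" by (rule Times_sets_lebesgue[OF sets S_lebesgue])
    have "s k x \<in> borel_measurable (lebesgue_on S)" if "x \<in> \<Sigma>" for x
      using H0_l2[OF sM[OF that]] by (simp add: l2_on_def)
    then have m1: "(\<lambda>z. indicator (\<Sigma> \<times> S) z * s k (fst z) (snd z)) \<in> borel_measurable lebesgue"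
      by (rule borel_measurable_simple_function_joint[OF sets S_lebesgue s(1)])
    have m2: "(\<lambda>z. indicator (\<Sigma> \<times> S) z * \<phi> z) \<in> borel_measurable lebesgue"
      using \<phi>l by (simp add: l2_on_zero_extension[OF T])
    have gm: "g \<in> borel_measurable lebesgue"
      unfolding g_def[abs_def] by (rule borel_measurable_abs[OF borel_measurable_diff[OF m1 m2]])
    have gxy: "g (x, y) = indicator \<Sigma> x * (indicator S y * \<bar>s k x y - \<phi> (x, y)\<bar>)" for x y
      by (simp add: g_def indicator_times flip: right_diff_distrib) (simp add: abs_mult mult.assoc)
    have "(\<integral>\<^sup>+y. ennreal (indicator S y * \<bar>B k y - A y\<bar>) \<partial>lebesgue) \<le>
      (\<integral>\<^sup>+y. (\<integral>\<^sup>+x. ennreal (g (x, y)) \<partial>lebesgue) \<partial>lebesgue)"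
    proof (rule nn_integral_mono_AE)
      show "AE y in lebesgue. ennreal (indicator S y * \<bar>B k y - A y\<bar>) \<le> (\<integral>\<^sup>+x. ennreal (g (x, y)) \<partial>lebesgue)"
        using sec(1) unfolding AE_lebesgue_on[OF S_lebesgue]
      proof eventually_elim
        case (elim y)
        show ?case
        proof (cases "y \<in> S")
          case True
          have iy: "integrable ?M (\<lambda>x. s k x y - \<phi> (x, y))"
            using isy elim True by (intro Bochner_Integration.integrable_diff) auto
          then have iy2: "integrable lebesgue (\<lambda>x. indicator \<Sigma> x * \<bar>s k x y - \<phi> (x, y)\<bar>)"
            using integrable_abs by (simp add: integrable_lebesgue_on[OF sets, symmetric])
          have "\<bar>B k y - A y\<bar> = \<bar>LINT x|?M. s k x y - \<phi> (x, y)\<bar>"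
            using isy elim True by (simp add: A_def B_def)
          also have "\<dots> \<le> (LINT x|?M. \<bar>s k x y - \<phi> (x, y)\<bar>)" by (rule integral_abs_bound)
          finally have "ennreal \<bar>B k y - A y\<bar> \<le> ennreal (LINT x|lebesgue. indicator \<Sigma> x * \<bar>s k x y - \<phi> (x, y)\<bar>)"
            unfolding LINT_lebesgue_on[OF sets] by (rule ennreal_leI)
          also have "\<dots> = (\<integral>\<^sup>+x. ennreal (g (x, y)) \<partial>lebesgue)"
            unfolding gxy using nn_integral_eq_integral[OF iy2] True by simp
          finally show ?thesis using True by simp
        qed simp
      qed
    qed
    also have "\<dots> = (\<integral>\<^sup>+x. (\<integral>\<^sup>+y. ennreal (g (x, y)) \<partial>lebesgue) \<partial>lebesgue)"
      unfolding nn_integral_lebesgue_prod(1)[OF gm] nn_integral_lebesgue_prod(2)[OF gm] ..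
    also have "\<dots> \<le> (\<integral>\<^sup>+x. ennreal (indicator \<Sigma> x * (K * nrm H0 (\<lambda>y. s k x y - \<phi> (x, y)))) \<partial>lebesgue)"
    proof (rule nn_integral_mono_AE)
      show "AE x in lebesgue. (\<integral>\<^sup>+y. ennreal (g (x, y)) \<partial>lebesgue) \<le> ennreal (indicator \<Sigma> x * (K * nrm H0 (\<lambda>y. s k x y - \<phi> (x, y))))"
        using \<phi>D(1) unfolding AE_lebesgue_on[OF sets]
      proof eventually_elim
        case (elim x)
        show ?case
        proof (cases "x \<in> \<Sigma>")
          case True
          then show ?thesis
            using H0_l1[OF one H0.diff_elts[OF sM[OF True] elim[rule_format, OF True]], of k] by (simp add: gxy K_def)
        qed (simp add: gxy)
      qed
    qed
    also have "\<dots> = ennreal (LINT x|lebesgue. indicator \<Sigma> x * (K * nrm H0 (\<lambda>y. s k x y - \<phi> (x, y))))"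
    proof (rule nn_integral_eq_integral)
      show "integrable lebesgue (\<lambda>x. indicator \<Sigma> x * (K * nrm H0 (\<lambda>y. s k x y - \<phi> (x, y))))"
        using integrable_mult_right[OF si, of K k] by (simp only: integrable_lebesgue_on[OF sets])
      show "AE x in lebesgue. 0 \<le> indicator \<Sigma> x * (K * nrm H0 (\<lambda>y. s k x y - \<phi> (x, y)))"
        using \<phi>D(1) unfolding AE_lebesgue_on[OF sets]
      proof eventually_elim
        case (elim x)
        show ?case
        proof (cases "x \<in> \<Sigma>")
          case True
          then show ?thesis
            using H0.nrm_nonneg[OF H0.diff_elts[OF sM[OF True] elim[rule_format, OF True]], of k] K by simp
        qed simp
      qed
    qed
    also have "(LINT x|lebesgue. indicator \<Sigma> x * (K * nrm H0 (\<lambda>y. s k x y - \<phi> (x, y)))) = K * e k"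
      unfolding LINT_lebesgue_on[OF sets, symmetric] e_def by simp
    finally show ?thesis .
  qed
  have Bu: "(\<integral>\<^sup>+y. ennreal (indicator S y * \<bar>B k y - u y\<bar>) \<partial>lebesgue) \<le> ennreal (K * nrm H0 (\<lambda>y. B k y - u y))" for k
    unfolding K_def by (rule H0_l1[OF one H0.diff_elts[OF B(1) u(1)]])
  have mA: "(\<lambda>y. indicator S y * A y) \<in> borel_measurable lebesgue"
    using sec(2) unfolding integrable_lebesgue_on[OF S_lebesgue] A_def by auto
  have mu: "(\<lambda>y. indicator S y * f y) \<in> borel_measurable lebesgue" if "f \<in> elts H0" for f
    using H0_l2[OF that] by (simp add: l2_on_zero_extension[OF S_lebesgue])
  have mabs: "(\<lambda>y. ennreal (indicator S y * \<bar>f y - h y\<bar>)) \<in> borel_measurable lebesgue"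
    if "(\<lambda>y. indicator S y * f y) \<in> borel_measurable lebesgue" "(\<lambda>y. indicator S y * h y) \<in> borel_measurable lebesgue" for f h
  proof -
    have "(\<lambda>y. ennreal \<bar>indicator S y * f y - indicator S y * h y\<bar>) \<in> borel_measurable lebesgue"
      by (intro measurable_compose[OF borel_measurable_abs[OF borel_measurable_diff[OF that]] measurable_ennreal])
    then show ?thesis by (simp add: abs_mult flip: right_diff_distrib)
  qed
  have D: "(\<integral>\<^sup>+y. ennreal (indicator S y * \<bar>A y - u y\<bar>) \<partial>lebesgue) \<le> ennreal (K * e k + K * nrm H0 (\<lambda>y. B k y - u y))" for k
  proof -
    have "(\<integral>\<^sup>+y. ennreal (indicator S y * \<bar>A y - u y\<bar>) \<partial>lebesgue) \<le>
      (\<integral>\<^sup>+y. ennreal (indicator S y * \<bar>B k y - A y\<bar>) + ennreal (indicator S y * \<bar>B k y - u y\<bar>) \<partial>lebesgue)"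
      by (intro nn_integral_mono) (auto simp: indicator_def simp flip: ennreal_plus intro!: ennreal_leI)
    also have "\<dots> = (\<integral>\<^sup>+y. ennreal (indicator S y * \<bar>B k y - A y\<bar>) \<partial>lebesgue) + (\<integral>\<^sup>+y. ennreal (indicator S y * \<bar>B k y - u y\<bar>) \<partial>lebesgue)"
      by (rule nn_integral_add[OF mabs[OF mu[OF B(1)] mA] mabs[OF mu[OF B(1)] mu[OF u(1)]]])
    also have "\<dots> \<le> ennreal (K * e k) + ennreal (K * nrm H0 (\<lambda>y. B k y - u y))" by (rule add_mono[OF BA Bu])
    also have "\<dots> = ennreal (K * e k + K * nrm H0 (\<lambda>y. B k y - u y))"
    proof (rule ennreal_plus[symmetric])
      have "0 \<le> e k" unfolding e_def
        by (rule integral_nonneg_AE) (use \<phi>D(1) AE_space in \<open>eventually_elim, auto intro!: H0.nrm_nonneg H0.diff_elts sM\<close>)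
      then show "0 \<le> K * e k" using K by simp
      show "0 \<le> K * nrm H0 (\<lambda>y. B k y - u y)" using K H0.nrm_nonneg[OF H0.diff_elts[OF B(1) u(1)]] by simp
    qed
    finally show ?thesis .
  qed
  have "(\<lambda>k. ennreal (K * e k + K * nrm H0 (\<lambda>y. B k y - u y))) \<longlonglongrightarrow> ennreal (K * 0 + K * 0)"
    by (intro tendsto_ennrealI tendsto_intros elim0 u(2))
  then have "(\<integral>\<^sup>+y. ennreal (indicator S y * \<bar>A y - u y\<bar>) \<partial>lebesgue) \<le> ennreal (K * 0 + K * 0)"
    by (rule LIMSEQ_le_const) (use D in blast)
  then have "(\<integral>\<^sup>+y. ennreal (indicator S y * \<bar>A y - u y\<bar>) \<partial>lebesgue) = 0" by simp
  then have "AE y in lebesgue. ennreal (indicator S y * \<bar>A y - u y\<bar>) = 0"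
    by (subst (asm) nn_integral_0_iff_AE[OF mabs[OF mA mu[OF u(1)]]])
  \<comment> \<open>The abstract limit u and the pointwise integral agree almost everywhere, so the
    latter is itself a representative in the space.\<close>
  then have ae: "AE y in lebesgue_on S. u y = A y"
    unfolding AE_lebesgue_on[OF S_lebesgue] by eventually_elim (auto simp: ennreal_eq_0_iff)
  note cong = H0_AE_cong[OF u(1) ae]
  show "(\<lambda>y. LINT x|?M. \<phi> (x, y)) \<in> elts H0" using cong(1) by (simp add: A_def[abs_def])
  \<comment> \<open>The integral bound holds for the approximants and is passed to the limit with
    the error terms written explicitly.\<close>
  have ub: "nrm H0 u \<le> (LINT x|?M. nrm H0 (\<lambda>y. \<phi> (x, y))) + (e k + nrm H0 (\<lambda>y. B k y - u y))" for k
  proof -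
    have "(LINT x|?M. nrm H0 (s k x)) \<le> (LINT x|?M. nrm H0 (\<lambda>y. \<phi> (x, y)) + nrm H0 (\<lambda>y. s k x y - \<phi> (x, y)))"
    proof (rule integral_mono_AE)
      show "integrable ?M (\<lambda>x. nrm H0 (s k x))" by (rule finite_measure.integral_simple_compose(1)[OF F s(1)])
      show "AE x in ?M. nrm H0 (s k x) \<le> nrm H0 (\<lambda>y. \<phi> (x, y)) + nrm H0 (\<lambda>y. s k x y - \<phi> (x, y))"
        using \<phi>D(1) AE_space
      proof eventually_elim
        case (elim x)
        then show ?case using H0.nrm_diff_abs[OF sM elim(1), of x k] by simp
      qed
    qed (intro Bochner_Integration.integrable_add si \<phi>i)
    also have "\<dots> = (LINT x|?M. nrm H0 (\<lambda>y. \<phi> (x, y))) + e k" unfolding e_def by (rule Bochner_Integration.integral_add[OF \<phi>i si])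
    finally show ?thesis using B(2)[of k] H0.nrm_diff_abs[OF B(1) u(1), of k] by simp
  qed
  have "(\<lambda>k. (LINT x|?M. nrm H0 (\<lambda>y. \<phi> (x, y))) + (e k + nrm H0 (\<lambda>y. B k y - u y))) \<longlonglongrightarrow> (LINT x|?M. nrm H0 (\<lambda>y. \<phi> (x, y))) + (0 + 0)"
    by (intro tendsto_intros elim0 u(2))
  then have "nrm H0 u \<le> (LINT x|?M. nrm H0 (\<lambda>y. \<phi> (x, y))) + (0 + 0)" by (rule LIMSEQ_le_const) (use ub in blast)
  then show "nrm H0 (\<lambda>y. LINT x|?M. \<phi> (x, y)) \<le> (LINT x|?M. nrm H0 (\<lambda>y. \<phi> (x, y)))"
    using cong(2) by (simp add: A_def[abs_def])
qed

end

subsection \<open>Rescaled copies of a set\<close>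

text \<open>The general affine change of variables scales every coordinate separately; here all the
  factors are c, which gives the Jacobian as a power of c.\<close>

lemma lebesgue_affine:
  fixes t :: "'v::euclidean_space"
  assumes c: "c > 0"
  shows "(\<lambda>x. c *\<^sub>R x + t) \<in> lebesgue \<rightarrow>\<^sub>M lebesgue"
    "lebesgue = density (distr lebesgue lebesgue (\<lambda>x. c *\<^sub>R x + t)) (\<lambda>_. ennreal (c ^ DIM('v)))"
proof -
  have eq: "t + (\<Sum>j\<in>Basis. (c * (x \<bullet> j)) *\<^sub>R j) = c *\<^sub>R x + t" for x :: 'v
  proof -
    have "(\<Sum>j\<in>Basis. (c * (x \<bullet> j)) *\<^sub>R j) = c *\<^sub>R (\<Sum>j\<in>Basis. (x \<bullet> j) *\<^sub>R j)" by (simp add: scaleR_sum_right)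
    then show ?thesis by (simp add: euclidean_representation)
  qed
  show "(\<lambda>x. c *\<^sub>R x + t) \<in> lebesgue \<rightarrow>\<^sub>M lebesgue"
    using lebesgue_affine_measurable[of "\<lambda>_. c" t] c by (simp add: eq)
  show "lebesgue = density (distr lebesgue lebesgue (\<lambda>x. c *\<^sub>R x + t)) (\<lambda>_. ennreal (c ^ DIM('v)))"
    using lebesgue_affine_euclidean[of "\<lambda>_. c" t] c by (simp add: eq)
qed

lemma AE_lebesgue_affine:
  fixes t :: "'v::euclidean_space"
  assumes c: "c > 0" and ae: "AE x in lebesgue. P x"
  shows "AE x in lebesgue. P (c *\<^sub>R x + t)"
proof -
  have "AE x in density (distr lebesgue lebesgue (\<lambda>x. c *\<^sub>R x + t)) (\<lambda>_. ennreal (c ^ DIM('v))). P x"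
    using ae by (subst (asm) lebesgue_affine(2)[OF c, of t])
  then have "AE x in distr lebesgue lebesgue (\<lambda>x. c *\<^sub>R x + t). P x" using c by (simp add: AE_density)
  then show ?thesis by (rule AE_distrD[OF lebesgue_affine(1)[OF c]])
qed

lemma integral_lebesgue_affine:
  fixes t :: "'v::euclidean_space" and f :: "'v \<Rightarrow> real"
  assumes c: "c > 0" and f: "f \<in> borel_measurable lebesgue"
  shows "(LINT x|lebesgue. f x) = c ^ DIM('v) * (LINT x|lebesgue. f (c *\<^sub>R x + t))"
    "integrable lebesgue f \<longleftrightarrow> integrable lebesgue (\<lambda>x. f (c *\<^sub>R x + t))"
proof -
  note T = lebesgue_affine(1)[OF c, of t]
  have "(LINT x|lebesgue. f x) = (LINT x|density (distr lebesgue lebesgue (\<lambda>x. c *\<^sub>R x + t)) (\<lambda>_. ennreal (c ^ DIM('v))). f x)"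
    using lebesgue_affine(2)[OF c, of t] by simp
  also have "\<dots> = c ^ DIM('v) * (LINT x|lebesgue. f (c *\<^sub>R x + t))"
    using c f T by (simp add: integral_density integral_distr)
  finally show "(LINT x|lebesgue. f x) = c ^ DIM('v) * (LINT x|lebesgue. f (c *\<^sub>R x + t))" .
  have "integrable lebesgue f \<longleftrightarrow> integrable (density (distr lebesgue lebesgue (\<lambda>x. c *\<^sub>R x + t)) (\<lambda>_. ennreal (c ^ DIM('v)))) f"
    using lebesgue_affine(2)[OF c, of t] by simp
  also have "\<dots> \<longleftrightarrow> integrable lebesgue (\<lambda>x. f (c *\<^sub>R x + t))"
    using c f T by (simp add: integrable_density integrable_distr_eq)
  finally show "integrable lebesgue f \<longleftrightarrow> integrable lebesgue (\<lambda>x. f (c *\<^sub>R x + t))" .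
qed

text \<open>Stated in an arbitrary Euclidean space because it is used for the perforated cells as
  well as, one dimension lower, for their faces and for the base cubes.\<close>

locale tiling =
  fixes \<epsilon> :: real and p :: "'k \<Rightarrow> 'v::euclidean_space" and I :: "'k set" and A :: "'v set"
  assumes \<epsilon>: "\<epsilon> > 0" and I: "finite I" and A: "A \<in> sets lebesgue"
    and disj: "\<And>j k. j \<in> I \<Longrightarrow> k \<in> I \<Longrightarrow> j \<noteq> k \<Longrightarrow> (\<lambda>y. \<epsilon> *\<^sub>R (y + p j)) ` A \<inter> (\<lambda>y. \<epsilon> *\<^sub>R (y + p k)) ` A = {}"
begin

definition tile :: "'k \<Rightarrow> 'v \<Rightarrow> 'v" where "tile k y = \<epsilon> *\<^sub>R (y + p k)"

text \<open>Written in the form \<open>c *\<^sub>R x + t\<close> so that the affine change of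
  variables applies to it directly.\<close>

definition untile :: "'k \<Rightarrow> 'v \<Rightarrow> 'v" where "untile k x = inverse \<epsilon> *\<^sub>R x + - p k"

definition tiles :: "'v set" where "tiles = (\<Union>k\<in>I. tile k ` A)"

lemma tile_affine: "tile k y = \<epsilon> *\<^sub>R y + \<epsilon> *\<^sub>R p k"
  by (simp add: tile_def scaleR_add_right)

lemma tile_untile [simp]: "tile k (untile k x) = x" "untile k (tile k y) = y"
  using \<epsilon> by (simp_all add: tile_def untile_def scaleR_add_right)

lemma tile_image: "tile k ` B = untile k -` B"
  by (auto intro!: image_eqI[of _ "tile k" "untile k _"])

lemma indicator_tile: "indicator (tile k ` A) x = (indicator A (untile k x) :: real)"
  unfolding tile_image by (simp add: indicator_def)

lemma tile_disj: "j \<in> I \<Longrightarrow> k \<in> I \<Longrightarrow> j \<noteq> k \<Longrightarrow> tile j ` A \<inter> tile k ` A = {}"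
  using disj unfolding tile_def by blast

lemma untile_measurable: "untile k \<in> lebesgue \<rightarrow>\<^sub>M lebesgue"
  unfolding untile_def[abs_def] by (rule lebesgue_affine) (use \<epsilon> in simp)

lemma tile_measurable: "tile k \<in> lebesgue \<rightarrow>\<^sub>M lebesgue"
  unfolding tile_affine[abs_def] by (rule lebesgue_affine[OF \<epsilon>])

lemma tile_sets: "tile k ` A \<in> sets lebesgue"
  using measurable_sets[OF untile_measurable A, of k] by (simp add: tile_image)

lemma tiles_sets: "tiles \<in> sets lebesgue"
  unfolding tiles_def using I tile_sets by (intro sets.finite_UN) auto

lemma indicator_tiles: "indicator tiles x = (\<Sum>k\<in>I. indicator A (untile k x) :: real)"
proof -
  have "indicator (\<Union>k\<in>I. tile k ` A) x = (\<Sum>k\<in>I. indicator (tile k ` A) x :: real)"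
    by (rule indicator_UN_disjoint[OF I]) (auto simp: disjoint_family_on_def tile_disj)
  then show ?thesis by (simp add: tiles_def indicator_tile)
qed

text \<open>Disjointness turns a function on the union into a finite sum of functions transported
  from the model set, so measurability and integrals reduce to one cell.\<close>

lemma indicator_tiles_mult:
  "indicator tiles x * (f x :: real) = (\<Sum>k\<in>I. indicator A (untile k x) * f (tile k (untile k x)))"
  by (simp add: indicator_tiles sum_distrib_right)

lemma measurable_tilesI:
  fixes f :: "'v \<Rightarrow> real"
  assumes "\<And>k. k \<in> I \<Longrightarrow> (\<lambda>y. f (tile k y)) \<in> borel_measurable (lebesgue_on A)"
  shows "f \<in> borel_measurable (lebesgue_on tiles)"
  unfolding measurable_lebesgue_on[OF tiles_sets] indicator_tiles_mult
proof (rule borel_measurable_sum)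
  fix k assume "k \<in> I"
  then have m: "(\<lambda>y. indicator A y * f (tile k y)) \<in> borel_measurable lebesgue"
    using assms by (simp add: measurable_lebesgue_on[OF A])
  show "(\<lambda>x. indicator A (untile k x) * f (tile k (untile k x))) \<in> borel_measurable lebesgue"
    by (rule measurable_compose[OF untile_measurable m])
qed

lemma measurable_tilesD:
  fixes f :: "'v \<Rightarrow> real"
  assumes f: "f \<in> borel_measurable (lebesgue_on tiles)" and k: "k \<in> I"
  shows "(\<lambda>y. f (tile k y)) \<in> borel_measurable (lebesgue_on A)"
proof -
  have m: "(\<lambda>x. indicator tiles x * f x) \<in> borel_measurable lebesgue"
    using f by (simp add: measurable_lebesgue_on[OF tiles_sets])
  have "(\<lambda>y. indicator A y * (indicator tiles (tile k y) * f (tile k y))) \<in> borel_measurable lebesgue"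
    by (rule borel_measurable_indicator_times[OF A measurable_compose[OF tile_measurable m]])
  moreover have "indicator A y * (indicator tiles (tile k y) * f (tile k y)) = indicator A y * f (tile k y)" for y
    using k by (auto simp: indicator_def tiles_def)
  ultimately show ?thesis by (simp add: measurable_lebesgue_on[OF A])
qed

lemma integrable_tilesI:
  fixes f :: "'v \<Rightarrow> real"
  assumes f: "\<And>k. k \<in> I \<Longrightarrow> integrable (lebesgue_on A) (\<lambda>y. f (tile k y))"
  shows "integrable (lebesgue_on tiles) f"
    "(LINT x|lebesgue_on tiles. f x) = (\<Sum>k\<in>I. \<epsilon> ^ DIM('v) * (LINT y|lebesgue_on A. f (tile k y)))"
proof -
  let ?g = "\<lambda>k x. indicator A (untile k x) * f (tile k (untile k x))"
  have g: "integrable lebesgue (?g k) \<and> (LINT x|lebesgue. ?g k x) = \<epsilon> ^ DIM('v) * (LINT y|lebesgue_on A. f (tile k y))"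
    if k: "k \<in> I" for k
  proof -
    have i: "integrable lebesgue (\<lambda>y. indicator A y * f (tile k y))" using f[OF k] by (simp add: integrable_lebesgue_on[OF A])
    then have m: "(\<lambda>y. indicator A y * f (tile k y)) \<in> borel_measurable lebesgue" by auto
    have gm: "?g k \<in> borel_measurable lebesgue" by (rule measurable_compose[OF untile_measurable m])
    have eq: "?g k (\<epsilon> *\<^sub>R x + \<epsilon> *\<^sub>R p k) = indicator A x * f (tile k x)" for x
      by (simp flip: tile_affine)
    show ?thesis
      using integral_lebesgue_affine[OF \<epsilon> gm, of "\<epsilon> *\<^sub>R p k"] i unfolding eq by (simp add: LINT_lebesgue_on[OF A])
  qed
  then show "integrable (lebesgue_on tiles) f"
    unfolding integrable_lebesgue_on[OF tiles_sets] indicator_tiles_mult by (intro Bochner_Integration.integrable_sum) auto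
  have "(LINT x|lebesgue_on tiles. f x) = (LINT x|lebesgue. (\<Sum>k\<in>I. ?g k x))"
    unfolding LINT_lebesgue_on[OF tiles_sets] indicator_tiles_mult ..
  also have "\<dots> = (\<Sum>k\<in>I. LINT x|lebesgue. ?g k x)" by (rule Bochner_Integration.integral_sum) (use g in blast)
  also have "\<dots> = (\<Sum>k\<in>I. \<epsilon> ^ DIM('v) * (LINT y|lebesgue_on A. f (tile k y)))" by (rule sum.cong) (use g in auto)
  finally show "(LINT x|lebesgue_on tiles. f x) = (\<Sum>k\<in>I. \<epsilon> ^ DIM('v) * (LINT y|lebesgue_on A. f (tile k y)))" .
qed

lemma integrable_tilesD:
  fixes f :: "'v \<Rightarrow> real"
  assumes f: "integrable (lebesgue_on tiles) f" and k: "k \<in> I"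
  shows "integrable (lebesgue_on A) (\<lambda>y. f (tile k y))"
proof -
  have i: "integrable lebesgue (\<lambda>x. indicator tiles x * f x)"
    using f by (simp add: integrable_lebesgue_on[OF tiles_sets])
  then have m: "(\<lambda>x. indicator tiles x * f x) \<in> borel_measurable lebesgue" by auto
  have "integrable lebesgue (\<lambda>y. indicator tiles (tile k y) * f (tile k y))"
    using integral_lebesgue_affine(2)[OF \<epsilon> m, of "\<epsilon> *\<^sub>R p k"] i by (simp flip: tile_affine)
  from integrable_mult_indicator[OF A this]
  have "integrable lebesgue (\<lambda>y. indicator A y * (indicator tiles (tile k y) * f (tile k y)))" by simp
  moreover have "indicator A y * (indicator tiles (tile k y) * f (tile k y)) = indicator A y * f (tile k y)" for y
    using k by (auto simp: indicator_def tiles_def)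
  ultimately show ?thesis by (simp add: integrable_lebesgue_on[OF A])
qed

lemma l2_on_tiles:
  "f \<in> l2_on tiles \<longleftrightarrow> (\<forall>k\<in>I. (\<lambda>y. f (tile k y)) \<in> l2_on A)"
proof
  assume f: "f \<in> l2_on tiles"
  then show "\<forall>k\<in>I. (\<lambda>y. f (tile k y)) \<in> l2_on A"
    using measurable_tilesD[of f] integrable_tilesD[of "\<lambda>x. (f x)\<^sup>2"] by (simp add: l2_on_def)
next
  assume f: "\<forall>k\<in>I. (\<lambda>y. f (tile k y)) \<in> l2_on A"
  have "f \<in> borel_measurable (lebesgue_on tiles)" by (rule measurable_tilesI) (use f in \<open>simp add: l2_on_def\<close>)
  moreover have "integrable (lebesgue_on tiles) (\<lambda>x. (f x)\<^sup>2)" by (rule integrable_tilesI(1)) (use f in \<open>simp add: l2_on_def\<close>)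
  ultimately show "f \<in> l2_on tiles" by (simp add: l2_on_def)
qed

lemma l2_inner_tiles:
  assumes "f \<in> l2_on tiles" "g \<in> l2_on tiles"
  shows "l2_inner tiles f g = (\<Sum>k\<in>I. \<epsilon> ^ DIM('v) * l2_inner A (\<lambda>y. f (tile k y)) (\<lambda>y. g (tile k y)))"
  unfolding l2_inner_def using assms by (intro integrable_tilesI(2) l2_on_mult_integrable) (auto simp: l2_on_tiles)

lemma l2_norm_tiles:
  assumes "f \<in> l2_on tiles"
  shows "(l2_norm tiles f)\<^sup>2 = (\<Sum>k\<in>I. \<epsilon> ^ DIM('v) * (l2_norm A (\<lambda>y. f (tile k y)))\<^sup>2)"
proof -
  have n: "(l2_norm S h)\<^sup>2 = l2_inner S h h" if "h \<in> l2_on S" for S and h :: "'v \<Rightarrow> real"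
    using l2.B_pos[OF that] by (simp add: l2_norm_def)
  show ?thesis unfolding n[OF assms] l2_inner_tiles[OF assms assms]
    using assms by (intro sum.cong) (auto simp: l2_on_tiles n)
qed

lemma AE_tilesI:
  assumes "\<And>k. k \<in> I \<Longrightarrow> AE y in lebesgue_on A. P (tile k y)"
  shows "AE x in lebesgue_on tiles. P x"
proof -
  have "AE x in lebesgue. \<forall>k\<in>I. untile k x \<in> A \<longrightarrow> P (tile k (untile k x))"
  proof (rule AE_finite_allI[OF I])
    fix k assume "k \<in> I"
    then have "AE y in lebesgue. y \<in> A \<longrightarrow> P (tile k y)" using assms by (simp add: AE_lebesgue_on[OF A])
    then show "AE x in lebesgue. untile k x \<in> A \<longrightarrow> P (tile k (untile k x))"
      unfolding untile_def by (rule AE_lebesgue_affine[rotated]) (use \<epsilon> in simp)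
  qed
  then show ?thesis unfolding AE_lebesgue_on[OF tiles_sets]
  proof eventually_elim
    case (elim x)
    show ?case
    proof
      assume "x \<in> tiles"
      then obtain k y where "k \<in> I" "y \<in> A" "x = tile k y" by (auto simp: tiles_def)
      then show "P x" using elim by (auto dest!: bspec[of I _ k])
    qed
  qed
qed

end

section \<open>Restricting test functions to one cell\<close>

text \<open>Cutting off by an indicator is harmless for a function vanishing near the frontier:
  around every point either the indicator is constant or the function is zero.\<close>

lemma indicator_mult_local:
  fixes f :: "'a::euclidean_space \<Rightarrow> real"
  assumes A: "open A" and W: "open W" "frontier A \<subseteq> W" and f0: "\<And>x. x \<in> W \<Longrightarrow> f x = 0"
  obtains V where "open V" "x \<in> V" "\<forall>y\<in>V. indicator A y * f y = indicator A x * f y"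
proof -
  consider "x \<in> A" | "x \<in> frontier A" | "x \<notin> closure A"
    using A by (auto simp: frontier_def interior_open)
  then show ?thesis
  proof cases
    case 1 then show ?thesis using that[of A] A by simp
  next
    case 2
    then show ?thesis using that[of W] W f0 by auto
  next
    case 3
    have "indicator A y = (0::real)" if "y \<in> - closure A" for y using that closure_subset by (auto simp: indicator_def)
    then show ?thesis using 3 closure_subset that[of "- closure A"] by (auto simp: indicator_def)
  qed
qed

lemma indicator_has_derivative:
  fixes f :: "'a::euclidean_space \<Rightarrow> real"
  assumes A: "open A" and W: "open W" "frontier A \<subseteq> W" and f0: "\<And>x. x \<in> W \<Longrightarrow> f x = 0"
    and f: "(f has_derivative D) (at x)"
  shows "((\<lambda>x. indicator A x * f x) has_derivative (\<lambda>h. indicator A x * D h)) (at x)"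
proof -
  obtain V where V: "open V" "x \<in> V" "\<forall>y\<in>V. indicator A y * f y = indicator A x * f y"
    by (rule indicator_mult_local[OF A W f0, where x=x])
  have "((\<lambda>y. indicator A x * f y) has_derivative (\<lambda>h. indicator A x * D h)) (at x)"
    using f by (auto intro!: derivative_eq_intros)
  then show ?thesis by (rule has_derivative_transform_within_open[OF _ V(1,2)]) (rule V(3)[rule_format, symmetric])
qed

lemma Ck_indicator:
  fixes f :: "'a::euclidean_space \<Rightarrow> real"
  assumes A: "open A" and W: "open W" "frontier A \<subseteq> W"
  shows "Ck k f \<Longrightarrow> (\<And>x. x \<in> W \<Longrightarrow> f x = 0) \<Longrightarrow> Ck k (\<lambda>x. indicator A x * f x)"
proof (induction k arbitrary: f)
  case 0
  have "isCont (\<lambda>x. indicator A x * f x) x" for x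
  proof -
    obtain V where V: "open V" "x \<in> V" "\<forall>y\<in>V. indicator A y * f y = indicator A x * f y"
      by (rule indicator_mult_local[OF A W 0(2), where x=x])
    have "\<forall>\<^sub>F y in nhds x. indicator A y * f y = indicator A x * f y"
      using V by (auto simp: eventually_nhds)
    then have "isCont (\<lambda>x. indicator A x * f x) x \<longleftrightarrow> isCont (\<lambda>y. indicator A x * f y) x" by (rule isCont_cong)
    moreover have "isCont (\<lambda>y. indicator A x * f y) x" using 0(1) by (auto simp: continuous_on_eq_continuous_at)
    ultimately show ?thesis by simp
  qed
  then show ?case by (simp add: continuous_on_eq_continuous_at)
next
  case (Suc k)
  show ?case
  proof (rule Ck_SucI[OF indicator_has_derivative[OF A W Suc.prems(2) Ck_SucD(1)[OF Suc.prems(1)]]])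
    fix b :: 'a assume b: "b \<in> Basis"
    show "Ck k (\<lambda>x. indicator A x * frechet_derivative f (at x) b)"
    proof (rule Suc.IH[OF Ck_SucD(2)[OF Suc.prems(1) b]])
      fix x assume x: "x \<in> W"
      have "((\<lambda>x. 0) has_derivative (\<lambda>h. 0)) (at x)" by simp
      then have "(f has_derivative (\<lambda>h. 0)) (at x)"
        by (rule has_derivative_transform_within_open[OF _ W(1) x]) (use Suc.prems(2) in simp)
      then show "frechet_derivative f (at x) b = 0" using frechet_derivative_at[of f "\<lambda>h. 0" x] by metis
    qed
  qed
qed

text \<open>The support of \<psi> is a compact subset of L, while the image of the frontier of A
  avoids L. The rescaled \<psi> therefore vanishes near that frontier and its restriction to A keeps
  a compact support inside A.\<close>

lemma test_functions_pullback:
  fixes A L :: "'a::euclidean_space set"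
  assumes \<psi>: "\<psi> \<in> test_functions L" and A: "open A" and c: "c > 0"
    and bd: "\<And>y. y \<in> frontier A \<Longrightarrow> c *\<^sub>R y + t \<notin> L"
  shows "(\<lambda>y. indicator A y * \<psi> (c *\<^sub>R y + t)) \<in> test_functions A"
    "frechet_derivative (\<lambda>y. indicator A y * \<psi> (c *\<^sub>R y + t)) (at y) b = indicator A y * (c * frechet_derivative \<psi> (at (c *\<^sub>R y + t)) b)"
proof -
  have ck: "Ck k \<psi>" for k using \<psi> by (simp add: test_functions_def)
  define K where "K = closure {x. \<psi> x \<noteq> 0}"
  have K: "compact K" "K \<subseteq> L" "{x. \<psi> x \<noteq> 0} \<subseteq> K" using \<psi> closure_subset[of "{x. \<psi> x \<noteq> 0}"] by (auto simp only: test_functions_def K_def)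
  \<comment> \<open>The preimage of the support under the scaling, written as an image under the
    inverse so that it is visibly compact.\<close>
  define K' where "K' = (\<lambda>x. inverse c *\<^sub>R x + - (inverse c *\<^sub>R t)) ` K"
  have K': "compact K'" unfolding K'_def using K(1) by (intro compact_continuous_image continuous_intros)
  have K'_iff: "y \<in> K' \<longleftrightarrow> c *\<^sub>R y + t \<in> K" for y
  proof
    assume "y \<in> K'" then show "c *\<^sub>R y + t \<in> K" using c by (auto simp: K'_def scaleR_diff_right)
  next
    assume "c *\<^sub>R y + t \<in> K"
    then show "y \<in> K'" unfolding K'_def using c by (auto intro!: image_eqI[of _ _ "c *\<^sub>R y + t"] simp: scaleR_add_right scaleR_diff_right)
  qed
  have W: "open (- K')" "frontier A \<subseteq> - K'" using compact_imp_closed[OF K'] bd K(2) by (auto simp: K'_iff)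
  have f0: "\<psi> (c *\<^sub>R y + t) = 0" if "y \<in> - K'" for y using that K(3) by (auto simp: K'_iff)
  let ?f = "\<lambda>y. indicator A y * \<psi> (c *\<^sub>R y + t)"
  have "Ck k ?f" for k by (rule Ck_indicator[OF A W Ck_affine[OF ck] f0])
  moreover have sub: "closure {x. ?f x \<noteq> 0} \<subseteq> closure A \<inter> K'"
  proof (rule closure_minimal)
    show "{x. ?f x \<noteq> 0} \<subseteq> closure A \<inter> K'" using f0 closure_subset[of A] by (auto simp: indicator_def split: if_splits)
    show "closed (closure A \<inter> K')" using compact_imp_closed[OF K'] by (intro closed_Int) auto
  qed
  moreover have "closure A \<inter> K' \<subseteq> A" using W(2) A by (auto simp: frontier_def interior_open)
  moreover have "compact (closure {x. ?f x \<noteq> 0})"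
  proof -
    have "K' \<inter> closure {x. ?f x \<noteq> 0} = closure {x. ?f x \<noteq> 0}" using sub by blast
    then show ?thesis using compact_Int_closed[OF K' closed_closure, of "{x. ?f x \<noteq> 0}"] by (simp only:)
  qed
  ultimately show "?f \<in> test_functions A" by (auto simp: test_functions_def)
  have d: "((\<lambda>x. \<psi> (c *\<^sub>R x + t)) has_derivative (\<lambda>h. frechet_derivative \<psi> (at (c *\<^sub>R y + t)) (c *\<^sub>R h))) (at y)"
    by (rule has_derivative_compose[OF _ Ck_SucD(1)[OF ck]]) (auto intro!: derivative_eq_intros)
  have lin: "frechet_derivative \<psi> (at z) (c *\<^sub>R h) = c * frechet_derivative \<psi> (at z) h" for z h
    using linear_scale[OF has_derivative_linear[OF Ck_SucD(1)[OF ck]]] by simp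
  have "frechet_derivative ?f (at y) = (\<lambda>h. indicator A y * (c * frechet_derivative \<psi> (at (c *\<^sub>R y + t)) h))"
    using frechet_derivative_at[OF indicator_has_derivative[OF A W f0 d]] unfolding lin by simp
  then show "frechet_derivative ?f (at y) b = indicator A y * (c * frechet_derivative \<psi> (at (c *\<^sub>R y + t)) b)" by simp
qed

subsection \<open>The perforated layer\<close>

lemma unit_cube_box: "unit_cube = box 0 (1 :: real ^ 'd::finite)"
  by (auto simp: unit_cube_def mem_box_cart)

lemma open_full_cell: "open (full_cell :: 'd::finite pt set)"
  unfolding full_cell_def unit_cube_box by (intro open_Times open_box open_greaterThanLessThan)

text \<open>The last claim is where the positive distance enters. A point of the closure over a base
  point outside the open cube would lie both on the lateral boundary of \<open>full_cell\<close> and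
  on the boundary of \<open>Zs\<close> off the two faces, making that distance zero.\<close>

lemma reference_cellD:
  fixes Zs :: "'d::finite pt set"
  assumes ref: "reference_cell Zs"
  shows "open Zs" "bounded Zs" "Zs \<subseteq> full_cell" "closure Zs \<subseteq> unit_cube \<times> UNIV"
proof -
  show Z: "open Zs" "bounded Zs" "Zs \<subseteq> full_cell" using ref by (auto simp: reference_cell_def lipschitz_domain_def)
  have cl: "closure Zs \<subseteq> cbox 0 1 \<times> {-1..1}"
  proof (rule closure_minimal)
    show "Zs \<subseteq> cbox 0 1 \<times> {-1..1}"
      using Z(3) box_subset_cbox[of 0 "1 :: real ^ 'd"] by (auto simp: full_cell_def unit_cube_box)
  qed (intro closed_Times closed_cbox closed_atLeastAtMost)
  have face: "interior (cell_face Zs c) \<subseteq> unit_cube" for c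
  proof -
    have "cell_face Zs c \<subseteq> cbox 0 1" using cl frontier_subset_closed[of "closure Zs"]
      by (auto simp: cell_face_def frontier_def)
    then have "interior (cell_face Zs c) \<subseteq> interior (cbox 0 1)" by (rule interior_mono)
    then show ?thesis by (simp add: unit_cube_box)
  qed
  let ?L = "frontier full_cell - (unit_cube \<times> {1} \<union> unit_cube \<times> {-1}) :: 'd pt set"
  show "closure Zs \<subseteq> unit_cube \<times> UNIV"
  proof (rule ccontr)
    assume "\<not> ?thesis"
    then obtain y c where yc: "(y, c) \<in> closure Zs" "y \<notin> unit_cube" by auto
    have o: "open (full_cell :: 'd pt set)" by (rule open_full_cell)
    have "(y, c) \<in> closure full_cell" using yc(1) closure_mono[OF Z(3)] by blast
    moreover have nf: "(y, c) \<notin> full_cell" using yc(2) by (simp add: full_cell_def)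
    ultimately have "(y, c) \<in> ?L" using yc(2) o by (simp add: frontier_def interior_open)
    moreover have "(y, c) \<in> frontier Zs - (interface Zs 1 \<union> interface Zs (-1))"
      using yc nf Z(1,3) face by (auto simp: frontier_def interior_open interface_def)
    ultimately have "setdist (frontier Zs - (interface Zs 1 \<union> interface Zs (-1))) ?L = 0"
      by (rule setdist_eq_0I[rotated])
    then show False using ref by (simp add: reference_cell_def)
  qed
qed

lemma interface_slice: "{x. (x, c) \<in> interface Zs c} = interior (cell_face Zs c)"
  by (auto simp: interface_def)

lemma flat_piece_interface:
  assumes ref: "reference_cell Zs"
  shows "flat_piece Zs (interface Zs c) c"
proof
  show "open Zs" "bounded Zs" using reference_cellD[OF ref] by auto
  show "{x. (x, c) \<in> interface Zs c} \<in> sets lebesgue" unfolding interface_slice by simp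
  fix x assume "(x, c) \<in> interface Zs c"
  then have "x \<in> cell_face Zs c" using interior_subset by (auto simp: interface_def)
  then show "(x, c) \<in> closure Zs" by (simp add: cell_face_def frontier_def)
qed

locale perforated =
  fixes \<Sigma> :: "(real ^ 'd::finite) set" and Zs :: "'d pt set" and \<epsilon> :: real
  assumes eps: "\<epsilon> > 0" and \<Sigma>_open: "open \<Sigma>" and \<Sigma>_bounded: "bounded \<Sigma>" and ref: "reference_cell Zs"
begin

abbreviation "II \<equiv> cell_indices \<Sigma> \<epsilon> :: (int ^ 'd) set"

text \<open>The index of the cell above a base point. It recovers k from any point of the closed
  cell with index k, which is how disjointness of the closed cells is expressed.\<close>

definition \<kappa> :: "real ^ 'd \<Rightarrow> int ^ 'd" where "\<kappa> x = (\<chi> i. \<lfloor>x $ i / \<epsilon>\<rfloor>)"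

lemmas Zs = reference_cellD[OF ref]

lemma \<kappa>_eq: assumes "y \<in> unit_cube" shows "\<kappa> (\<epsilon> *\<^sub>R (y + of_ints k)) = k"
proof -
  have "\<lfloor>y $ i + of_int (k $ i)\<rfloor> = k $ i" for i
    using assms by (intro floor_unique) (auto simp: unit_cube_def less_imp_le)
  then show ?thesis using eps by (simp add: \<kappa>_def of_ints_def vec_eq_iff)
qed

lemma int_part_\<kappa>: "int_part (x /\<^sub>R \<epsilon>) = of_ints (\<kappa> x)"
  by (simp add: int_part_def of_ints_def \<kappa>_def vec_eq_iff field_simps)

lemma base_cell_subset: assumes "k \<in> II" "y \<in> unit_cube" shows "\<epsilon> *\<^sub>R (y + of_ints k) \<in> \<Sigma>"
proof -
  have "scaled_shift \<epsilon> k (y, 0) \<in> \<Sigma> \<times> {-\<epsilon><..<\<epsilon>}"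
    using assms by (auto simp: cell_indices_def full_cell_def)
  then show ?thesis by (simp add: scaled_shift_def)
qed

lemma finite_II: "finite II"
proof -
  obtain B where B: "\<And>x. x \<in> \<Sigma> \<Longrightarrow> norm x \<le> B" using \<Sigma>_bounded by (auto simp: bounded_iff)
  \<comment> \<open>The centre of the unit cube: the centres of all admissible base cells lie in the
    bounded set \<Sigma>, which bounds their indices.\<close>
  define h :: "real ^ 'd" where "h = (\<chi> i. 1 / 2)"
  have h: "h \<in> unit_cube" by (simp add: h_def unit_cube_def)
  define N where "N = \<lceil>B / \<epsilon> + 1\<rceil>"
  have "k $ i \<in> {-N..N}" if k: "k \<in> II" for k i
  proof -
    have "\<bar>(\<epsilon> *\<^sub>R (h + of_ints k)) $ i\<bar> \<le> B"
      using B[OF base_cell_subset[OF k h]] component_le_norm_cart order_trans by blast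
    then have "\<epsilon> * \<bar>1 / 2 + of_int (k $ i)\<bar> \<le> B" using eps by (simp add: h_def of_ints_def abs_mult)
    then have "\<bar>1 / 2 + real_of_int (k $ i)\<bar> \<le> B / \<epsilon>" using eps by (simp add: field_simps)
    \<comment> \<open>The summand 1 more than absorbs the coordinate 1/2 of the centre.\<close>
    then have "\<bar>real_of_int (k $ i)\<bar> \<le> B / \<epsilon> + 1" by linarith
    also have "\<dots> \<le> of_int N" unfolding N_def by linarith
    finally have "\<bar>k $ i\<bar> \<le> N" by linarith
    then show ?thesis by auto
  qed
  then have "II \<subseteq> vec_lambda ` (PiE UNIV (\<lambda>_. {-N..N}))"
    by (intro subsetI image_eqI[where x="vec_nth _"]) auto
  moreover have "finite (PiE (UNIV :: 'd set) (\<lambda>_. {-N..N}))" by (rule finite_PiE) auto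
  ultimately show ?thesis by (meson finite_imageI finite_subset)
qed

lemma \<kappa>_shift: "y \<in> closure Zs \<Longrightarrow> \<kappa> (fst (\<epsilon> *\<^sub>R (y + (of_ints k, 0)))) = k"
  using Zs(4) by (cases y) (auto simp: \<kappa>_eq)

lemma Zs_closure: "y \<in> Zs \<Longrightarrow> y \<in> closure Zs"
  using closure_subset by blast

sublocale L: tiling \<epsilon> "\<lambda>k. (of_ints k, 0)" II Zs
proof
  show "Zs \<in> sets lebesgue" using Zs(1) by simp
  fix j k :: "int ^ 'd" assume "j \<noteq> k"
  show "(\<lambda>y. \<epsilon> *\<^sub>R (y + (of_ints j, 0))) ` Zs \<inter> (\<lambda>y. \<epsilon> *\<^sub>R (y + (of_ints k, 0))) ` Zs = {}"
  proof (rule equals0I)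
    fix x assume "x \<in> (\<lambda>y. \<epsilon> *\<^sub>R (y + (of_ints j, 0))) ` Zs \<inter> (\<lambda>y. \<epsilon> *\<^sub>R (y + (of_ints k, 0))) ` Zs"
    then obtain y z where y: "y \<in> Zs" "x = \<epsilon> *\<^sub>R (y + (of_ints j, 0))" and z: "z \<in> Zs" "x = \<epsilon> *\<^sub>R (z + (of_ints k, 0))"
      by blast
    have "j = k"
      using \<kappa>_shift[OF Zs_closure[OF y(1)], of j, folded y(2)] \<kappa>_shift[OF Zs_closure[OF z(1)], of k, folded z(2)] by simp
    then show False using \<open>j \<noteq> k\<close> by simp
  qed
qed (rule eps, rule finite_II)

lemma tile_shift: "L.tile = scaled_shift \<epsilon>"
  by (simp add: L.tile_def scaled_shift_def fun_eq_iff)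

lemma tiles_layer: "L.tiles = layer \<Sigma> Zs \<epsilon>"
  by (simp add: L.tiles_def layer_def tile_shift)

lemma \<kappa>_tile: "y \<in> closure Zs \<Longrightarrow> \<kappa> (fst (L.tile k y)) = k"
  unfolding L.tile_def by (rule \<kappa>_shift)

text \<open>A boundary point of a closed cell belongs to no other cell because its index is
  determined, and not to its own because \<open>Zs\<close> is open. This is the frontier condition
  of \<open>test_functions_pullback\<close>.\<close>

lemma tile_boundary: assumes "y \<in> frontier Zs" shows "L.tile k y \<notin> layer \<Sigma> Zs \<epsilon>"
proof
  have y: "y \<in> closure Zs" "y \<notin> Zs" using assms Zs(1) by (auto simp: frontier_def interior_open)
  assume "L.tile k y \<in> layer \<Sigma> Zs \<epsilon>"
  then obtain j z where z: "z \<in> Zs" "L.tile k y = L.tile j z" by (auto simp: L.tiles_def simp flip: tiles_layer)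
  then have "k = j" using \<kappa>_tile[OF y(1), of k] \<kappa>_tile[OF Zs_closure[OF z(1)], of j] by simp
  then have "y = z" using z(2) by (metis L.tile_untile(2))
  then show False using z(1) y(2) by simp
qed

lemma tile_homeo: "continuous_on T (L.tile k)" "continuous_on T (L.untile k)"
  unfolding L.tile_def L.untile_def by (intro continuous_intros)+

lemma tile_open: assumes "open T" shows "open (L.tile k ` T)"
  unfolding L.tile_image by (rule open_vimage[OF assms tile_homeo(2)])

lemma tile_closed: assumes "closed T" shows "closed (L.tile k ` T)"
  unfolding L.tile_image by (rule closed_vimage[OF assms tile_homeo(2)])

lemma layer_open: "open (layer \<Sigma> Zs \<epsilon>)"
  unfolding tiles_layer[symmetric] L.tiles_def by (intro open_UN ballI tile_open Zs(1))

lemma closure_layer: "closure (layer \<Sigma> Zs \<epsilon>) = (\<Union>k\<in>II. L.tile k ` closure Zs)"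
proof
  show "closure (layer \<Sigma> Zs \<epsilon>) \<subseteq> (\<Union>k\<in>II. L.tile k ` closure Zs)"
  proof (rule closure_minimal)
    show "layer \<Sigma> Zs \<epsilon> \<subseteq> (\<Union>k\<in>II. L.tile k ` closure Zs)"
      unfolding tiles_layer[symmetric] L.tiles_def using closure_subset[of Zs] by blast
    show "closed (\<Union>k\<in>II. L.tile k ` closure Zs)"
      by (intro closed_UN finite_II ballI tile_closed closed_closure)
  qed
  show "(\<Union>k\<in>II. L.tile k ` closure Zs) \<subseteq> closure (layer \<Sigma> Zs \<epsilon>)"
  proof (rule UN_least)
    fix k assume k: "k \<in> II"
    have "L.tile k ` closure Zs \<subseteq> closure (L.tile k ` Zs)"
      by (rule image_closure_subset[OF tile_homeo(1)]) (auto intro: closure_subset[THEN subsetD])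
    also have "\<dots> \<subseteq> closure (layer \<Sigma> Zs \<epsilon>)"
      unfolding tiles_layer[symmetric] L.tiles_def using k by (intro closure_mono) blast
    finally show "L.tile k ` closure Zs \<subseteq> closure (layer \<Sigma> Zs \<epsilon>)" .
  qed
qed

lemma layer_bounded: "bounded (layer \<Sigma> Zs \<epsilon>)"
proof (rule bounded_subset)
  show "bounded (\<Union>k\<in>II. L.tile k ` closure Zs)"
  proof (rule bounded_UN[OF finite_II], rule ballI)
    fix k show "bounded (L.tile k ` closure Zs)"
      using Zs(2) by (intro compact_imp_bounded compact_continuous_image tile_homeo) simp
  qed
  show "layer \<Sigma> Zs \<epsilon> \<subseteq> (\<Union>k\<in>II. L.tile k ` closure Zs)"
    using closure_subset[of "layer \<Sigma> Zs \<epsilon>"] by (simp add: closure_layer)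
qed

section \<open>Gluing functions given cell by cell\<close>

text \<open>Defined through the index map, the glued function is total and needs no choice. Only its
  values on the closed cells matter.\<close>

definition glue :: "(int ^ 'd \<Rightarrow> 'd pt \<Rightarrow> 'r) \<Rightarrow> 'd pt \<Rightarrow> 'r" where
  "glue a x = a (\<kappa> (fst x)) (L.untile (\<kappa> (fst x)) x)"

lemma glue_tile: "y \<in> closure Zs \<Longrightarrow> glue a (L.tile k y) = a k y"
  by (simp add: glue_def \<kappa>_tile)

lemma glue_tile': "y \<in> Zs \<Longrightarrow> glue a (L.tile k y) = a k y"
  by (rule glue_tile[OF Zs_closure])

lemma glue_l2: "glue a \<in> l2_on (layer \<Sigma> Zs \<epsilon>) \<longleftrightarrow> (\<forall>k\<in>II. a k \<in> l2_on Zs)"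
  unfolding tiles_layer[symmetric] L.l2_on_tiles
  using l2_on_cong[of Zs "\<lambda>y. glue a (L.tile _ y)" "a _"] by (simp add: glue_tile')

lemma glue_l2_norm:
  assumes "\<And>k. k \<in> II \<Longrightarrow> a k \<in> l2_on Zs"
  shows "(l2_norm (layer \<Sigma> Zs \<epsilon>) (glue a))\<^sup>2 = (\<Sum>k\<in>II. \<epsilon> ^ DIM('d pt) * (l2_norm Zs (a k))\<^sup>2)"
proof -
  have "glue a \<in> l2_on L.tiles" using assms by (simp add: tiles_layer glue_l2)
  from L.l2_norm_tiles[OF this] show ?thesis
    using l2_norm_cong[of Zs "\<lambda>y. glue a (L.tile _ y)" "a _"] by (simp add: tiles_layer glue_tile')
qed

text \<open>The factor \<open>inverse \<epsilon>\<close> is the chain rule for the rescaling of a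
  cell.\<close>

definition glue_grad :: "(int ^ 'd \<Rightarrow> 'd pt \<Rightarrow> real) \<Rightarrow> 'd pt \<Rightarrow> 'd pt" where
  "glue_grad a = glue (\<lambda>k y. inverse \<epsilon> *\<^sub>R grad Zs (a k) y)"

lemma glue_grad_comp: "(\<lambda>x. glue_grad a x \<bullet> c) = glue (\<lambda>k y. inverse \<epsilon> * (grad Zs (a k) y \<bullet> c))"
  by (simp add: glue_grad_def glue_def fun_eq_iff)

text \<open>A test function of the layer restricts on every cell to a test function of that cell, so
  integration by parts holds cell by cell and no interface terms arise.\<close>

lemma glue_weak_gradient:
  assumes a: "\<And>k. k \<in> II \<Longrightarrow> a k \<in> h1_on Zs"
  shows "weak_gradient (layer \<Sigma> Zs \<epsilon>) (glue a) (glue_grad a)"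
proof (rule weak_gradientI)
  fix b :: "'d pt" assume b: "b \<in> Basis"
  have ZM: "Zs \<in> sets lebesgue" using Zs(1) by simp
  have LM: "layer \<Sigma> Zs \<epsilon> \<in> sets lebesgue" using layer_open by simp
  have gk: "(\<lambda>y. inverse \<epsilon> * (grad Zs (a k) y \<bullet> b)) \<in> l2_on Zs" if "k \<in> II" for k
    using L2.scale_elts[of "\<lambda>y. grad Zs (a k) y \<bullet> b" Zs "inverse \<epsilon>"] weak_gradient_l2[OF h1_on_grad[OF a[OF that]] b] by simp
  show gl: "(\<lambda>x. glue_grad a x \<bullet> b) \<in> l2_on (layer \<Sigma> Zs \<epsilon>)"
    unfolding glue_grad_comp glue_l2 using gk by blast
  have al: "glue a \<in> l2_on (layer \<Sigma> Zs \<epsilon>)" unfolding glue_l2 using a h1_on_l2 by blast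
  fix \<psi> assume \<psi>: "\<psi> \<in> test_functions (layer \<Sigma> Zs \<epsilon>)"
  note tl = test_functions_l2[OF LM \<psi>] and dl = test_functions_l2[OF LM test_functions_deriv[OF \<psi> b]]
  have cell: "l2_inner Zs (\<lambda>y. glue a (L.tile k y)) (\<lambda>y. frechet_derivative \<psi> (at (L.tile k y)) b) =
      - l2_inner Zs (\<lambda>y. glue_grad a (L.tile k y) \<bullet> b) (\<lambda>y. \<psi> (L.tile k y))" if k: "k \<in> II" for k
  proof -
    let ?\<psi> = "\<lambda>y. indicator Zs y * \<psi> (L.tile k y)"
    note pb = test_functions_pullback[OF \<psi> Zs(1) eps tile_boundary[unfolded L.tile_affine], folded L.tile_affine]
    note ak = a[OF k]
    have gb: "(\<lambda>y. grad Zs (a k) y \<bullet> b) \<in> l2_on Zs" by (rule weak_gradient_l2[OF h1_on_grad[OF ak] b])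
    have "l2_inner Zs (\<lambda>y. glue a (L.tile k y)) (\<lambda>y. frechet_derivative \<psi> (at (L.tile k y)) b) =
      l2_inner Zs (\<lambda>y. inverse \<epsilon> * a k y) (\<lambda>y. frechet_derivative ?\<psi> (at y) b)"
      using eps by (intro l2_inner_cong) (simp add: pb(2) glue_tile')
    also have "\<dots> = inverse \<epsilon> * l2_inner Zs (a k) (\<lambda>y. frechet_derivative ?\<psi> (at y) b)"
      by (simp add: l2_inner_def mult.assoc)
    also have "\<dots> = inverse \<epsilon> * (- l2_inner Zs (\<lambda>y. grad Zs (a k) y \<bullet> b) ?\<psi>)"
      by (simp only: weak_gradient_ibp[OF h1_on_grad[OF ak] b pb(1)])
    also have "\<dots> = - l2_inner Zs (\<lambda>y. inverse \<epsilon> * (grad Zs (a k) y \<bullet> b)) ?\<psi>"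
      by (simp add: l2_inner_def mult.assoc)
    also have "l2_inner Zs (\<lambda>y. inverse \<epsilon> * (grad Zs (a k) y \<bullet> b)) ?\<psi> =
      l2_inner Zs (\<lambda>y. glue_grad a (L.tile k y) \<bullet> b) (\<lambda>y. \<psi> (L.tile k y))"
      by (rule l2_inner_cong) (simp add: glue_grad_def glue_tile')
    finally show ?thesis .
  qed
  show "l2_inner (layer \<Sigma> Zs \<epsilon>) (glue a) (\<lambda>x. frechet_derivative \<psi> (at x) b) =
      - l2_inner (layer \<Sigma> Zs \<epsilon>) (\<lambda>x. glue_grad a x \<bullet> b) \<psi>"
    using L.l2_inner_tiles[unfolded tiles_layer, OF al dl] L.l2_inner_tiles[unfolded tiles_layer, OF gl tl]
    by (simp add: cell sum_negf)
qed

lemma glue_h1: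
  assumes a: "\<And>k. k \<in> II \<Longrightarrow> a k \<in> h1_on Zs"
  shows "glue a \<in> h1_on (layer \<Sigma> Zs \<epsilon>)"
  by (rule h1_onI[OF _ glue_weak_gradient[OF a]]) (use a h1_on_l2 in \<open>auto simp: glue_l2\<close>)

text \<open>The change of variables contributes \<epsilon> to the full dimension in both terms, and
  the chain rule a further \<open>(inverse \<epsilon>)\<^sup>2\<close> in the gradient term.\<close>

lemma glue_h1_norm:
  assumes a: "\<And>k. k \<in> II \<Longrightarrow> a k \<in> h1_on Zs" and \<alpha>: "0 \<le> \<alpha>" and \<beta>: "0 \<le> \<beta>"
  shows "(h1_norm \<alpha> \<beta> (layer \<Sigma> Zs \<epsilon>) (glue a))\<^sup>2 =
    (\<Sum>k\<in>II. \<epsilon> ^ DIM('d pt) * (h1_norm \<alpha> (\<beta> * (inverse \<epsilon>)\<^sup>2) Zs (a k))\<^sup>2)"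
proof -
  have gl: "(\<lambda>y. grad Zs (a k) y \<bullet> b) \<in> l2_on Zs" if "k \<in> II" "b \<in> Basis" for k b
    by (rule weak_gradient_l2[OF h1_on_grad[OF a[OF that(1)]] that(2)])
  have sc: "(\<lambda>y. inverse \<epsilon> * (grad Zs (a k) y \<bullet> b)) \<in> l2_on Zs"
    "(l2_norm Zs (\<lambda>y. inverse \<epsilon> * (grad Zs (a k) y \<bullet> b)))\<^sup>2 = (inverse \<epsilon>)\<^sup>2 * (l2_norm Zs (\<lambda>y. grad Zs (a k) y \<bullet> b))\<^sup>2"
    if "k \<in> II" "b \<in> Basis" for k b
    using L2.scale_elts[of "\<lambda>y. grad Zs (a k) y \<bullet> b" Zs "inverse \<epsilon>"]
      L2.nrm_scale[of "\<lambda>y. grad Zs (a k) y \<bullet> b" Zs "inverse \<epsilon>"] gl[OF that] by (simp_all add: power_mult_distrib abs_of_pos[OF eps])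
  have "(h1_norm \<alpha> \<beta> (layer \<Sigma> Zs \<epsilon>) (glue a))\<^sup>2 =
     \<alpha> * (\<Sum>k\<in>II. \<epsilon> ^ DIM('d pt) * (l2_norm Zs (a k))\<^sup>2) +
     \<beta> * (\<Sum>b\<in>Basis. \<Sum>k\<in>II. \<epsilon> ^ DIM('d pt) * (l2_norm Zs (\<lambda>y. inverse \<epsilon> * (grad Zs (a k) y \<bullet> b)))\<^sup>2)"
  proof -
    have g: "glue a \<in> h1_on (layer \<Sigma> Zs \<epsilon>)" "weak_gradient (layer \<Sigma> Zs \<epsilon>) (glue a) (glue_grad a)"
      by (intro glue_h1 glue_weak_gradient a; assumption)+
    have n0: "(l2_norm (layer \<Sigma> Zs \<epsilon>) (glue a))\<^sup>2 = (\<Sum>k\<in>II. \<epsilon> ^ DIM('d pt) * (l2_norm Zs (a k))\<^sup>2)"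
      by (intro glue_l2_norm h1_on_l2 a)
    have n1: "(l2_norm (layer \<Sigma> Zs \<epsilon>) (\<lambda>x. glue_grad a x \<bullet> b))\<^sup>2 =
       (\<Sum>k\<in>II. \<epsilon> ^ DIM('d pt) * (l2_norm Zs (\<lambda>y. inverse \<epsilon> * (grad Zs (a k) y \<bullet> b)))\<^sup>2)" if "b \<in> Basis" for b
      unfolding glue_grad_comp using that by (intro glue_l2_norm sc(1))
    have n2: "(\<Sum>b\<in>Basis. (l2_norm (layer \<Sigma> Zs \<epsilon>) (\<lambda>x. glue_grad a x \<bullet> b))\<^sup>2) =
       (\<Sum>b\<in>Basis. \<Sum>k\<in>II. \<epsilon> ^ DIM('d pt) * (l2_norm Zs (\<lambda>y. inverse \<epsilon> * (grad Zs (a k) y \<bullet> b)))\<^sup>2)"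
      by (rule sum.cong[OF refl]) (rule n1)
    show ?thesis unfolding h1_norm_power2[OF layer_open g \<alpha> \<beta>] n0 n2 ..
  qed
  also have "\<dots> = \<alpha> * (\<Sum>k\<in>II. \<epsilon> ^ DIM('d pt) * (l2_norm Zs (a k))\<^sup>2) +
     \<beta> * (\<Sum>b\<in>Basis. \<Sum>k\<in>II. \<epsilon> ^ DIM('d pt) * ((inverse \<epsilon>)\<^sup>2 * (l2_norm Zs (\<lambda>y. grad Zs (a k) y \<bullet> b))\<^sup>2))"
    by (rule arg_cong[of _ _ "\<lambda>x. _ + \<beta> * x"], intro sum.cong refl, simp only: sc(2))
  also have "\<dots> = (\<Sum>k\<in>II. \<epsilon> ^ DIM('d pt) * (\<alpha> * (l2_norm Zs (a k))\<^sup>2 +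
      (\<beta> * (inverse \<epsilon>)\<^sup>2) * (\<Sum>b\<in>Basis. (l2_norm Zs (\<lambda>y. grad Zs (a k) y \<bullet> b))\<^sup>2)))"
    by (subst sum.swap) (simp add: sum_distrib_left sum.distrib algebra_simps)
  also have "\<dots> = (\<Sum>k\<in>II. \<epsilon> ^ DIM('d pt) * (h1_norm \<alpha> (\<beta> * (inverse \<epsilon>)\<^sup>2) Zs (a k))\<^sup>2)"
    using a \<alpha> \<beta> by (intro sum.cong) (simp_all add: h1_norm_power2[OF Zs(1) a h1_on_grad[OF a]])
  finally show ?thesis .
qed

end

text \<open>Traces in the layer are measured with unit weights, which rescaling turns into the
  weights 1 and \<open>(inverse \<epsilon>)\<^sup>2\<close> on a cell. For convergence to zero, this
  crude comparison with unit weights suffices.\<close>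

lemma h1_norm_weight_le:
  assumes S: "open S" and u: "u \<in> h1_on S" and \<beta>: "0 \<le> \<beta>"
  shows "(h1_norm 1 \<beta> S u)\<^sup>2 \<le> (1 + \<beta>) * (h1_norm 1 1 S u)\<^sup>2"
proof -
  let ?g = "\<Sum>c\<in>Basis. (l2_norm S (\<lambda>x. grad S u x \<bullet> c))\<^sup>2"
  have "0 \<le> ?g" by (simp add: sum_nonneg)
  then show ?thesis
    unfolding h1_norm_power2[OF S u h1_on_grad[OF u] zero_le_one \<beta>] h1_norm_power2[OF S u h1_on_grad[OF u] zero_le_one zero_le_one]
    using \<beta> by (simp add: algebra_simps)
qed

lemma h1_norm_weight_scale:
  assumes S: "open S" and u: "u \<in> h1_on S" and \<beta>: "0 \<le> \<beta>"
  shows "(h1_norm \<beta> \<beta> S u)\<^sup>2 = \<beta> * (h1_norm 1 1 S u)\<^sup>2"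
  unfolding h1_norm_power2[OF S u h1_on_grad[OF u] \<beta> \<beta>] h1_norm_power2[OF S u h1_on_grad[OF u] zero_le_one zero_le_one]
  by (simp add: algebra_simps)

context perforated
begin

lemma face_cube: "interior (cell_face Zs c) \<subseteq> unit_cube"
  using interior_subset[of "cell_face Zs c"] Zs(4) by (auto simp: cell_face_def frontier_def)

lemma face_closure: "y \<in> interior (cell_face Zs c) \<Longrightarrow> (y, c) \<in> closure Zs"
  using interior_subset[of "cell_face Zs c"] by (auto simp: cell_face_def frontier_def)

text \<open>Subsets of the open cube and any finite index set are allowed so that the faces, the
  cube itself and a single base cell are all instances.\<close>

lemma tiling_cube:
  fixes B :: "(real ^ 'd) set"
  assumes B: "B \<in> sets lebesgue" "B \<subseteq> unit_cube" and K: "finite K"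
  shows "tiling \<epsilon> of_ints K B"
proof
  fix j k :: "int ^ 'd" assume "j \<noteq> k"
  show "(\<lambda>y. \<epsilon> *\<^sub>R (y + of_ints j)) ` B \<inter> (\<lambda>y. \<epsilon> *\<^sub>R (y + of_ints k)) ` B = {}"
  proof (rule equals0I)
    fix x assume "x \<in> (\<lambda>y. \<epsilon> *\<^sub>R (y + of_ints j)) ` B \<inter> (\<lambda>y. \<epsilon> *\<^sub>R (y + of_ints k)) ` B"
    then obtain y z where y: "y \<in> unit_cube" "x = \<epsilon> *\<^sub>R (y + of_ints j)" and z: "z \<in> unit_cube" "x = \<epsilon> *\<^sub>R (z + of_ints k)"
      using B(2) by blast
    have "j = k" using \<kappa>_eq[OF y(1), of j, folded y(2)] \<kappa>_eq[OF z(1), of k, folded z(2)] by simp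
    then show False using \<open>j \<noteq> k\<close> by simp
  qed
qed (use eps B K in auto)

sublocale F: tiling \<epsilon> of_ints II "interior (cell_face Zs c)" for c
  by (rule tiling_cube[OF _ face_cube finite_II]) simp

lemma tile_Pair: "L.tile k (y, c) = (F.tile k y, \<epsilon> * c)"
  by (simp add: L.tile_def F.tile_def)

lemma layer_interface_slice: "{x. (x, \<epsilon> * c) \<in> layer_interface \<Sigma> Zs \<epsilon> c} = F.tiles c"
proof -
  have "scaled_shift \<epsilon> k ` interface Zs c = (\<lambda>y. (F.tile k y, \<epsilon> * c)) ` interior (cell_face Zs c)" for k
    by (auto simp: interface_def F.tile_def scaled_shift_def image_iff)
  then show ?thesis unfolding layer_interface_def F.tiles_def by auto
qed

text \<open>The height is kept as \<open>\<epsilon> * c\<close> so that c = 1 and c = -1 give both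
  interfaces.\<close>

lemma flat_piece_layer: "flat_piece (layer \<Sigma> Zs \<epsilon>) (layer_interface \<Sigma> Zs \<epsilon> c) (\<epsilon> * c)"
proof
  show "open (layer \<Sigma> Zs \<epsilon>)" "bounded (layer \<Sigma> Zs \<epsilon>)" by (rule layer_open, rule layer_bounded)
  show "{x. (x, \<epsilon> * c) \<in> layer_interface \<Sigma> Zs \<epsilon> c} \<in> sets lebesgue"
    unfolding layer_interface_slice by (rule F.tiles_sets)
  fix x assume "(x, \<epsilon> * c) \<in> layer_interface \<Sigma> Zs \<epsilon> c"
  then have "x \<in> F.tiles c" using layer_interface_slice by blast
  then obtain k y where k: "k \<in> II" "y \<in> interior (cell_face Zs c)" "x = F.tile k y" by (auto simp: F.tiles_def)
  then have "(x, \<epsilon> * c) = L.tile k (y, c)" by (simp add: tile_Pair)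
  then show "(x, \<epsilon> * c) \<in> closure (layer \<Sigma> Zs \<epsilon>)"
    unfolding closure_layer using k face_closure by blast
qed

sublocale Z: two_pieces Zs "interface Zs 1" 1 "interface Zs (-1)" "-1" 1 1
  by (intro two_pieces.intro two_pieces_axioms.intro flat_piece_interface ref) auto

sublocale Lay: two_pieces "layer \<Sigma> Zs \<epsilon>" "layer_interface \<Sigma> Zs \<epsilon> 1" \<epsilon> "layer_interface \<Sigma> Zs \<epsilon> (-1)" "-\<epsilon>" "1 / \<epsilon>" \<epsilon>
  using flat_piece_layer[of 1] flat_piece_layer[of "-1"] eps
  by (intro two_pieces.intro two_pieces_axioms.intro) auto

lemma H_cell_eq: "H_cell Zs = Z.H0"
  by (simp add: H_cell_def Z.H0_def)

lemma L2_H_cell_eq: "L2_H_cell \<Sigma> Zs = Z.L2V \<Sigma>"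
  by (simp add: L2_H_cell_def Z.L2V_def H_cell_eq)

lemma H_layer_eq: "H_layer \<Sigma> Zs \<epsilon> = Lay.H0"
  by (simp add: H_layer_def Lay.H0_def)

text \<open>The approximating sequences of the cells are glued. Finitely many disjoint closed cells
  keep the result continuous up to the boundary, and both squared errors are finite sums over the
  cells, so they tend to zero.\<close>

lemma glue_trace:
  assumes a: "\<And>k. k \<in> II \<Longrightarrow> a k \<in> h1_on Zs"
    and tr: "\<And>k. k \<in> II \<Longrightarrow> has_flat_trace Zs (interface Zs c) c (a k) (\<lambda>_. 0)"
  shows "has_flat_trace (layer \<Sigma> Zs \<epsilon>) (layer_interface \<Sigma> Zs \<epsilon> c) (\<epsilon> * c) (glue a) (\<lambda>_. 0)"
proof -
  interpret P: flat_piece Zs "interface Zs c" c by (rule flat_piece_interface[OF ref])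
  interpret G: flat_piece "layer \<Sigma> Zs \<epsilon>" "layer_interface \<Sigma> Zs \<epsilon> c" "\<epsilon> * c" by (rule flat_piece_layer)
  let ?F = "interior (cell_face Zs c)"
  have "\<exists>u. (\<forall>j. u j \<in> h1_on Zs) \<and> (\<forall>j. continuous_on (closure Zs) (u j)) \<and>
     (\<lambda>j. h1_norm 1 1 Zs (\<lambda>x. u j x - a k x)) \<longlonglongrightarrow> 0 \<and> (\<lambda>j. l2_norm ?F (\<lambda>x. u j (x, c))) \<longlonglongrightarrow> 0" if k: "k \<in> II" for k
  proof -
    obtain u where "\<And>j. u j \<in> h1_on Zs" "\<And>j. continuous_on (closure Zs) (u j)"
      "(\<lambda>j. h1_norm 1 1 Zs (\<lambda>x. u j x - a k x)) \<longlonglongrightarrow> 0" "(\<lambda>j. l2_norm {x. (x, c) \<in> interface Zs c} (\<lambda>x. u j (x, c))) \<longlonglongrightarrow> 0"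
      using P.trace0E[OF tr[OF k]] by blast
    then show ?thesis unfolding interface_slice by blast
  qed
  then have "\<exists>u. \<forall>k\<in>II. (\<forall>j. u k j \<in> h1_on Zs) \<and> (\<forall>j. continuous_on (closure Zs) (u k j)) \<and>
     (\<lambda>j. h1_norm 1 1 Zs (\<lambda>x. u k j x - a k x)) \<longlonglongrightarrow> 0 \<and> (\<lambda>j. l2_norm ?F (\<lambda>x. u k j (x, c))) \<longlonglongrightarrow> 0"
    by (intro bchoice ballI)
  then obtain u where u: "\<And>k j. k \<in> II \<Longrightarrow> u k j \<in> h1_on Zs" "\<And>k j. k \<in> II \<Longrightarrow> continuous_on (closure Zs) (u k j)"
    "\<And>k. k \<in> II \<Longrightarrow> (\<lambda>j. h1_norm 1 1 Zs (\<lambda>x. u k j x - a k x)) \<longlonglongrightarrow> 0"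
    "\<And>k. k \<in> II \<Longrightarrow> (\<lambda>j. l2_norm ?F (\<lambda>x. u k j (x, c))) \<longlonglongrightarrow> 0" by blast
  define w where "w j = glue (\<lambda>k. u k j)" for j
  have wc: "continuous_on (closure (layer \<Sigma> Zs \<epsilon>)) (w j)" for j
    unfolding closure_layer
  proof (rule continuous_on_closed_Union[OF finite_II])
    fix k assume k: "k \<in> II"
    show "closed (L.tile k ` closure Zs)" by (intro tile_closed closed_closure)
    have "continuous_on (L.tile k ` closure Zs) (\<lambda>x. u k j (L.untile k x))"
      by (rule continuous_on_compose2[OF u(2)[OF k] tile_homeo(2)]) auto
    \<comment> \<open>On the whole closed cell, boundary included, gluing returns the function with
      index k.\<close>
    then show "continuous_on (L.tile k ` closure Zs) (w j)"
      by (rule continuous_on_cong[THEN iffD2, rotated -1]) (auto simp: w_def glue_tile)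
  qed
  have dk: "(\<lambda>y. u k j y - a k y) \<in> h1_on Zs" if "k \<in> II" for k j
    using Z.P.h1.diff_elts[of "u k j" "a k"] u(1)[OF that] a[OF that] by simp
  show ?thesis
  proof (rule G.trace0I[of w])
    show wh: "w j \<in> h1_on (layer \<Sigma> Zs \<epsilon>)" for j unfolding w_def by (intro glue_h1 u)
    show "continuous_on (closure (layer \<Sigma> Zs \<epsilon>)) (w j)" for j by (rule wc)
    have dg: "(\<lambda>x. w j x - glue a x) = glue (\<lambda>k y. u k j y - a k y)" for j
      by (simp add: w_def glue_def fun_eq_iff)
    let ?b = "1 * (inverse \<epsilon>)\<^sup>2"
    have "(\<lambda>j. \<Sum>k\<in>II. \<epsilon> ^ DIM('d pt) * ((1 + ?b) * (h1_norm 1 1 Zs (\<lambda>y. u k j y - a k y))\<^sup>2)) \<longlonglongrightarrow>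
      (\<Sum>k\<in>II. \<epsilon> ^ DIM('d pt) * ((1 + ?b) * 0\<^sup>2))"
      by (intro tendsto_intros u)
    then have lim: "(\<lambda>j. \<Sum>k\<in>II. \<epsilon> ^ DIM('d pt) * ((1 + ?b) * (h1_norm 1 1 Zs (\<lambda>y. u k j y - a k y))\<^sup>2)) \<longlonglongrightarrow> 0" by simp
    have "(\<lambda>j. (h1_norm 1 1 (layer \<Sigma> Zs \<epsilon>) (\<lambda>x. w j x - glue a x))\<^sup>2) \<longlonglongrightarrow> 0"
    proof (rule Lim_null_comparison[OF always_eventually lim], rule allI)
      fix j
      have "(h1_norm 1 1 (layer \<Sigma> Zs \<epsilon>) (\<lambda>x. w j x - glue a x))\<^sup>2 =
        (\<Sum>k\<in>II. \<epsilon> ^ DIM('d pt) * (h1_norm 1 ?b Zs (\<lambda>y. u k j y - a k y))\<^sup>2)"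
        unfolding dg by (rule glue_h1_norm[OF dk]) auto
      also have "\<dots> \<le> (\<Sum>k\<in>II. \<epsilon> ^ DIM('d pt) * ((1 + ?b) * (h1_norm 1 1 Zs (\<lambda>y. u k j y - a k y))\<^sup>2))"
        by (intro sum_mono mult_left_mono h1_norm_weight_le[OF Zs(1) dk]) (use eps in auto)
      finally show "norm ((h1_norm 1 1 (layer \<Sigma> Zs \<epsilon>) (\<lambda>x. w j x - glue a x))\<^sup>2)
        \<le> (\<Sum>k\<in>II. \<epsilon> ^ DIM('d pt) * ((1 + ?b) * (h1_norm 1 1 Zs (\<lambda>y. u k j y - a k y))\<^sup>2))" by simp
    qed
    from tendsto_real_sqrt[OF this] show "(\<lambda>j. h1_norm 1 1 (layer \<Sigma> Zs \<epsilon>) (\<lambda>x. w j x - glue a x)) \<longlonglongrightarrow> 0"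
      by (simp add: tendsto_rabs_zero_iff)
    have "(\<lambda>j. \<Sum>k\<in>II. \<epsilon> ^ DIM(real ^ 'd) * (l2_norm ?F (\<lambda>x. u k j (x, c)))\<^sup>2) \<longlonglongrightarrow> (\<Sum>k\<in>II. \<epsilon> ^ DIM(real ^ 'd) * 0\<^sup>2)"
      by (intro tendsto_intros u)
    moreover have "(l2_norm (F.tiles c) (\<lambda>x. w j (x, \<epsilon> * c)))\<^sup>2 = (\<Sum>k\<in>II. \<epsilon> ^ DIM(real ^ 'd) * (l2_norm ?F (\<lambda>x. u k j (x, c)))\<^sup>2)" for j
    proof -
      have l: "(\<lambda>x. w j (x, \<epsilon> * c)) \<in> l2_on (F.tiles c)" using G.slice_l2[OF wc] unfolding layer_interface_slice .
      have "l2_norm ?F (\<lambda>y. w j (F.tile k y, \<epsilon> * c)) = l2_norm ?F (\<lambda>x. u k j (x, c))" for k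
        by (rule l2_norm_cong) (simp add: w_def glue_tile face_closure flip: tile_Pair)
      then show ?thesis unfolding F.l2_norm_tiles[OF l] by simp
    qed
    ultimately have "(\<lambda>j. (l2_norm (F.tiles c) (\<lambda>x. w j (x, \<epsilon> * c)))\<^sup>2) \<longlonglongrightarrow> 0" by simp
    from tendsto_real_sqrt[OF this]
    show "(\<lambda>j. l2_norm {x. (x, \<epsilon> * c) \<in> layer_interface \<Sigma> Zs \<epsilon> c} (\<lambda>x. w j (x, \<epsilon> * c))) \<longlonglongrightarrow> 0"
      unfolding layer_interface_slice by (simp add: tendsto_rabs_zero_iff)
  qed
qed

text \<open>The layer weights are balanced: \<epsilon> times
  \<open>(inverse \<epsilon>)\<^sup>2\<close> equals \<open>1 / \<epsilon>\<close>, so both terms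
  acquire one common weight, and together with the Jacobian it leaves
  \<open>\<epsilon> ^ CARD('d)\<close>, the volume of a base cell.\<close>

lemma glue_H:
  assumes a: "\<And>k. k \<in> II \<Longrightarrow> a k \<in> elts Z.H0"
  shows "glue a \<in> elts Lay.H0" "(nrm Lay.H0 (glue a))\<^sup>2 = (\<Sum>k\<in>II. \<epsilon> ^ CARD('d) * (nrm Z.H0 (a k))\<^sup>2)"
proof -
  have h: "a k \<in> h1_on Zs" if "k \<in> II" for k using a[OF that] by (rule Z.H0_h1)
  have g: "glue a \<in> h1_on (layer \<Sigma> Zs \<epsilon>)" by (rule glue_h1) (rule h)
  show "glue a \<in> elts Lay.H0"
    using g glue_trace[of a, OF h, where c=1] glue_trace[of a, OF h, where c="-1"] a by (auto simp: Lay.H0_def Z.H0_def)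
  have e: "\<epsilon> * (inverse \<epsilon>)\<^sup>2 = 1 / \<epsilon>" using eps by (simp add: power2_eq_square field_simps)
  have "(nrm Lay.H0 (glue a))\<^sup>2 = (\<Sum>k\<in>II. \<epsilon> ^ DIM('d pt) * (h1_norm (1 / \<epsilon>) (1 / \<epsilon>) Zs (a k))\<^sup>2)"
    unfolding Lay.H0_def fspace.sel using glue_h1_norm[of a, OF h, where \<alpha>="1 / \<epsilon>" and \<beta>=\<epsilon>] eps unfolding e by simp
  also have "\<dots> = (\<Sum>k\<in>II. \<epsilon> ^ CARD('d) * (nrm Z.H0 (a k))\<^sup>2)"
  proof (rule sum.cong[OF refl])
    fix k assume k: "k \<in> II"
    have "\<epsilon> ^ DIM('d pt) * ((1 / \<epsilon>) * (h1_norm 1 1 Zs (a k))\<^sup>2) = \<epsilon> ^ CARD('d) * (h1_norm 1 1 Zs (a k))\<^sup>2"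
      using eps by simp
    then show "\<epsilon> ^ DIM('d pt) * (h1_norm (1 / \<epsilon>) (1 / \<epsilon>) Zs (a k))\<^sup>2 = \<epsilon> ^ CARD('d) * (nrm Z.H0 (a k))\<^sup>2"
      using h1_norm_weight_scale[OF Zs(1) h[OF k], of "1 / \<epsilon>"] eps by (simp add: Z.H0_def)
  qed
  finally show "(nrm Lay.H0 (glue a))\<^sup>2 = (\<Sum>k\<in>II. \<epsilon> ^ CARD('d) * (nrm Z.H0 (a k))\<^sup>2)" .
qed

end

subsection \<open>The averaging operator\<close>

lemma measure_unit_cube: "measure lebesgue (unit_cube :: (real ^ 'd::finite) set) = 1" "(unit_cube :: (real ^ 'd) set) \<in> lmeasurable"
proof -
  have "measure lborel (box 0 (1 :: real ^ 'd)) = (\<Prod>b\<in>Basis. (1 - 0 :: real ^ 'd) \<bullet> b)"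
    by (subst measure_lborel_box) (auto simp: Basis_vec_def inner_axis)
  also have "\<dots> = 1" by (intro prod.neutral) (auto simp: Basis_vec_def inner_axis)
  finally show "measure lebesgue (unit_cube :: (real ^ 'd) set) = 1" by (simp add: unit_cube_box)
  show "(unit_cube :: (real ^ 'd) set) \<in> lmeasurable" by (simp add: unit_cube_box)
qed

context perforated
begin

lemma unit_cube_sets: "unit_cube \<in> sets (lebesgue :: (real ^ 'd) measure)"
  by (simp add: unit_cube_box)

definition base_cell :: "int ^ 'd \<Rightarrow> (real ^ 'd) set" where
  "base_cell k = (\<lambda>z. \<epsilon> *\<^sub>R (z + of_ints k)) ` unit_cube"

sublocale Q: tiling \<epsilon> of_ints II unit_cube
  by (rule tiling_cube[OF unit_cube_sets subset_refl finite_II])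

lemma Q_tile: "Q.tile k ` unit_cube = base_cell k"
  by (auto simp: Q.tile_def base_cell_def)

lemma base_cell_sets: "base_cell k \<in> sets lebesgue"
  using Q.tile_sets[of k] by (simp add: Q_tile)

lemma base_cell_\<Sigma>: "k \<in> II \<Longrightarrow> base_cell k \<subseteq> \<Sigma>"
  using base_cell_subset by (auto simp: base_cell_def)

text \<open>Valid for every f: if one side is not integrable then neither is the other, and both
  take the default value 0. This lets \<open>averaging_op_tile\<close> be stated without conditions
  on \<phi>.\<close>

lemma base_cell_integral:
  "(LINT x|lebesgue_on (base_cell k). f x) = \<epsilon> ^ CARD('d) * (LINT z|lebesgue_on unit_cube. f (\<epsilon> *\<^sub>R (z + of_ints k)))"
proof -
  interpret T: tiling \<epsilon> of_ints "{k}" unit_cube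
    by (rule tiling_cube[OF unit_cube_sets subset_refl]) simp
  have t: "T.tiles = base_cell k" "T.tile k = (\<lambda>z. \<epsilon> *\<^sub>R (z + of_ints k))"
    by (auto simp: T.tiles_def T.tile_def base_cell_def)
  show ?thesis
  proof (cases "integrable (lebesgue_on unit_cube) (\<lambda>z. f (\<epsilon> *\<^sub>R (z + of_ints k)))")
    case True
    then show ?thesis using T.integrable_tilesI(2)[of f] by (simp add: t)
  next
    case False
    then have "\<not> integrable (lebesgue_on (base_cell k)) f" using T.integrable_tilesD[of f k] by (auto simp: t)
    then show ?thesis using False by (simp add: not_integrable_integral_eq)
  qed
qed

lemma base_cell_lmeasurable: "base_cell k \<in> lmeasurable" "measure lebesgue (base_cell k) = \<epsilon> ^ CARD('d)"
proof -
  have eq: "base_cell k = (\<lambda>x. \<epsilon> *\<^sub>R x + \<epsilon> *\<^sub>R of_ints k) ` unit_cube"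
    by (simp add: base_cell_def scaleR_add_right)
  have "emeasure lebesgue (base_cell k) < \<infinity>"
    unfolding eq emeasure_lebesgue_affine using measure_unit_cube(2) eps
    by (auto simp: fmeasurable_def ennreal_mult_less_top)
  then show "base_cell k \<in> lmeasurable" using base_cell_sets by (simp add: fmeasurable_def)
  show "measure lebesgue (base_cell k) = \<epsilon> ^ CARD('d)"
    unfolding eq measure_lebesgue_affine measure_unit_cube(1) using eps by simp
qed

text \<open>The averaging operator in the coordinates of cell k: the normalising factor is the
  reciprocal of the measure of the base cell.\<close>

definition cell_average :: "((real ^ 'd) \<times> 'd pt \<Rightarrow> real) \<Rightarrow> int ^ 'd \<Rightarrow> 'd pt \<Rightarrow> real" where
  "cell_average \<phi> k y = inverse (\<epsilon> ^ CARD('d)) * (LINT x|lebesgue_on (base_cell k). \<phi> (x, y))"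

lemma averaging_op_tile:
  assumes y: "y \<in> Zs" shows "averaging_op \<epsilon> \<phi> (L.tile k y) = cell_average \<phi> k y"
proof -
  obtain u c where uc: "y = (u, c)" by (cases y)
  have u: "u \<in> unit_cube" using Zs_closure[OF y] Zs(4) uc by auto
  have i: "int_part ((\<epsilon> *\<^sub>R (u + of_ints k)) /\<^sub>R \<epsilon>) = of_ints k" by (simp only: int_part_\<kappa> \<kappa>_eq[OF u])
  have f: "frac_part ((\<epsilon> *\<^sub>R (u + of_ints k)) /\<^sub>R \<epsilon>) = u"
    unfolding frac_part_def i using eps by simp
  have "averaging_op \<epsilon> \<phi> (L.tile k y) = (LINT z|lebesgue_on unit_cube. \<phi> (\<epsilon> *\<^sub>R (z + of_ints k), y))"
    using eps i f by (simp add: averaging_op_def L.tile_def uc)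
  also have "\<dots> = cell_average \<phi> k y"
    unfolding cell_average_def base_cell_integral using eps by simp
  finally show ?thesis .
qed

lemma averaging_op_glue: "x \<in> layer \<Sigma> Zs \<epsilon> \<Longrightarrow> averaging_op \<epsilon> \<phi> x = glue (cell_average \<phi>) x"
  by (auto simp: L.tiles_def averaging_op_tile glue_tile' simp flip: tiles_layer)

lemma \<Sigma>_sets: "\<Sigma> \<in> sets lebesgue" using \<Sigma>_open by simp

text \<open>The second claim is Jensen's inequality for the mean, obtained from Cauchy-Schwarz
  against the constant 1, whose squared norm is the measure of the base cell.\<close>

lemma cell_average_H0:
  assumes \<phi>: "\<phi> \<in> elts (Z.L2V \<Sigma>)" and k: "k \<in> II"
  shows "cell_average \<phi> k \<in> elts Z.H0"
    "\<epsilon> ^ CARD('d) * (nrm Z.H0 (cell_average \<phi> k))\<^sup>2 \<le> (LINT x|lebesgue_on (base_cell k). (nrm Z.H0 (\<lambda>y. \<phi> (x, y)))\<^sup>2)"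
proof -
  let ?Q = "base_cell k" and ?d = "\<epsilon> ^ CARD('d)"
  have d: "?d > 0" using eps by simp
  have inv: "inverse ?d * ?d = 1" using eps by (intro left_inverse) simp
  have \<phi>Q: "\<phi> \<in> elts (Z.L2V ?Q)" by (rule Z.L2V_subset[OF \<phi> \<Sigma>_sets base_cell_sets base_cell_\<Sigma>[OF k]])
  note I = Z.L2V_integral[OF refl refl base_cell_lmeasurable(1) \<phi>Q]
  show A: "cell_average \<phi> k \<in> elts Z.H0" unfolding cell_average_def[abs_def] by (rule Z.H0.scale_elts[OF I(1)])
  let ?p = "\<lambda>x. nrm Z.H0 (\<lambda>y. \<phi> (x, y))"
  note p = Z.H0.bochner_l2_nrm_l2(1)[OF base_cell_sets Z.L2VD(2)[OF \<phi>Q]]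
  have one: "(\<lambda>_. 1 :: real) \<in> l2_on ?Q"
    using finite_measure.integrable_const[OF finite_measure_lebesgue_on[OF base_cell_lmeasurable(1)[of k]], of "1::real"] by (simp add: l2_on_def)
  have n1: "(l2_norm ?Q (\<lambda>_. 1))\<^sup>2 = ?d"
    unfolding l2_norm_power2[OF one] using base_cell_lmeasurable[of k] by (simp add: measure_restrict_space)
  have "nrm Z.H0 (cell_average \<phi> k) = inverse ?d * nrm Z.H0 (\<lambda>y. LINT x|lebesgue_on ?Q. \<phi> (x, y))"
    unfolding cell_average_def[abs_def] Z.H0.nrm_scale[OF I(1)] using d by simp
  also have "\<dots> \<le> inverse ?d * (LINT x|lebesgue_on ?Q. ?p x)" using I(2) d by (intro mult_left_mono) auto
  \<comment> \<open>Sections outside the carrier occur only on a null set, but the norm has no known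
    sign there; the absolute value avoids the issue.\<close>
  also have "\<dots> \<le> inverse ?d * (LINT x|lebesgue_on ?Q. \<bar>?p x\<bar>)"
    using d l2_on_integrable[OF p base_cell_lmeasurable(1)] by (intro mult_left_mono integral_mono) auto
  also have "\<dots> \<le> inverse ?d * (l2_norm ?Q (\<lambda>_. 1) * l2_norm ?Q ?p)"
    using d by (intro mult_left_mono l1_le_l2[OF base_cell_lmeasurable(1) p]) auto
  finally have "(nrm Z.H0 (cell_average \<phi> k))\<^sup>2 \<le> (inverse ?d * (l2_norm ?Q (\<lambda>_. 1) * l2_norm ?Q ?p))\<^sup>2"
    by (intro power_mono Z.H0.nrm_nonneg[OF A])
  also have "\<dots> = inverse ?d * (l2_norm ?Q ?p)\<^sup>2"
    unfolding power_mult_distrib n1 using inv by (simp add: power2_eq_square)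
  finally have "?d * (nrm Z.H0 (cell_average \<phi> k))\<^sup>2 \<le> ?d * (inverse ?d * (l2_norm ?Q ?p)\<^sup>2)"
    using d by (intro mult_left_mono) auto
  also have "\<dots> = (LINT x|lebesgue_on ?Q. (?p x)\<^sup>2)" 
    unfolding l2_norm_power2[OF p] mult.assoc[symmetric] mult.commute[of ?d "inverse ?d"] inv by simp
  finally show "?d * (nrm Z.H0 (cell_average \<phi> k))\<^sup>2 \<le> (LINT x|lebesgue_on ?Q. (?p x)\<^sup>2)" .
qed

lemma averaging_op_AE: "AE x in lebesgue_on (layer \<Sigma> Zs \<epsilon>). glue (cell_average \<phi>) x = averaging_op \<epsilon> \<phi> x"
  by (rule AE_I2) (simp add: averaging_op_glue)

text \<open>Gluing weighs each cell with the volume of its base cell, exactly the factor in the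
  estimate of the cell mean. Summing over the disjoint base cells inside \<Sigma> gives the bound
  with constant 1.\<close>

lemma averaging_op_H_layer:
  assumes \<phi>: "\<phi> \<in> elts (Z.L2V \<Sigma>)"
  shows "averaging_op \<epsilon> \<phi> \<in> elts Lay.H0" "nrm Lay.H0 (averaging_op \<epsilon> \<phi>) \<le> nrm (Z.L2V \<Sigma>) \<phi>"
proof -
  let ?p = "\<lambda>x. nrm Z.H0 (\<lambda>y. \<phi> (x, y))"
  note g = glue_H[of "cell_average \<phi>", OF cell_average_H0(1)[OF \<phi>]]
  note c = Lay.H0_AE_cong[OF g(1) averaging_op_AE]
  show "averaging_op \<epsilon> \<phi> \<in> elts Lay.H0" by (rule c(1))
  note p = Z.H0.bochner_l2_nrm_l2[OF \<Sigma>_sets Z.L2VD(2)[OF \<phi>]]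
  have ps: "integrable (lebesgue_on \<Sigma>) (\<lambda>x. (?p x)\<^sup>2)" using p(1) by (simp add: l2_on_def)
  have tsub: "Q.tiles \<subseteq> \<Sigma>" unfolding Q.tiles_def Q_tile using base_cell_\<Sigma> by blast
  have tsq: "integrable (lebesgue_on Q.tiles) (\<lambda>x. (?p x)\<^sup>2)"
    using l2_on_subset[OF p(1) \<Sigma>_sets Q.tiles_sets tsub] by (simp add: l2_on_def)
  have "(nrm Lay.H0 (averaging_op \<epsilon> \<phi>))\<^sup>2 = (\<Sum>k\<in>II. \<epsilon> ^ CARD('d) * (nrm Z.H0 (cell_average \<phi> k))\<^sup>2)"
    using c(2) g(2) by simp
  also have "\<dots> \<le> (\<Sum>k\<in>II. LINT x|lebesgue_on (base_cell k). (?p x)\<^sup>2)"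
    by (intro sum_mono cell_average_H0(2) \<phi>)
  also have "\<dots> = (\<Sum>k\<in>II. \<epsilon> ^ DIM(real ^ 'd) * (LINT z|lebesgue_on unit_cube. (?p (Q.tile k z))\<^sup>2))"
    by (simp add: base_cell_integral Q.tile_def)
  also have "\<dots> = (LINT x|lebesgue_on Q.tiles. (?p x)\<^sup>2)"
    by (rule Q.integrable_tilesI(2)[symmetric]) (rule Q.integrable_tilesD[OF tsq])
  \<comment> \<open>The admissible cells need not fill \<Sigma>; the part left out has a nonnegative
    integrand.\<close>
  also have "\<dots> \<le> (LINT x|lebesgue_on \<Sigma>. (?p x)\<^sup>2)"
    unfolding LINT_lebesgue_on[OF Q.tiles_sets] LINT_lebesgue_on[OF \<Sigma>_sets]
    using ps tsq tsub unfolding integrable_lebesgue_on[OF Q.tiles_sets] integrable_lebesgue_on[OF \<Sigma>_sets]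
    by (intro integral_mono) (auto simp: indicator_def)
  also have "\<dots> = (nrm (Z.L2V \<Sigma>) \<phi>)\<^sup>2"
    unfolding Z.L2V_def fspace.sel p(2) l2_norm_power2[OF p(1)] ..
  finally show "nrm Lay.H0 (averaging_op \<epsilon> \<phi>) \<le> nrm (Z.L2V \<Sigma>) \<phi>"
    by (rule power2_le_imp_le) (rule seminormed.nrm_nonneg[OF Z.seminormed_L2V[OF \<Sigma>_sets] \<phi>])
qed

text \<open>By Fubini almost every section of \<phi> and \<psi> over a base cell is integrable, and
  for those the mean is linear. On the remaining null set the default value of the integral may
  break linearity.\<close>

lemma averaging_op_comb:
  assumes \<phi>: "\<phi> \<in> elts (Z.L2V \<Sigma>)" and \<psi>: "\<psi> \<in> elts (Z.L2V \<Sigma>)"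
  shows "nrm Lay.H0 (\<lambda>x. averaging_op \<epsilon> (\<lambda>y. a * \<phi> y + b * \<psi> y) x - (a * averaging_op \<epsilon> \<phi> x + b * averaging_op \<epsilon> \<psi> x)) = 0"
proof -
  have comb: "(\<lambda>y. a * \<phi> y + b * \<psi> y) \<in> elts (Z.L2V \<Sigma>)"
    by (rule seminormed.comb_elts[OF Z.seminormed_L2V[OF \<Sigma>_sets] \<phi> \<psi>])
  have "AE x in lebesgue_on L.tiles. averaging_op \<epsilon> (\<lambda>y. a * \<phi> y + b * \<psi> y) x = a * averaging_op \<epsilon> \<phi> x + b * averaging_op \<epsilon> \<psi> x"
  proof (rule L.AE_tilesI)
    fix k assume k: "k \<in> II"
    have sec: "AE y in lebesgue_on Zs. integrable (lebesgue_on (base_cell k)) (\<lambda>x. \<theta> (x, y))" if "\<theta> \<in> elts (Z.L2V \<Sigma>)" for \<theta>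
      by (rule l2_on_Times_section(1)[OF base_cell_lmeasurable(1) Z.S_lmeasurable
            Z.L2VD(1)[OF Z.L2V_subset[OF that \<Sigma>_sets base_cell_sets base_cell_\<Sigma>[OF k]]]])
    show "AE y in lebesgue_on Zs. averaging_op \<epsilon> (\<lambda>y. a * \<phi> y + b * \<psi> y) (L.tile k y) =
        a * averaging_op \<epsilon> \<phi> (L.tile k y) + b * averaging_op \<epsilon> \<psi> (L.tile k y)"
      using sec[OF \<phi>] sec[OF \<psi>] AE_space
    proof eventually_elim
      case (elim y)
      then have y: "y \<in> Zs" by simp
      show ?case unfolding averaging_op_tile[OF y] cell_average_def using elim by (simp add: algebra_simps)
    qed
  qed
  then show ?thesis unfolding tiles_layer by (rule Lay.H0_AE_cong(3)[OF averaging_op_H_layer(1)[OF comb]])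
qed

end

subsection \<open>Adjointness and conclusion\<close>

context perforated
begin

text \<open>The index map takes floors and so partitions the base space into half-open cubes,
  whereas \<open>base_cell\<close> is open. They differ only on the grid hyperplanes.\<close>

lemma off_grid: "AE x in (lebesgue :: (real ^ 'd) measure). \<forall>i. \<forall>m::int. x $ i \<noteq> \<epsilon> * of_int m"
proof -
  have "AE x in (lebesgue :: (real ^ 'd) measure). x $ i \<noteq> \<epsilon> * of_int m" for i and m :: int
  proof -
    have "negligible {x :: real ^ 'd. x $ i = \<epsilon> * of_int m}" 
      using negligible_standard_hyperplane[of "axis i (1::real)" "\<epsilon> * of_int m"] by (simp add: inner_axis)
    then have "{x :: real ^ 'd. x $ i = \<epsilon> * of_int m} \<in> null_sets lebesgue" by (simp add: negligible_iff_null_sets)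
    from AE_not_in[OF this] show ?thesis by simp
  qed
  then show ?thesis by (simp add: AE_all_countable)
qed

lemma mem_base_cell:
  assumes x: "\<And>i (m::int). x $ i \<noteq> \<epsilon> * of_int m"
  shows "x \<in> base_cell k \<longleftrightarrow> \<kappa> x = k"
proof
  assume "x \<in> base_cell k" then show "\<kappa> x = k" by (auto simp: base_cell_def \<kappa>_eq)
next
  assume k: "\<kappa> x = k"
  define u where "u = x /\<^sub>R \<epsilon> - of_ints k"
  have u_i: "u $ i = x $ i / \<epsilon> - of_int \<lfloor>x $ i / \<epsilon>\<rfloor>" for i
    using k by (auto simp: u_def of_ints_def \<kappa>_def vec_eq_iff divide_inverse mult.commute)
  have "0 < u $ i \<and> u $ i < 1" for i
  proof -
    have "x $ i / \<epsilon> \<noteq> of_int \<lfloor>x $ i / \<epsilon>\<rfloor>" using x[of i "\<lfloor>x $ i / \<epsilon>\<rfloor>"] eps by (auto simp: field_simps)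
    then show ?thesis unfolding u_i by linarith
  qed
  then have "u \<in> unit_cube" by (simp add: unit_cube_def)
  moreover have "x = \<epsilon> *\<^sub>R (u + of_ints k)" using eps by (simp add: u_def)
  ultimately show "x \<in> base_cell k" by (auto simp: base_cell_def)
qed

text \<open>Whether the extension by zero applies depends on x alone, through its cell index, so the
  unfolded function is constant in x on each base cell.\<close>

lemma unfolding_op_eq:
  assumes y: "y \<in> Zs"
  shows "unfolding_op \<Sigma> Zs \<epsilon> v (x, y) = (if \<kappa> x \<in> II then v (L.tile (\<kappa> x) y) else 0)"
proof -
  have z: "\<epsilon> *\<^sub>R (int_part (x /\<^sub>R \<epsilon>), 0) + \<epsilon> *\<^sub>R y = L.tile (\<kappa> x) y"
    unfolding int_part_\<kappa> L.tile_def by (simp add: scaleR_add_right add.commute)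
  have "L.tile (\<kappa> x) y \<in> layer \<Sigma> Zs \<epsilon> \<longleftrightarrow> \<kappa> x \<in> II"
  proof
    assume "L.tile (\<kappa> x) y \<in> layer \<Sigma> Zs \<epsilon>"
    then obtain k w where k: "k \<in> II" "w \<in> Zs" "L.tile (\<kappa> x) y = L.tile k w"
      by (auto simp: L.tiles_def simp flip: tiles_layer)
    then have "\<kappa> x = k" using \<kappa>_tile[OF Zs_closure[OF y], of "\<kappa> x"] \<kappa>_tile[OF Zs_closure[OF k(2)], of k] by simp
    then show "\<kappa> x \<in> II" using k(1) by simp
  next
    assume "\<kappa> x \<in> II" then show "L.tile (\<kappa> x) y \<in> layer \<Sigma> Zs \<epsilon>"
      using y by (auto simp: L.tiles_def simp flip: tiles_layer)
  qed
  then show ?thesis unfolding unfolding_op_def Let_def prod.case z by simp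
qed

text \<open>The unfolded function does not depend on x within a base cell, so integrating its
  product with \<phi> over that cell leaves only the mean of \<phi>. Base points of other cells
  contribute zero to the left side.\<close>

lemma unfolding_adjoint:
  assumes v: "v \<in> l2_on (layer \<Sigma> Zs \<epsilon>)" and \<phi>: "\<phi> \<in> elts (Z.L2V \<Sigma>)"
  shows "l2_inner (\<Sigma> \<times> Zs) (unfolding_op \<Sigma> Zs \<epsilon> v) \<phi> = 1 / \<epsilon> * l2_inner (layer \<Sigma> Zs \<epsilon>) v (averaging_op \<epsilon> \<phi>)"
proof -
  let ?d = "\<epsilon> ^ CARD('d)"
  let ?h = "\<lambda>k z. v (L.tile k (snd z)) * \<phi> z"
  have inv: "?d * inverse ?d = 1" using eps by (intro right_inverse) simp
  have T: "\<Sigma> \<times> Zs \<in> sets lebesgue" by (rule Times_sets_lebesgue[OF \<Sigma>_sets Z.S_lebesgue])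
  have Tk: "base_cell k \<times> Zs \<in> sets lebesgue" for k by (rule Times_sets_lebesgue[OF base_cell_sets Z.S_lebesgue])
  have vk: "(\<lambda>y. v (L.tile k y)) \<in> l2_on Zs" if "k \<in> II" for k
    using v that unfolding tiles_layer[symmetric] L.l2_on_tiles by blast
  have \<phi>k: "\<phi> \<in> l2_on (base_cell k \<times> Zs)" if "k \<in> II" for k
    by (rule Z.L2VD(1)[OF Z.L2V_subset[OF \<phi> \<Sigma>_sets base_cell_sets base_cell_\<Sigma>[OF that]]])
  have hi: "integrable (lebesgue_on (base_cell k \<times> Zs)) (?h k)" if "k \<in> II" for k
    by (rule l2_on_mult_integrable[OF l2_on_snd[OF base_cell_lmeasurable(1) Z.S_lebesgue vk[OF that]] \<phi>k[OF that]])
  have al: "averaging_op \<epsilon> \<phi> \<in> l2_on (layer \<Sigma> Zs \<epsilon>)" by (rule Lay.H0_l2[OF averaging_op_H_layer(1)[OF \<phi>]])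
  \<comment> \<open>The Jacobian has one power of \<epsilon> more than \<open>?d\<close>, which the
    prefactor removes; \<open>?d\<close> then cancels the normalisation of the mean.\<close>
  have "1 / \<epsilon> * l2_inner (layer \<Sigma> Zs \<epsilon>) v (averaging_op \<epsilon> \<phi>) =
     (\<Sum>k\<in>II. ?d * l2_inner Zs (\<lambda>y. v (L.tile k y)) (\<lambda>y. averaging_op \<epsilon> \<phi> (L.tile k y)))"
    using L.l2_inner_tiles[unfolded tiles_layer, OF v al] eps by (simp add: sum_distrib_left)
  also have "\<dots> = (\<Sum>k\<in>II. LINT z|lebesgue_on (base_cell k \<times> Zs). ?h k z)"
  proof (rule sum.cong[OF refl])
    fix k assume k: "k \<in> II"
    have "?d * l2_inner Zs (\<lambda>y. v (L.tile k y)) (\<lambda>y. averaging_op \<epsilon> \<phi> (L.tile k y)) =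
      ?d * (LINT y|lebesgue_on Zs. inverse ?d * (LINT x|lebesgue_on (base_cell k). ?h k (x, y)))"
      unfolding l2_inner_def
      by (intro arg_cong[of _ _ "(*) ?d"] Bochner_Integration.integral_cong refl) (simp add: averaging_op_tile cell_average_def)
    also have "\<dots> = (?d * inverse ?d) * (LINT y|lebesgue_on Zs. LINT x|lebesgue_on (base_cell k). ?h k (x, y))"
      by (simp only: integral_mult_right_zero mult.assoc)
    also have "\<dots> = (LINT z|lebesgue_on (base_cell k \<times> Zs). ?h k z)"
      unfolding inv lebesgue_on_Times_section(3)[OF base_cell_sets Z.S_lebesgue hi[OF k]] by simp
    finally show "?d * l2_inner Zs (\<lambda>y. v (L.tile k y)) (\<lambda>y. averaging_op \<epsilon> \<phi> (L.tile k y)) =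
      (LINT z|lebesgue_on (base_cell k \<times> Zs). ?h k z)" .
  qed
  also have "\<dots> = (\<Sum>k\<in>II. LINT z|lebesgue. indicator (base_cell k \<times> Zs) z * ?h k z)"
    by (simp add: LINT_lebesgue_on[OF Tk])
  also have "\<dots> = (LINT z|lebesgue. (\<Sum>k\<in>II. indicator (base_cell k \<times> Zs) z * ?h k z))"
    using hi unfolding integrable_lebesgue_on[OF Tk] by (rule Bochner_Integration.integral_sum[symmetric])
  also have "\<dots> = (LINT z|lebesgue. indicator (\<Sigma> \<times> Zs) z * (unfolding_op \<Sigma> Zs \<epsilon> v z * \<phi> z))"
  proof (rule integral_cong_AE)
    show m: "(\<lambda>z. \<Sum>k\<in>II. indicator (base_cell k \<times> Zs) z * ?h k z) \<in> borel_measurable lebesgue"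
      using hi unfolding integrable_lebesgue_on[OF Tk] by (intro borel_measurable_sum) auto
    show ae: "AE z in lebesgue. (\<Sum>k\<in>II. indicator (base_cell k \<times> Zs) z * ?h k z) =
        indicator (\<Sigma> \<times> Zs) z * (unfolding_op \<Sigma> Zs \<epsilon> v z * \<phi> z)"
      using AE_lebesgue_fst[OF off_grid]
    proof eventually_elim
      case (elim z)
      obtain x y where z: "z = (x, y)" by (cases z)
      have mem: "x \<in> base_cell k \<longleftrightarrow> \<kappa> x = k" for k by (rule mem_base_cell) (use elim z in auto)
      show ?case
      proof (cases "y \<in> Zs")
        case True
        have "(\<Sum>k\<in>II. indicator (base_cell k \<times> Zs) z * ?h k z) = (\<Sum>k\<in>II. if k = \<kappa> x then ?h k z else 0)"
          using True mem by (intro sum.cong) (auto simp: z indicator_times indicator_def)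
        also have "\<dots> = (if \<kappa> x \<in> II then ?h (\<kappa> x) z else 0)" using finite_II by simp
        also have "\<dots> = indicator (\<Sigma> \<times> Zs) z * (unfolding_op \<Sigma> Zs \<epsilon> v z * \<phi> z)"
        proof -
          have "\<kappa> x \<in> II \<Longrightarrow> x \<in> \<Sigma>" using base_cell_\<Sigma>[of "\<kappa> x"] mem[of "\<kappa> x"] by blast
          then show ?thesis using True by (auto simp: z unfolding_op_eq indicator_times)
        qed
        finally show ?thesis .
      qed (simp add: z indicator_times)
    qed
    \<comment> \<open>Joint measurability of the unfolded product is inherited from the finite sum
      over cells through equality almost everywhere.\<close>
    show "(\<lambda>z. indicator (\<Sigma> \<times> Zs) z * (unfolding_op \<Sigma> Zs \<epsilon> v z * \<phi> z)) \<in> borel_measurable lebesgue"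
      by (rule borel_measurable_AE[OF m ae])
  qed
  also have "\<dots> = l2_inner (\<Sigma> \<times> Zs) (unfolding_op \<Sigma> Zs \<epsilon> v) \<phi>"
    by (simp add: l2_inner_def LINT_lebesgue_on[OF T])
  finally show ?thesis by simp
qed

sublocale PB: dual_pullback Lay.H0 "Z.L2V \<Sigma>" "1 / \<epsilon>" "averaging_op \<epsilon>"
  by (intro dual_pullback.intro dual_pullback_axioms.intro Lay.H0.seminormed_axioms Z.seminormed_L2V[OF \<Sigma>_sets]
      averaging_op_H_layer averaging_op_comb)

end

theorem proposition2:
  fixes \<Sigma> :: "(real ^ 'd::finite) set" and Zs :: "'d pt set" and \<epsilon> H T :: real
    and v :: "real \<Rightarrow> 'd pt \<Rightarrow> real"
  assumes "H > 0" and "T > 0" and "\<epsilon> > 0" and "inverse \<epsilon> \<in> \<nat>"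
    and "connected \<Sigma>" and "lipschitz_domain \<Sigma>"
    and "reference_cell Zs"
    and "lipschitz_domain (whole_domain \<Sigma> H Zs \<epsilon>)"
    and "v \<in> bochner_l2 (lebesgue_on {0<..<T}) (L2 (layer \<Sigma> Zs \<epsilon>))"
    and "(\<lambda>t. pivot (layer \<Sigma> Zs \<epsilon>) (v t)) \<in> bochner_h1 T (dual (H_layer \<Sigma> Zs \<epsilon>))"
  shows "(\<lambda>t. pivot (\<Sigma> \<times> Zs) (unfolding_op \<Sigma> Zs \<epsilon> (v t))) \<in> bochner_h1 T (dual (L2_H_cell \<Sigma> Zs))
    \<and> (\<forall>dv dTv.
         has_time_deriv T (dual (H_layer \<Sigma> Zs \<epsilon>)) (\<lambda>t. pivot (layer \<Sigma> Zs \<epsilon>) (v t)) dv \<longrightarrow>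
         has_time_deriv T (dual (L2_H_cell \<Sigma> Zs))
           (\<lambda>t. pivot (\<Sigma> \<times> Zs) (unfolding_op \<Sigma> Zs \<epsilon> (v t))) dTv \<longrightarrow>
         (AE t in lebesgue_on {0<..<T}. \<forall>\<phi>\<in>elts (L2_H_cell \<Sigma> Zs).
            dTv t \<phi> = 1 / \<epsilon> * dv t (averaging_op \<epsilon> \<phi>)) \<and>
         bochner_l2_norm (lebesgue_on {0<..<T}) (dual (L2_H_cell \<Sigma> Zs)) dTv
           \<le> 1 / \<epsilon> * bochner_l2_norm (lebesgue_on {0<..<T}) (dual (H_layer \<Sigma> Zs \<epsilon>)) dv)"
proof -
  interpret perforated \<Sigma> Zs \<epsilon>
    using assms(3,6,7) by unfold_locales (auto simp: lipschitz_domain_def)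
  let ?M = "lebesgue_on {0<..<T}"
  let ?u = "\<lambda>t. pivot (layer \<Sigma> Zs \<epsilon>) (v t)" and ?u' = "\<lambda>t. pivot (\<Sigma> \<times> Zs) (unfolding_op \<Sigma> Zs \<epsilon> (v t))"
  have C: "complete_measure ?M" by (simp add: complete_measure_lebesgue_on)
  \<comment> \<open>Where \<open>v t\<close> is square integrable, adjointness says that the pivot
    functional of the unfolded function is the pullback of that of \<open>v t\<close>.\<close>
  have "AE t in ?M. v t \<in> l2_on (layer \<Sigma> Zs \<epsilon>)" using assms(9) by (auto simp: bochner_l2_def)
  then have lu: "PB.lifts ?M ?u ?u'"
    unfolding PB.lifts_def by eventually_elim (simp add: PB.pb_def pivot_def unfolding_adjoint)
  have lift: "has_time_deriv T (dual (Z.L2V \<Sigma>)) ?u' (\<lambda>t. PB.pb (dv t))" if "has_time_deriv T (dual Lay.H0) ?u dv" for dv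
    by (rule PB.has_time_deriv_lift[OF that lu]) (simp add: PB.lifts_def)
  have ex: "?u' \<in> bochner_h1 T (dual (Z.L2V \<Sigma>))"
    using assms(10) lift unfolding bochner_h1_def H_layer_eq by blast
  have main: "(AE t in ?M. \<forall>\<phi>\<in>elts (Z.L2V \<Sigma>). dTv t \<phi> = 1 / \<epsilon> * dv t (averaging_op \<epsilon> \<phi>)) \<and>
      bochner_l2_norm ?M (dual (Z.L2V \<Sigma>)) dTv \<le> 1 / \<epsilon> * bochner_l2_norm ?M (dual Lay.H0) dv"
    if dv: "has_time_deriv T (dual Lay.H0) ?u dv" and dTv: "has_time_deriv T (dual (Z.L2V \<Sigma>)) ?u' dTv" for dv dTv
  proof
    \<comment> \<open>\<open>dTv\<close> is an arbitrary generalized derivative. The pullback of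
      \<open>dv\<close> is another one, and uniqueness identifies them outside one null set common
      to all \<phi>.\<close>
    have eq: "AE t in ?M. \<forall>\<phi>\<in>elts (Z.L2V \<Sigma>). dTv t \<phi> = PB.pb (dv t) \<phi>"
      using PB.Y.time_deriv_unique[OF dTv lift[OF dv]] by eventually_elim blast
    then show "AE t in ?M. \<forall>\<phi>\<in>elts (Z.L2V \<Sigma>). dTv t \<phi> = 1 / \<epsilon> * dv t (averaging_op \<epsilon> \<phi>)"
      by (simp add: PB.pb_def)
    have mem: "dv \<in> bochner_l2 ?M (dual Lay.H0)" "dTv \<in> bochner_l2 ?M (dual (Z.L2V \<Sigma>))"
      using dv dTv by (simp_all add: has_time_deriv_def)
    note D = PB.DX.bochner_l2D[OF C mem(1)] and DT = PB.DY.bochner_l2D[OF C mem(2)]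
    have le: "AE t in ?M. nrm (dual (Z.L2V \<Sigma>)) (dTv t) \<le> \<bar>1 / \<epsilon>\<bar> * nrm (dual Lay.H0) (dv t)"
      using PB.lifts_elts(2)[OF _ D(1), of dTv] eq by (simp add: PB.lifts_def)
    have "(LINT t|?M. (nrm (dual (Z.L2V \<Sigma>)) (dTv t))\<^sup>2) \<le> (LINT t|?M. (1 / \<epsilon>)\<^sup>2 * (nrm (dual Lay.H0) (dv t))\<^sup>2)"
    proof (rule integral_mono_AE[OF DT(3) integrable_mult_right[OF D(3)]])
      show "AE t in ?M. (nrm (dual (Z.L2V \<Sigma>)) (dTv t))\<^sup>2 \<le> (1 / \<epsilon>)\<^sup>2 * (nrm (dual Lay.H0) (dv t))\<^sup>2"
        using le DT(1)
      proof eventually_elim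
        case (elim t)
        then have "(nrm (dual (Z.L2V \<Sigma>)) (dTv t))\<^sup>2 \<le> (\<bar>1 / \<epsilon>\<bar> * nrm (dual Lay.H0) (dv t))\<^sup>2"
          by (intro power_mono PB.Y.dual_nonneg)
        then show ?case by (simp add: power_mult_distrib power_divide)
      qed
    qed
    then have "sqrt (LINT t|?M. (nrm (dual (Z.L2V \<Sigma>)) (dTv t))\<^sup>2) \<le> sqrt ((1 / \<epsilon>)\<^sup>2 * (LINT t|?M. (nrm (dual Lay.H0) (dv t))\<^sup>2))"
      by (intro real_sqrt_le_mono) simp
    then show "bochner_l2_norm ?M (dual (Z.L2V \<Sigma>)) dTv \<le> 1 / \<epsilon> * bochner_l2_norm ?M (dual Lay.H0) dv"
      unfolding bochner_l2_norm_def real_sqrt_mult real_sqrt_abs using eps by simp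
  qed
  show ?thesis
    unfolding H_layer_eq L2_H_cell_eq using ex main by blast
qed

end
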